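(* Let $\acute N$ be an isotropic screen transversal lightlike submanifold of a locally metallic semi-Riemannian manifold $(\breve N,\breve g,\breve J)$. Then $\acute N$ is totally geodesic if and only if, for all $\xi_1,\xi_2\in\Gamma(Rad(T\acute N))$, $N\in\Gamma(ltr(T\acute N))$ and $Z\in\Gamma(D_o)$, one has $D^{\ell}(\xi_1,\breve J\xi_2)=0$, $D^{\ell}(\xi_1,Z)=0$, and there is no component of $D^s(\xi_1,N)$ in $\breve J\,Rad(T\acute N)$.
   Context: Fix positive integers $p,q$. A metallic semi-Riemannian manifold $(\breve N,\breve g,\breve J)$ is a semi-Riemannian manifold $(\breve N,\breve g)$ with a $(1,1)$-tensor field $\breve J$ such that $\breve J^2=p\breve J+qI$ and $\breve g(\breve JW,U)=\breve g(W,\breve JU)$ for all vector fields $W,U$ on $\breve N$. It is locally metallic if $\breve\nabla\breve J=0$, where $\breve\nabla$ is the Levi-Civita connection of $\breve g$. A submanifold $\acute N$ of dimension $m$ and codimension $k$ in $\breve N$ is lightlike if the metric $g$ induced from $\breve g$ is degenerate and $Rad(T\acute N)=T\acute N\cap T\acute N^{\perp}$ is a distribution of constant rank $r$, $1\le r\le m$. It is isotropic if $r=m<k$, so that $T\acute N=Rad(T\acute N)$ and the screen distribution is $S(T\acute N)=\{0\}$. Fix a screen transversal bundle $S(T\acute N^{\perp})$ (non-degenerate complement of $Rad(T\acute N)$ in $T\acute N^{\perp}$), and the associated lightlike transversal bundle $ltr(T\acute N)$: it is orthogonal to $S(T\acute N^\perp)$, and for any local basis $\{\xi_i\}$ of $Rad(T\acute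 N)$ it is locally spanned by $\{N_i\}$ with $\breve g(\xi_i,N_j)=\delta_{ij}$, $\breve g(N_i,N_j)=0$. $\acute N$ is an isotropic screen transversal lightlike submanifold if it is isotropic and $\breve J\,Rad(T\acute N)\subset S(T\acute N^\perp)$. Throughout, $\breve J\,ltr(T\acute N)\subset S(T\acute N^\perp)$ as well, and (with $\oplus_{ort}$ denoting orthogonal direct sum) $T\breve N|_{\acute N}=\{T\acute N\oplus ltr(T\acute N)\}\oplus_{ort}\{\breve J\,Rad(T\acute N)\oplus\breve J\,ltr(T\acute N)\}\oplus_{ort}D_o$, where $D_o$ is the orthogonal complement of $\breve J\,Rad(T\acute N)\oplus\breve J\,ltr(T\acute N)$ in $S(T\acute N^\perp)$. For $W,U\in\Gamma(T\acute N)$, $N\in\Gamma(ltr(T\acute N))$ and $Z\in\Gamma(S(T\acute N^\perp))$ write $\breve\nabla_WU=\nabla_WU+h^{\ell}(W,U)+h^s(W,U)$, $\breve\nabla_WN=-A_NW+\nabla^{\ell}_WN+D^s(W,N)$, $\breve\nabla_WZ=-A_ZW+\nabla^s_WZ+D^{\ell}(W,Z)$, where $\nabla_WU,A_NW,A_ZW\in\Gamma(T\acute N)$; $h^\ell(W,U),\nabla^\ell_WN,D^\ell(W,Z)\in\Gamma(ltr(T\acute N))$; $h^s(W,U),D^s(W,N),\nabla^s_WZ\in\Gamma(S(T\acute N^\perp))$. $\acute N$ is totally geodesic if its second fundamental form vanishes: $h^{\ell}=0$ and $h^s=0$. A section $X$ is said to have no component in $\breve J\,Rad(T\acute N)$ if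 $\breve g(X,\breve J\xi)=0$ for all $\xi\in\Gamma(Rad(T\acute N))$. *)

theory Defs
  imports "HOL-Analysis.Analysis" "HOL-Library.Function_Algebras"
begin

section \<open>Smooth manifolds\<close>

text \<open>Real-valued functions form a real vector space under the pointwise operations.
  Tangent vectors are derivations, i.e. functionals, and live in such a function space.\<close>

instantiation "fun" :: (type, real_vector) real_vector
begin

definition scaleR_fun :: "real \<Rightarrow> ('a \<Rightarrow> 'b) \<Rightarrow> 'a \<Rightarrow> 'b" where
  "scaleR_fun c f = (\<lambda>x. c *\<^sub>R f x)"

instance
  by standard (simp_all add: scaleR_fun_def fun_eq_iff algebra_simps)

end

text \<open>\<open>Ck_on k S f\<close>, for open \<open>S\<close> in a Euclidean space: \<open>f\<close> is of class \<open>C\<^sup>k\<close> on \<open>S\<close>.\<close>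

primrec Ck_on :: "nat \<Rightarrow> 'a::euclidean_space set \<Rightarrow> ('a \<Rightarrow> 'b::real_normed_vector) \<Rightarrow> bool" where
  "Ck_on 0 S f \<longleftrightarrow> continuous_on S f"
| "Ck_on (Suc k) S f \<longleftrightarrow>
     (\<forall>x\<in>S. f differentiable (at x)) \<and>
     (\<forall>v. Ck_on k S (\<lambda>x. frechet_derivative f (at x) v))"

definition smooth_on :: "'a::euclidean_space set \<Rightarrow> ('a \<Rightarrow> 'b::real_normed_vector) \<Rightarrow> bool" where
  "smooth_on S f \<longleftrightarrow> (\<forall>k. Ck_on k S f)"

text \<open>A chart is a domain together with a coordinate map, of which only the restriction to the
  domain matters.  An atlas need not be maximal.\<close>

type_synonym ('a, 'e) atlas = "('a set \<times> ('a \<Rightarrow> 'e)) set"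

definition smooth_manifold ::
  "('a::{t2_space, second_countable_topology}, 'e::euclidean_space) atlas \<Rightarrow> bool" where
  "smooth_manifold \<A> \<longleftrightarrow>
     (\<Union>(D, \<phi>)\<in>\<A>. D) = UNIV \<and>
     (\<forall>(D, \<phi>)\<in>\<A>. open D \<and> open (\<phi> ` D) \<and> (\<exists>\<psi>. homeomorphism D (\<phi> ` D) \<phi> \<psi>)) \<and>
     (\<forall>(D, \<phi>)\<in>\<A>. \<forall>(D', \<phi>')\<in>\<A>. smooth_on (\<phi> ` (D \<inter> D')) (\<phi>' \<circ> inv_into D \<phi>))"

definition smooth_fun ::
  "('a::topological_space, 'e::euclidean_space) atlas \<Rightarrow> 'a set \<Rightarrow> ('a \<Rightarrow> 'v::real_normed_vector) \<Rightarrow> bool"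
  where
  "smooth_fun \<A> U f \<longleftrightarrow> (\<forall>(D, \<phi>)\<in>\<A>. smooth_on (\<phi> ` (U \<inter> D)) (f \<circ> inv_into D \<phi>))"

definition smooth_near ::
  "('a::topological_space, 'e::euclidean_space) atlas \<Rightarrow> 'a \<Rightarrow> ('a \<Rightarrow> 'v::real_normed_vector) \<Rightarrow> bool"
  where
  "smooth_near \<A> x f \<longleftrightarrow> (\<exists>U. open U \<and> x \<in> U \<and> smooth_fun \<A> U f)"

definition smooth_map ::
  "('b::topological_space, 'd::euclidean_space) atlas \<Rightarrow>
   ('a::topological_space, 'e::euclidean_space) atlas \<Rightarrow> ('b \<Rightarrow> 'a) \<Rightarrow> bool" where
  "smooth_map \<B> \<A> \<iota> \<longleftrightarrow>
     continuous_on UNIV \<iota> \<and> (\<forall>(D, \<phi>)\<in>\<A>. smooth_fun \<B> (\<iota> -` D) (\<phi> \<circ> \<iota>))"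

text \<open>A tangent vector at \<open>x\<close> is a derivation of the algebra of germs at \<open>x\<close> of smooth functions.
  It is represented as a functional on all functions which depends only on the germ and which, to
  make the representation unique, is \<open>0\<close> on functions that are not smooth near \<open>x\<close>.\<close>

type_synonym 'a tvec = "('a \<Rightarrow> real) \<Rightarrow> real"

definition tangent_space ::
  "('a::topological_space, 'e::euclidean_space) atlas \<Rightarrow> 'a \<Rightarrow> 'a tvec set" where
  "tangent_space \<A> x = {v.
     (\<forall>f h. smooth_near \<A> x f \<and> smooth_near \<A> x h \<longrightarrow>
        v (\<lambda>z. f z + h z) = v f + v h \<and>
        v (\<lambda>z. f z * h z) = v f * h x + f x * v h) \<and>
     (\<forall>c f. smooth_near \<A> x f \<longrightarrow> v (\<lambda>z. c * f z) = c * v f) \<and>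
     (\<forall>f h. smooth_near \<A> x f \<and> eventually (\<lambda>z. f z = h z) (nhds x) \<longrightarrow> v f = v h) \<and>
     (\<forall>f. \<not> smooth_near \<A> x f \<longrightarrow> v f = 0)}"

definition pushforward ::
  "('a::topological_space, 'e::euclidean_space) atlas \<Rightarrow> ('b \<Rightarrow> 'a) \<Rightarrow> 'b \<Rightarrow> 'b tvec \<Rightarrow> 'a tvec" where
  "pushforward \<A> \<iota> y w = (\<lambda>f. if smooth_near \<A> (\<iota> y) f then w (f \<circ> \<iota>) else 0)"

text \<open>An immersed submanifold: the image of an injective immersion \<open>\<iota>\<close> of a manifold which carries
  its own topology and atlas.\<close>

definition submanifold ::
  "('b::{t2_space, second_countable_topology}, 'd::euclidean_space) atlas \<Rightarrow>
   ('a::topological_space, 'e::euclidean_space) atlas \<Rightarrow> ('b \<Rightarrow> 'a) \<Rightarrow> bool" where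
  "submanifold \<B> \<A> \<iota> \<longleftrightarrow>
     smooth_manifold \<B> \<and> smooth_map \<B> \<A> \<iota> \<and> inj \<iota> \<and>
     (\<forall>y. inj_on (pushforward \<A> \<iota> y) (tangent_space \<B> y))"

text \<open>Smooth sections over an open set \<open>A\<close> of the pulled back tangent bundle \<open>\<iota>\<^sup>*TM\<close> (vector
  fields along \<open>\<iota>\<close>).  Vector fields on a manifold are the case \<open>\<iota> = id\<close>.\<close>

definition section_along ::
  "('b::topological_space, 'd::euclidean_space) atlas \<Rightarrow>
   ('a::topological_space, 'e::euclidean_space) atlas \<Rightarrow> ('b \<Rightarrow> 'a) \<Rightarrow> 'b set \<Rightarrow>
   ('b \<Rightarrow> 'a tvec) \<Rightarrow> bool" where
  "section_along \<B> \<A> \<iota> A V \<longleftrightarrow>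
     (\<forall>y\<in>A. V y \<in> tangent_space \<A> (\<iota> y)) \<and>
     (\<forall>U f. open U \<and> smooth_fun \<A> U (f :: 'a \<Rightarrow> real) \<longrightarrow>
        smooth_fun \<B> (A \<inter> \<iota> -` U) (\<lambda>y. V y f))"

definition section_near ::
  "('b::topological_space, 'd::euclidean_space) atlas \<Rightarrow>
   ('a::topological_space, 'e::euclidean_space) atlas \<Rightarrow> ('b \<Rightarrow> 'a) \<Rightarrow> 'b \<Rightarrow>
   ('b \<Rightarrow> 'a tvec) \<Rightarrow> bool" where
  "section_near \<B> \<A> \<iota> y V \<longleftrightarrow> (\<exists>A. open A \<and> y \<in> A \<and> section_along \<B> \<A> \<iota> A V)"

abbreviation vector_field ::
  "('a::topological_space, 'e::euclidean_space) atlas \<Rightarrow> 'a set \<Rightarrow> ('a \<Rightarrow> 'a tvec) \<Rightarrow> bool" where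
  "vector_field \<A> \<equiv> section_along \<A> \<A> id"

definition lie_bracket ::
  "('a::topological_space, 'e::euclidean_space) atlas \<Rightarrow>
   ('a \<Rightarrow> 'a tvec) \<Rightarrow> ('a \<Rightarrow> 'a tvec) \<Rightarrow> 'a \<Rightarrow> 'a tvec" where
  "lie_bracket \<A> X Y x =
     (\<lambda>f. if smooth_near \<A> x f then X x (\<lambda>z. Y z f) - Y x (\<lambda>z. X z f) else 0)"

text \<open>A family \<open>E\<close> of subspaces is a smooth subbundle of \<open>\<iota>\<^sup>*TM\<close> of rank \<open>n\<close> if it has smooth
  local frames.\<close>

definition smooth_frame ::
  "('b::topological_space, 'd::euclidean_space) atlas \<Rightarrow>
   ('a::topological_space, 'e::euclidean_space) atlas \<Rightarrow> ('b \<Rightarrow> 'a) \<Rightarrow>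
   ('b \<Rightarrow> 'a tvec set) \<Rightarrow> nat \<Rightarrow> 'b set \<Rightarrow> (nat \<Rightarrow> 'b \<Rightarrow> 'a tvec) \<Rightarrow> bool" where
  "smooth_frame \<B> \<A> \<iota> E n A F \<longleftrightarrow>
     (\<forall>i<n. section_along \<B> \<A> \<iota> A (F i)) \<and>
     (\<forall>y\<in>A. inj_on (\<lambda>i. F i y) {..<n} \<and> independent ((\<lambda>i. F i y) ` {..<n}) \<and>
             span ((\<lambda>i. F i y) ` {..<n}) = E y)"

definition smooth_subbundle ::
  "('b::topological_space, 'd::euclidean_space) atlas \<Rightarrow>
   ('a::topological_space, 'e::euclidean_space) atlas \<Rightarrow> ('b \<Rightarrow> 'a) \<Rightarrow>
   ('b \<Rightarrow> 'a tvec set) \<Rightarrow> nat \<Rightarrow> bool" where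
  "smooth_subbundle \<B> \<A> \<iota> E n \<longleftrightarrow>
     (\<forall>y. \<exists>A F. open A \<and> y \<in> A \<and> smooth_frame \<B> \<A> \<iota> E n A F)"

text \<open>\<open>\<Gamma>(E)\<close>, and the vector fields on the submanifold whose images under \<open>d\<iota>\<close> lie in \<open>E\<close>.
  The latter represent the sections of subbundles of the tangent bundle of the submanifold.\<close>

definition sections ::
  "('b::topological_space, 'd::euclidean_space) atlas \<Rightarrow>
   ('a::topological_space, 'e::euclidean_space) atlas \<Rightarrow> ('b \<Rightarrow> 'a) \<Rightarrow>
   ('b \<Rightarrow> 'a tvec set) \<Rightarrow> ('b \<Rightarrow> 'a tvec) set" where
  "sections \<B> \<A> \<iota> E = {V. section_along \<B> \<A> \<iota> UNIV V \<and> (\<forall>y. V y \<in> E y)}"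

definition tangent_sections ::
  "('b::topological_space, 'd::euclidean_space) atlas \<Rightarrow>
   ('a::topological_space, 'e::euclidean_space) atlas \<Rightarrow> ('b \<Rightarrow> 'a) \<Rightarrow>
   ('b \<Rightarrow> 'a tvec set) \<Rightarrow> ('b \<Rightarrow> 'b tvec) set" where
  "tangent_sections \<B> \<A> \<iota> E =
     {X. vector_field \<B> UNIV X \<and> (\<forall>y. pushforward \<A> \<iota> y (X y) \<in> E y)}"


section \<open>Metrics, connections, metallic structures\<close>

text \<open>The last clause is the constancy of the index, the maximal dimension of a negative definite
  subspace of a tangent space.\<close>

definition semi_riemannian ::
  "('a::topological_space, 'e::euclidean_space) atlas \<Rightarrow>
   ('a \<Rightarrow> 'a tvec \<Rightarrow> 'a tvec \<Rightarrow> real) \<Rightarrow> bool" where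
  "semi_riemannian \<A> g \<longleftrightarrow>
     (\<forall>x. \<forall>u\<in>tangent_space \<A> x. \<forall>v\<in>tangent_space \<A> x. g x u v = g x v u) \<and>
     (\<forall>x. \<forall>u\<in>tangent_space \<A> x. \<forall>v\<in>tangent_space \<A> x. \<forall>w\<in>tangent_space \<A> x. \<forall>c.
        g x (c *\<^sub>R u + v) w = c * g x u w + g x v w) \<and>
     (\<forall>x. \<forall>u\<in>tangent_space \<A> x. (\<forall>v\<in>tangent_space \<A> x. g x u v = 0) \<longrightarrow> u = 0) \<and>
     (\<forall>A X Y. open A \<and> vector_field \<A> A X \<and> vector_field \<A> A Y \<longrightarrow>
        smooth_fun \<A> A (\<lambda>x. g x (X x) (Y x))) \<and>
     (\<exists>\<nu>. \<forall>x. let neg = {S. subspace S \<and> S \<subseteq> tangent_space \<A> x \<and> (\<forall>u\<in>S. u \<noteq> 0 \<longrightarrow> g x u u < 0)}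
          in (\<exists>S\<in>neg. dim S = \<nu>) \<and> (\<forall>S\<in>neg. dim S \<le> \<nu>))"

text \<open>A connection on \<open>\<iota>\<^sup>*TM\<close>: \<open>D y w V\<close> is the covariant derivative at \<open>y\<close>, in the direction
  \<open>w\<close>, of a section \<open>V\<close> defined and smooth near \<open>y\<close>.  An affine connection is the case
  \<open>\<iota> = id\<close>.  Taking \<open>f\<close> in the Leibniz rule locally constant, but not constant, shows that
  \<open>D y w V\<close> depends only on the germ of \<open>V\<close> at \<open>y\<close>.\<close>

definition connection_along ::
  "('b::topological_space, 'd::euclidean_space) atlas \<Rightarrow>
   ('a::topological_space, 'e::euclidean_space) atlas \<Rightarrow> ('b \<Rightarrow> 'a) \<Rightarrow>
   ('b \<Rightarrow> 'b tvec \<Rightarrow> ('b \<Rightarrow> 'a tvec) \<Rightarrow> 'a tvec) \<Rightarrow> bool" where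
  "connection_along \<B> \<A> \<iota> D \<longleftrightarrow>
     (\<forall>y. \<forall>w\<in>tangent_space \<B> y. \<forall>V. section_near \<B> \<A> \<iota> y V \<longrightarrow>
        D y w V \<in> tangent_space \<A> (\<iota> y)) \<and>
     (\<forall>y. \<forall>w\<in>tangent_space \<B> y. \<forall>w'\<in>tangent_space \<B> y. \<forall>c V. section_near \<B> \<A> \<iota> y V \<longrightarrow>
        D y (c *\<^sub>R w + w') V = c *\<^sub>R D y w V + D y w' V) \<and>
     (\<forall>y. \<forall>w\<in>tangent_space \<B> y. \<forall>V V'. section_near \<B> \<A> \<iota> y V \<and> section_near \<B> \<A> \<iota> y V' \<longrightarrow>
        D y w (\<lambda>z. V z + V' z) = D y w V + D y w V') \<and>
     (\<forall>y. \<forall>w\<in>tangent_space \<B> y. \<forall>f V. smooth_near \<B> y f \<and> section_near \<B> \<A> \<iota> y V \<longrightarrow>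
        D y w (\<lambda>z. f z *\<^sub>R V z) = w f *\<^sub>R V y + f y *\<^sub>R D y w V) \<and>
     (\<forall>A X V. open A \<and> vector_field \<B> A X \<and> section_along \<B> \<A> \<iota> A V \<longrightarrow>
        section_along \<B> \<A> \<iota> A (\<lambda>y. D y (X y) V))"

definition levi_civita ::
  "('a::topological_space, 'e::euclidean_space) atlas \<Rightarrow>
   ('a \<Rightarrow> 'a tvec \<Rightarrow> 'a tvec \<Rightarrow> real) \<Rightarrow>
   ('a \<Rightarrow> 'a tvec \<Rightarrow> ('a \<Rightarrow> 'a tvec) \<Rightarrow> 'a tvec) \<Rightarrow> bool" where
  "levi_civita \<A> g nabla \<longleftrightarrow>
     connection_along \<A> \<A> id nabla \<and>
     (\<forall>A X Y. open A \<and> vector_field \<A> A X \<and> vector_field \<A> A Y \<longrightarrow>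
        (\<forall>x\<in>A. nabla x (X x) Y - nabla x (Y x) X = lie_bracket \<A> X Y x)) \<and>
     (\<forall>A X Y Z. open A \<and> vector_field \<A> A X \<and> vector_field \<A> A Y \<and> vector_field \<A> A Z \<longrightarrow>
        (\<forall>x\<in>A. X x (\<lambda>z. g z (Y z) (Z z)) =
                 g x (nabla x (X x) Y) (Z x) + g x (Y x) (nabla x (X x) Z)))"

text \<open>The connection induced by \<open>nabla\<close> on \<open>\<iota>\<^sup>*TM\<close>, characterised by
  \<open>D\<^sub>w (Y \<circ> \<iota>) = nabla\<^bsub>d\<iota> w\<^esub> Y\<close>.  It gives the meaning of \<open>nabla\<^sub>W V\<close> for \<open>W\<close> tangent to the
  submanifold and \<open>V\<close> defined only along the submanifold.\<close>

definition induced_connection ::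
  "('b::topological_space, 'd::euclidean_space) atlas \<Rightarrow>
   ('a::topological_space, 'e::euclidean_space) atlas \<Rightarrow> ('b \<Rightarrow> 'a) \<Rightarrow>
   ('a \<Rightarrow> 'a tvec \<Rightarrow> ('a \<Rightarrow> 'a tvec) \<Rightarrow> 'a tvec) \<Rightarrow>
   ('b \<Rightarrow> 'b tvec \<Rightarrow> ('b \<Rightarrow> 'a tvec) \<Rightarrow> 'a tvec) \<Rightarrow> bool" where
  "induced_connection \<B> \<A> \<iota> nabla D \<longleftrightarrow>
     connection_along \<B> \<A> \<iota> D \<and>
     (\<forall>y. \<forall>w\<in>tangent_space \<B> y. \<forall>Y. section_near \<A> \<A> id (\<iota> y) Y \<longrightarrow>
        D y w (Y \<circ> \<iota>) = nabla (\<iota> y) (pushforward \<A> \<iota> y w) Y)"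

definition tensor_field_11 ::
  "('a::topological_space, 'e::euclidean_space) atlas \<Rightarrow> ('a \<Rightarrow> 'a tvec \<Rightarrow> 'a tvec) \<Rightarrow> bool" where
  "tensor_field_11 \<A> J \<longleftrightarrow>
     (\<forall>x. \<forall>v\<in>tangent_space \<A> x. J x v \<in> tangent_space \<A> x) \<and>
     (\<forall>x. \<forall>u\<in>tangent_space \<A> x. \<forall>v\<in>tangent_space \<A> x. \<forall>c.
        J x (c *\<^sub>R u + v) = c *\<^sub>R J x u + J x v) \<and>
     (\<forall>A Y. open A \<and> vector_field \<A> A Y \<longrightarrow> vector_field \<A> A (\<lambda>x. J x (Y x)))"

definition metallic_semi_riemannian ::
  "nat \<Rightarrow> nat \<Rightarrow> ('a::{t2_space, second_countable_topology}, 'e::euclidean_space) atlas \<Rightarrow>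
   ('a \<Rightarrow> 'a tvec \<Rightarrow> 'a tvec \<Rightarrow> real) \<Rightarrow> ('a \<Rightarrow> 'a tvec \<Rightarrow> 'a tvec) \<Rightarrow> bool" where
  "metallic_semi_riemannian p q \<A> g J \<longleftrightarrow>
     smooth_manifold \<A> \<and> semi_riemannian \<A> g \<and> tensor_field_11 \<A> J \<and>
     (\<forall>x. \<forall>v\<in>tangent_space \<A> x. J x (J x v) = real p *\<^sub>R J x v + real q *\<^sub>R v) \<and>
     (\<forall>x. \<forall>u\<in>tangent_space \<A> x. \<forall>v\<in>tangent_space \<A> x. g x (J x u) v = g x u (J x v))"

definition parallel_11 ::
  "('a::topological_space, 'e::euclidean_space) atlas \<Rightarrow>
   ('a \<Rightarrow> 'a tvec \<Rightarrow> ('a \<Rightarrow> 'a tvec) \<Rightarrow> 'a tvec) \<Rightarrow> ('a \<Rightarrow> 'a tvec \<Rightarrow> 'a tvec) \<Rightarrow> bool" where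
  "parallel_11 \<A> nabla J \<longleftrightarrow>
     (\<forall>x. \<forall>w\<in>tangent_space \<A> x. \<forall>Y. section_near \<A> \<A> id x Y \<longrightarrow>
        nabla x w (\<lambda>z. J z (Y z)) - J x (nabla x w Y) = 0)"

definition locally_metallic ::
  "nat \<Rightarrow> nat \<Rightarrow> ('a::{t2_space, second_countable_topology}, 'e::euclidean_space) atlas \<Rightarrow>
   ('a \<Rightarrow> 'a tvec \<Rightarrow> 'a tvec \<Rightarrow> real) \<Rightarrow> ('a \<Rightarrow> 'a tvec \<Rightarrow> 'a tvec) \<Rightarrow>
   ('a \<Rightarrow> 'a tvec \<Rightarrow> ('a \<Rightarrow> 'a tvec) \<Rightarrow> 'a tvec) \<Rightarrow> bool" where
  "locally_metallic p q \<A> g J nabla \<longleftrightarrow>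
     metallic_semi_riemannian p q \<A> g J \<and> levi_civita \<A> g nabla \<and> parallel_11 \<A> nabla J"


section \<open>Lightlike submanifolds\<close>

definition subspace_sum :: "'v::real_vector set \<Rightarrow> 'v set \<Rightarrow> 'v set"  (infixl "\<boxplus>" 65) where
  "S \<boxplus> T = {u + v | u v. u \<in> S \<and> v \<in> T}"

definition complementary :: "'v::real_vector set \<Rightarrow> 'v set \<Rightarrow> bool" where
  "complementary S T \<longleftrightarrow> subspace S \<and> subspace T \<and> S \<inter> T = {0}"

definition component :: "'v::real_vector set \<Rightarrow> 'v set \<Rightarrow> 'v \<Rightarrow> 'v" where
  "component S T v = (THE u. u \<in> S \<and> v - u \<in> T)"

definition orthogonal_sets ::
  "('a \<Rightarrow> 'a tvec \<Rightarrow> 'a tvec \<Rightarrow> real) \<Rightarrow> 'a \<Rightarrow> 'a tvec set \<Rightarrow> 'a tvec set \<Rightarrow> bool" where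
  "orthogonal_sets g x S T \<longleftrightarrow> (\<forall>u\<in>S. \<forall>v\<in>T. g x u v = 0)"

definition TN ::
  "('b::topological_space, 'd::euclidean_space) atlas \<Rightarrow>
   ('a::topological_space, 'e::euclidean_space) atlas \<Rightarrow> ('b \<Rightarrow> 'a) \<Rightarrow> 'b \<Rightarrow> 'a tvec set" where
  "TN \<B> \<A> \<iota> y = pushforward \<A> \<iota> y ` tangent_space \<B> y"

definition TN_perp ::
  "('b::topological_space, 'd::euclidean_space) atlas \<Rightarrow>
   ('a::topological_space, 'e::euclidean_space) atlas \<Rightarrow> ('b \<Rightarrow> 'a) \<Rightarrow>
   ('a \<Rightarrow> 'a tvec \<Rightarrow> 'a tvec \<Rightarrow> real) \<Rightarrow> 'b \<Rightarrow> 'a tvec set" where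
  "TN_perp \<B> \<A> \<iota> g y =
     {v \<in> tangent_space \<A> (\<iota> y). \<forall>u\<in>TN \<B> \<A> \<iota> y. g (\<iota> y) v u = 0}"

definition Rad ::
  "('b::topological_space, 'd::euclidean_space) atlas \<Rightarrow>
   ('a::topological_space, 'e::euclidean_space) atlas \<Rightarrow> ('b \<Rightarrow> 'a) \<Rightarrow>
   ('a \<Rightarrow> 'a tvec \<Rightarrow> 'a tvec \<Rightarrow> real) \<Rightarrow> 'b \<Rightarrow> 'a tvec set" where
  "Rad \<B> \<A> \<iota> g y = TN \<B> \<A> \<iota> y \<inter> TN_perp \<B> \<A> \<iota> g y"

definition lightlike ::
  "('b::{t2_space, second_countable_topology}, 'd::euclidean_space) atlas \<Rightarrow>
   ('a::topological_space, 'e::euclidean_space) atlas \<Rightarrow> ('b \<Rightarrow> 'a) \<Rightarrow>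
   ('a \<Rightarrow> 'a tvec \<Rightarrow> 'a tvec \<Rightarrow> real) \<Rightarrow> nat \<Rightarrow> bool" where
  "lightlike \<B> \<A> \<iota> g r \<longleftrightarrow>
     submanifold \<B> \<A> \<iota> \<and>
     (\<forall>y. \<exists>w\<in>tangent_space \<B> y. w \<noteq> 0 \<and>
        (\<forall>u\<in>tangent_space \<B> y. g (\<iota> y) (pushforward \<A> \<iota> y w) (pushforward \<A> \<iota> y u) = 0)) \<and>
     smooth_subbundle \<B> \<A> \<iota> (Rad \<B> \<A> \<iota> g) r \<and> 1 \<le> r \<and> r \<le> DIM('d)"

text \<open>The dimension is \<open>m = DIM('d)\<close>, the codimension is \<open>k = DIM('e) - DIM('d)\<close>.\<close>

definition isotropic ::
  "('b::{t2_space, second_countable_topology}, 'd::euclidean_space) atlas \<Rightarrow>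
   ('a::topological_space, 'e::euclidean_space) atlas \<Rightarrow> ('b \<Rightarrow> 'a) \<Rightarrow>
   ('a \<Rightarrow> 'a tvec \<Rightarrow> 'a tvec \<Rightarrow> real) \<Rightarrow> bool" where
  "isotropic \<B> \<A> \<iota> g \<longleftrightarrow>
     lightlike \<B> \<A> \<iota> g DIM('d) \<and> DIM('d) < DIM('e) - DIM('d)"

definition screen_transversal_bundle ::
  "('b::topological_space, 'd::euclidean_space) atlas \<Rightarrow>
   ('a::topological_space, 'e::euclidean_space) atlas \<Rightarrow> ('b \<Rightarrow> 'a) \<Rightarrow>
   ('a \<Rightarrow> 'a tvec \<Rightarrow> 'a tvec \<Rightarrow> real) \<Rightarrow> ('b \<Rightarrow> 'a tvec set) \<Rightarrow> bool" where
  "screen_transversal_bundle \<B> \<A> \<iota> g S \<longleftrightarrow>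
     (\<exists>n. smooth_subbundle \<B> \<A> \<iota> S n) \<and>
     (\<forall>y. complementary (Rad \<B> \<A> \<iota> g y) (S y) \<and>
          TN_perp \<B> \<A> \<iota> g y = Rad \<B> \<A> \<iota> g y \<boxplus> S y \<and>
          (\<forall>u\<in>S y. (\<forall>v\<in>S y. g (\<iota> y) u v = 0) \<longrightarrow> u = 0))"

definition lightlike_transversal_bundle ::
  "('b::topological_space, 'd::euclidean_space) atlas \<Rightarrow>
   ('a::topological_space, 'e::euclidean_space) atlas \<Rightarrow> ('b \<Rightarrow> 'a) \<Rightarrow>
   ('a \<Rightarrow> 'a tvec \<Rightarrow> 'a tvec \<Rightarrow> real) \<Rightarrow> ('b \<Rightarrow> 'a tvec set) \<Rightarrow> nat \<Rightarrow> ('b \<Rightarrow> 'a tvec set) \<Rightarrow> bool"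
  where
  "lightlike_transversal_bundle \<B> \<A> \<iota> g S r L \<longleftrightarrow>
     smooth_subbundle \<B> \<A> \<iota> L r \<and>
     (\<forall>y. orthogonal_sets g (\<iota> y) (L y) (S y)) \<and>
     (\<forall>A \<xi>. open A \<and> smooth_frame \<B> \<A> \<iota> (Rad \<B> \<A> \<iota> g) r A \<xi> \<longrightarrow>
        (\<exists>N. smooth_frame \<B> \<A> \<iota> L r A N \<and>
           (\<forall>y\<in>A. \<forall>i<r. \<forall>j<r.
              g (\<iota> y) (\<xi> i y) (N j y) = (if i = j then 1 else 0) \<and>
              g (\<iota> y) (N i y) (N j y) = 0)))"

definition screen_transversal_lightlike_isotropic ::
  "('b::{t2_space, second_countable_topology}, 'd::euclidean_space) atlas \<Rightarrow>
   ('a::topological_space, 'e::euclidean_space) atlas \<Rightarrow> ('b \<Rightarrow> 'a) \<Rightarrow>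
   ('a \<Rightarrow> 'a tvec \<Rightarrow> 'a tvec \<Rightarrow> real) \<Rightarrow> ('a \<Rightarrow> 'a tvec \<Rightarrow> 'a tvec) \<Rightarrow>
   ('b \<Rightarrow> 'a tvec set) \<Rightarrow> bool" where
  "screen_transversal_lightlike_isotropic \<B> \<A> \<iota> g J S \<longleftrightarrow>
     isotropic \<B> \<A> \<iota> g \<and> (\<forall>y. J (\<iota> y) ` Rad \<B> \<A> \<iota> g y \<subseteq> S y)"

definition D_o ::
  "('b::topological_space, 'd::euclidean_space) atlas \<Rightarrow>
   ('a::topological_space, 'e::euclidean_space) atlas \<Rightarrow> ('b \<Rightarrow> 'a) \<Rightarrow>
   ('a \<Rightarrow> 'a tvec \<Rightarrow> 'a tvec \<Rightarrow> real) \<Rightarrow> ('a \<Rightarrow> 'a tvec \<Rightarrow> 'a tvec) \<Rightarrow>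
   ('b \<Rightarrow> 'a tvec set) \<Rightarrow> ('b \<Rightarrow> 'a tvec set) \<Rightarrow> 'b \<Rightarrow> 'a tvec set" where
  "D_o \<B> \<A> \<iota> g J S L y =
     {z \<in> S y. \<forall>u \<in> J (\<iota> y) ` Rad \<B> \<A> \<iota> g y \<boxplus> J (\<iota> y) ` L y. g (\<iota> y) z u = 0}"

text \<open>The decomposition
  \<open>T_yM = {TN \<oplus> ltr} \<oplus>_ort {J Rad \<oplus> J ltr} \<oplus>_ort D_o\<close> at every point of the submanifold.\<close>

definition tangent_decomposition ::
  "('b::topological_space, 'd::euclidean_space) atlas \<Rightarrow>
   ('a::topological_space, 'e::euclidean_space) atlas \<Rightarrow> ('b \<Rightarrow> 'a) \<Rightarrow>
   ('a \<Rightarrow> 'a tvec \<Rightarrow> 'a tvec \<Rightarrow> real) \<Rightarrow> ('a \<Rightarrow> 'a tvec \<Rightarrow> 'a tvec) \<Rightarrow>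
   ('b \<Rightarrow> 'a tvec set) \<Rightarrow> ('b \<Rightarrow> 'a tvec set) \<Rightarrow> bool" where
  "tangent_decomposition \<B> \<A> \<iota> g J S L \<longleftrightarrow>
     (\<forall>y. let T = TN \<B> \<A> \<iota> y;
              JR = J (\<iota> y) ` Rad \<B> \<A> \<iota> g y; JL = J (\<iota> y) ` L y;
              Do = D_o \<B> \<A> \<iota> g J S L y
          in tangent_space \<A> (\<iota> y) = (T \<boxplus> L y) \<boxplus> (JR \<boxplus> JL) \<boxplus> Do \<and>
             complementary T (L y) \<and> complementary JR JL \<and>
             complementary (T \<boxplus> L y) (JR \<boxplus> JL) \<and>
             complementary ((T \<boxplus> L y) \<boxplus> (JR \<boxplus> JL)) Do \<and>
             orthogonal_sets g (\<iota> y) (T \<boxplus> L y) (JR \<boxplus> JL) \<and>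
             orthogonal_sets g (\<iota> y) ((T \<boxplus> L y) \<boxplus> (JR \<boxplus> JL)) Do)"

text \<open>The components of \<open>v \<in> T_yM = TN \<oplus> ltr \<oplus> S(TN\<^sup>\<bottom>)\<close> in \<open>ltr\<close> and in \<open>S(TN\<^sup>\<bottom>)\<close>.\<close>

definition ltr_part ::
  "('b::topological_space, 'd::euclidean_space) atlas \<Rightarrow>
   ('a::topological_space, 'e::euclidean_space) atlas \<Rightarrow> ('b \<Rightarrow> 'a) \<Rightarrow>
   ('b \<Rightarrow> 'a tvec set) \<Rightarrow> ('b \<Rightarrow> 'a tvec set) \<Rightarrow> 'b \<Rightarrow> 'a tvec \<Rightarrow> 'a tvec" where
  "ltr_part \<B> \<A> \<iota> S L y = component (L y) (TN \<B> \<A> \<iota> y \<boxplus> S y)"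

definition str_part ::
  "('b::topological_space, 'd::euclidean_space) atlas \<Rightarrow>
   ('a::topological_space, 'e::euclidean_space) atlas \<Rightarrow> ('b \<Rightarrow> 'a) \<Rightarrow>
   ('b \<Rightarrow> 'a tvec set) \<Rightarrow> ('b \<Rightarrow> 'a tvec set) \<Rightarrow> 'b \<Rightarrow> 'a tvec \<Rightarrow> 'a tvec" where
  "str_part \<B> \<A> \<iota> S L y = component (S y) (TN \<B> \<A> \<iota> y \<boxplus> L y)"

text \<open>The transversal terms in the Gauss and Weingarten formulas; \<open>D\<close> is the induced connection,
  \<open>W\<close>, \<open>U\<close> are vector fields on the submanifold, \<open>N\<close> and \<open>Z\<close> are sections of \<open>ltr\<close> and of
  \<open>S(TN\<^sup>\<bottom>)\<close>.\<close>

definition h_l where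
  "h_l \<B> \<A> \<iota> D S L W U y =
     ltr_part \<B> \<A> \<iota> S L y (D y (W y) (\<lambda>z. pushforward \<A> \<iota> z (U z)))"

definition h_s where
  "h_s \<B> \<A> \<iota> D S L W U y =
     str_part \<B> \<A> \<iota> S L y (D y (W y) (\<lambda>z. pushforward \<A> \<iota> z (U z)))"

definition D_s where
  "D_s \<B> \<A> \<iota> D S L W N y = str_part \<B> \<A> \<iota> S L y (D y (W y) N)"

definition D_l where
  "D_l \<B> \<A> \<iota> D S L W Z y = ltr_part \<B> \<A> \<iota> S L y (D y (W y) Z)"

definition totally_geodesic ::
  "('b::topological_space, 'd::euclidean_space) atlas \<Rightarrow>
   ('a::topological_space, 'e::euclidean_space) atlas \<Rightarrow> ('b \<Rightarrow> 'a) \<Rightarrow>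
   ('b \<Rightarrow> 'b tvec \<Rightarrow> ('b \<Rightarrow> 'a tvec) \<Rightarrow> 'a tvec) \<Rightarrow>
   ('b \<Rightarrow> 'a tvec set) \<Rightarrow> ('b \<Rightarrow> 'a tvec set) \<Rightarrow> bool" where
  "totally_geodesic \<B> \<A> \<iota> D S L \<longleftrightarrow>
     (\<forall>W U. vector_field \<B> UNIV W \<and> vector_field \<B> UNIV U \<longrightarrow>
        (\<forall>y. h_l \<B> \<A> \<iota> D S L W U y = 0 \<and> h_s \<B> \<A> \<iota> D S L W U y = 0))"

text \<open>The vector field along \<open>\<iota>\<close> given by \<open>J\<close> applied to a vector field on the submanifold.\<close>

definition J_along ::
  "('a::topological_space, 'e::euclidean_space) atlas \<Rightarrow> ('b \<Rightarrow> 'a) \<Rightarrow>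
   ('a \<Rightarrow> 'a tvec \<Rightarrow> 'a tvec) \<Rightarrow> ('b \<Rightarrow> 'b tvec) \<Rightarrow> 'b \<Rightarrow> 'a tvec" where
  "J_along \<A> \<iota> J \<xi> = (\<lambda>y. J (\<iota> y) (pushforward \<A> \<iota> y (\<xi> y)))"

definition no_component_in_J_Rad ::
  "('b::topological_space, 'd::euclidean_space) atlas \<Rightarrow>
   ('a::topological_space, 'e::euclidean_space) atlas \<Rightarrow> ('b \<Rightarrow> 'a) \<Rightarrow>
   ('a \<Rightarrow> 'a tvec \<Rightarrow> 'a tvec \<Rightarrow> real) \<Rightarrow> ('a \<Rightarrow> 'a tvec \<Rightarrow> 'a tvec) \<Rightarrow> ('b \<Rightarrow> 'a tvec) \<Rightarrow> bool" where
  "no_component_in_J_Rad \<B> \<A> \<iota> g J X \<longleftrightarrow>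
     (\<forall>\<xi>\<in>tangent_sections \<B> \<A> \<iota> (Rad \<B> \<A> \<iota> g). \<forall>y. g (\<iota> y) (X y) (J_along \<A> \<iota> J \<xi> y) = 0)"

end

theory Submission
  imports Defs
begin

text \<open>Let \<open>W\<close>, \<open>U\<close> be tangent to the submanifold.  On an isotropic submanifold \<open>Rad = TN\<close>
  (\<open>Rad_eq_TN\<close>), so the induced metric vanishes and \<open>TM = TN \<oplus> ltr \<oplus> S\<close> with \<open>TN\<close> orthogonal to \<open>TN\<close>
  and \<open>S\<close>, and \<open>ltr\<close> orthogonal to \<open>ltr\<close> and \<open>S\<close>.  By non-degeneracy, the \<open>ltr\<close>-part of a vector is
  tested by its products with \<open>TN\<close>, and its \<open>S\<close>-part by its products with \<open>J Rad\<close>, \<open>J ltr\<close> and \<open>D\<^sub>o\<close>.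

  The \<open>ltr\<close>-part of \<open>D\<^sub>W U\<close> is always zero: \<open>g(D\<^sub>W U, X)\<close> is symmetric in \<open>W\<close>, \<open>U\<close> because \<open>D\<close> has
  no torsion, and skew in \<open>U\<close>, \<open>X\<close> because the induced metric vanishes
  (\<open>isotropic_second_form_tangent\<close>).  For the \<open>S\<close>-part, differentiation of \<open>g(U, J \<xi>) = 0\<close>,
  \<open>g(U, Z) = 0\<close> and \<open>g(U, J N) = 0\<close>, together with \<open>D(J N) = J(D N)\<close>, gives
  \<open>g(D\<^sub>W U, J \<xi>) = - g(U, D\<^sup>l(W, J \<xi>))\<close>, \<open>g(D\<^sub>W U, Z) = - g(U, D\<^sup>l(W, Z))\<close> and
  \<open>g(D\<^sub>W U, J N) = - g(J U, D\<^sup>s(W, N))\<close>.  Hence the three conditions say exactly that the \<open>S\<close>-part of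
  \<open>D\<^sub>W U\<close> is zero.

  Since tangent vectors are derivations, and \<open>D\<close> is an axiomatically given connection along \<open>\<iota>\<close>, two
  kinds of preparation are needed.  First, \<open>D\<close> must inherit from the Levi-Civita connection its
  compatibility with \<open>g\<close> and \<open>J\<close> and the vanishing of the torsion (\<open>metric_compatible\<close>,
  \<open>D_parallel_tensor\<close>, \<open>torsion_free\<close>).  Sections along \<open>\<iota>\<close> are locally combinations of restricted
  coordinate fields (\<open>tangent_expansion\<close>, a consequence of Hadamard's lemma), so it suffices to check
  the first two of these on restrictions of vector fields (\<open>section_near_induct\<close>).  Secondly, as the
  conditions concern global sections, every vector in \<open>TN\<close>, \<open>ltr\<close> and \<open>D\<^sub>o\<close> must be the value of a
  global section; this uses bump functions (\<open>manifold_bump\<close>, \<open>extend_section\<close>) and, for \<open>D\<^sub>o\<close>, an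
  explicit projection (\<open>Do_section_through\<close>).\<close>

section \<open>Calculus of \<open>C\<^sup>k\<close> functions on open sets\<close>

lemma Ck_on_cong:
  assumes "open S" "\<And>x. x \<in> S \<Longrightarrow> f x = g x" "Ck_on k S f"
  shows "Ck_on k S g"
  using assms
proof (induction k arbitrary: f g)
  case 0
  then show ?case by (auto cong: continuous_on_cong)
next
  case (Suc k)
  have d: "(g has_derivative frechet_derivative f (at x)) (at x)" if "x \<in> S" for x
    using Suc.prems that
    by (auto simp: frechet_derivative_works intro: has_derivative_transform_within_open)
  then have "frechet_derivative f (at x) v = frechet_derivative g (at x) v" if "x \<in> S" for x v
    using that frechet_derivative_at by metis
  then have "Ck_on k S (\<lambda>x. frechet_derivative g (at x) v)" for v
    using Suc.IH[of "\<lambda>x. frechet_derivative f (at x) v"] Suc.prems by auto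
  with d show ?case by (auto simp: differentiable_def)
qed

lemma Ck_on_SucI:
  assumes "open S" "\<And>x. x \<in> S \<Longrightarrow> (f has_derivative f' x) (at x)" "\<And>v. Ck_on k S (\<lambda>x. f' x v)"
  shows "Ck_on (Suc k) S f"
proof -
  have "f' x v = frechet_derivative f (at x) v" if "x \<in> S" for x v
    using that assms(2) frechet_derivative_at by metis
  then have "Ck_on k S (\<lambda>x. frechet_derivative f (at x) v)" for v
    by (intro Ck_on_cong[OF assms(1) _ assms(3)[of v]]) auto
  with assms(2) show ?thesis by (auto simp: differentiable_def)
qed

lemma Ck_on_has_derivative:
  assumes "Ck_on (Suc k) S f" "x \<in> S"
  shows "(f has_derivative frechet_derivative f (at x)) (at x)"
  using assms by (auto simp: frechet_derivative_works)

lemma Ck_on_subset: "Ck_on k T f \<Longrightarrow> S \<subseteq> T \<Longrightarrow> Ck_on k S f"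
  by (induction k arbitrary: f) (auto intro: continuous_on_subset)

lemma Ck_on_local:
  assumes "\<And>x. x \<in> S \<Longrightarrow> \<exists>T. open T \<and> x \<in> T \<and> Ck_on k T f"
  shows "Ck_on k S f"
  using assms
proof (induction k arbitrary: f)
  case 0
  have "continuous (at x within S) f" if x: "x \<in> S" for x
  proof -
    obtain T where "open T" "x \<in> T" "continuous_on T f"
      using 0[OF x] by auto
    then show ?thesis
      using continuous_at_imp_continuous_at_within continuous_on_eq_continuous_at by blast
  qed
  then show ?case by (simp add: continuous_on_eq_continuous_within)
next
  case (Suc k)
  have "Ck_on k S (\<lambda>x. frechet_derivative f (at x) v)" for v
    using Suc.prems by (intro Suc.IH) fastforce
  moreover have "f differentiable (at x)" if "x \<in> S" for x
    using Suc.prems[OF that] by auto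
  ultimately show ?case by simp
qed

lemma Ck_on_Suc_imp: "Ck_on (Suc k) S f \<Longrightarrow> Ck_on k S f"
proof (induction k arbitrary: f)
  case 0
  then show ?case
    by (auto intro!: differentiable_imp_continuous_on differentiable_at_imp_differentiable_on)
next
  case (Suc k)
  then show ?case by (metis Ck_on.simps(2))
qed

lemma Ck_on_const: "Ck_on k S (\<lambda>x. c)"
  by (induction k arbitrary: c) auto

lemma Ck_on_bounded_linear:
  assumes S: "open S" and h: "bounded_linear h" and f: "Ck_on k S f"
  shows "Ck_on k S (\<lambda>x. h (f x))"
  using f
proof (induction k arbitrary: f)
  case 0
  then show ?case using bounded_linear.continuous_on[OF h] by auto
next
  case (Suc k)
  show ?case
  proof (rule Ck_on_SucI[OF S])
    show "((\<lambda>x. h (f x)) has_derivative (\<lambda>v. h (frechet_derivative f (at x) v))) (at x)"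
      if "x \<in> S" for x
      using bounded_linear.has_derivative[OF h Ck_on_has_derivative[OF Suc.prems that]] .
    show "Ck_on k S (\<lambda>x. h (frechet_derivative f (at x) v))" for v
      using Suc by auto
  qed
qed

lemma Ck_on_ident:
  assumes "open S"
  shows "Ck_on k S (\<lambda>x. x)"
proof (cases k)
  case (Suc n)
  then show ?thesis
    using Ck_on_SucI[OF assms has_derivative_ident Ck_on_const] by simp
qed auto

lemma Ck_on_add:
  assumes S: "open S" and f: "Ck_on k S f" and g: "Ck_on k S g"
  shows "Ck_on k S (\<lambda>x. f x + g x)"
  using f g
proof (induction k arbitrary: f g)
  case 0
  then show ?case by (auto intro: continuous_intros)
next
  case (Suc k)
  show ?case
  proof (rule Ck_on_SucI[OF S])
    show "((\<lambda>x. f x + g x) has_derivative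
        (\<lambda>v. frechet_derivative f (at x) v + frechet_derivative g (at x) v)) (at x)"
      if "x \<in> S" for x
      using Suc.prems that by (intro has_derivative_add Ck_on_has_derivative)
  qed (use Suc in auto)
qed

lemma Ck_on_sum:
  assumes S: "open S" and f: "\<And>i. i \<in> I \<Longrightarrow> Ck_on k S (f i)"
  shows "Ck_on k S (\<lambda>x. \<Sum>i\<in>I. f i x)"
  using f by (induction I rule: infinite_finite_induct) (auto intro!: Ck_on_const Ck_on_add[OF S])

lemma Ck_on_scaleR:
  fixes f :: "'a::euclidean_space \<Rightarrow> real" and g :: "'a \<Rightarrow> 'b::real_normed_vector"
  assumes S: "open S" and f: "Ck_on k S f" and g: "Ck_on k S g"
  shows "Ck_on k S (\<lambda>x. f x *\<^sub>R g x)"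
  using f g
proof (induction k arbitrary: f g)
  case 0
  then show ?case by (auto intro: continuous_intros)
next
  case (Suc k)
  show ?case
  proof (rule Ck_on_SucI[OF S])
    show "((\<lambda>x. f x *\<^sub>R g x) has_derivative
        (\<lambda>v. f x *\<^sub>R frechet_derivative g (at x) v + frechet_derivative f (at x) v *\<^sub>R g x)) (at x)"
      if "x \<in> S" for x
      using Suc.prems that by (intro has_derivative_scaleR Ck_on_has_derivative)
    show "Ck_on k S (\<lambda>x. f x *\<^sub>R frechet_derivative g (at x) v + frechet_derivative f (at x) v *\<^sub>R g x)"
      for v
      using Suc.prems
        Ck_on_Suc_imp[OF Suc.prems(1)] Ck_on_Suc_imp[OF Suc.prems(2)]
      by (intro Ck_on_add[OF S] Suc.IH) auto
  qed
qed

lemma linear_Basis_expansion: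
  fixes F :: "'a::euclidean_space \<Rightarrow> 'b::real_vector"
  assumes "linear F"
  shows "F w = (\<Sum>b\<in>Basis. (w \<bullet> b) *\<^sub>R F b)"
proof -
  have "F w = F (\<Sum>b\<in>Basis. (w \<bullet> b) *\<^sub>R b)"
    by (simp add: euclidean_representation)
  also have "\<dots> = (\<Sum>b\<in>Basis. (w \<bullet> b) *\<^sub>R F b)"
    using assms by (simp add: linear_sum linear_scale)
  finally show ?thesis .
qed

lemma Ck_on_compose:
  fixes f :: "'b::euclidean_space \<Rightarrow> 'c::real_normed_vector" and g :: "'a::euclidean_space \<Rightarrow> 'b"
  assumes S: "open S" and T: "open T" and g: "Ck_on k S g" and f: "Ck_on k T f"
    and gST: "\<And>x. x \<in> S \<Longrightarrow> g x \<in> T"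
  shows "Ck_on k S (\<lambda>x. f (g x))"
  using g f
proof (induction k arbitrary: f)
  case 0
  then show ?case using gST by (auto intro: continuous_on_compose2)
next
  case (Suc k)
  show ?case
  proof (rule Ck_on_SucI[OF S])
    fix x assume x: "x \<in> S"
    have f': "(f has_derivative frechet_derivative f (at (g x))) (at (g x))"
      using Ck_on_has_derivative[OF Suc.prems(2)] gST x by blast
    have g': "(g has_derivative frechet_derivative g (at x)) (at x)"
      using Ck_on_has_derivative[OF Suc.prems(1) x] .
    have "((\<lambda>x. f (g x)) has_derivative
        (\<lambda>v. frechet_derivative f (at (g x)) (frechet_derivative g (at x) v))) (at x)"
      using diff_chain_at[OF g' f'] by (simp add: o_def)
    moreover have "linear (frechet_derivative f (at (g x)))"
      using f' has_derivative_linear by blast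
    ultimately show "((\<lambda>x. f (g x)) has_derivative
        (\<lambda>v. \<Sum>b\<in>Basis. (frechet_derivative g (at x) v \<bullet> b) *\<^sub>R frechet_derivative f (at (g x)) b)) (at x)"
      by (subst (asm) linear_Basis_expansion)
  next
    fix v
    show "Ck_on k S (\<lambda>x. \<Sum>b\<in>Basis. (frechet_derivative g (at x) v \<bullet> b) *\<^sub>R frechet_derivative f (at (g x)) b)"
      using Suc.prems Ck_on_Suc_imp[OF Suc.prems(1)]
      by (intro Ck_on_sum[OF S] Ck_on_scaleR[OF S] Suc.IH Ck_on_bounded_linear[OF S bounded_linear_inner_left])
        auto
  qed
qed

lemma smooth_on_cong:
  "open S \<Longrightarrow> (\<And>x. x \<in> S \<Longrightarrow> f x = g x) \<Longrightarrow> smooth_on S f \<Longrightarrow> smooth_on S g"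
  using Ck_on_cong unfolding smooth_on_def by blast

lemma smooth_on_subset: "smooth_on T f \<Longrightarrow> S \<subseteq> T \<Longrightarrow> smooth_on S f"
  using Ck_on_subset unfolding smooth_on_def by blast

lemma smooth_on_local:
  "(\<And>x. x \<in> S \<Longrightarrow> \<exists>T. open T \<and> x \<in> T \<and> smooth_on T f) \<Longrightarrow> smooth_on S f"
  using Ck_on_local unfolding smooth_on_def by meson

lemma smooth_on_const: "smooth_on S (\<lambda>x. c)"
  by (simp add: smooth_on_def Ck_on_const)

lemma smooth_on_ident: "open S \<Longrightarrow> smooth_on S (\<lambda>x. x)"
  by (simp add: smooth_on_def Ck_on_ident)

lemma smooth_on_add: "open S \<Longrightarrow> smooth_on S f \<Longrightarrow> smooth_on S g \<Longrightarrow> smooth_on S (\<lambda>x. f x + g x)"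
  by (simp add: smooth_on_def Ck_on_add)

lemma smooth_on_scaleR:
  fixes f :: "'a::euclidean_space \<Rightarrow> real"
  shows "open S \<Longrightarrow> smooth_on S f \<Longrightarrow> smooth_on S g \<Longrightarrow> smooth_on S (\<lambda>x. f x *\<^sub>R g x)"
  by (simp add: smooth_on_def Ck_on_scaleR)

lemma smooth_on_bounded_linear:
  "open S \<Longrightarrow> bounded_linear h \<Longrightarrow> smooth_on S f \<Longrightarrow> smooth_on S (\<lambda>x. h (f x))"
  by (simp add: smooth_on_def Ck_on_bounded_linear)

lemma smooth_on_compose:
  fixes f :: "'b::euclidean_space \<Rightarrow> 'c::real_normed_vector" and g :: "'a::euclidean_space \<Rightarrow> 'b"
  shows "open S \<Longrightarrow> open T \<Longrightarrow> smooth_on S g \<Longrightarrow> smooth_on T f \<Longrightarrow> (\<And>x. x \<in> S \<Longrightarrow> g x \<in> T) \<Longrightarrow>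
    smooth_on S (\<lambda>x. f (g x))"
  unfolding smooth_on_def using Ck_on_compose by blast

lemma smooth_on_frechet_derivative:
  "smooth_on S f \<Longrightarrow> smooth_on S (\<lambda>x. frechet_derivative f (at x) v)"
  unfolding smooth_on_def by (metis Ck_on.simps(2))

lemma smooth_on_has_derivative:
  "smooth_on S f \<Longrightarrow> x \<in> S \<Longrightarrow> (f has_derivative frechet_derivative f (at x)) (at x)"
  unfolding smooth_on_def using Ck_on_has_derivative by blast

lemma smooth_on_continuous: "smooth_on S f \<Longrightarrow> continuous_on S f"
  unfolding smooth_on_def by (metis Ck_on.simps(1))

section \<open>Hadamard's lemma and bump functions\<close>

lemma segment_in_convex:
  assumes "convex S" "a \<in> S" "y \<in> S" "t \<in> {0..1::real}"
  shows "a + t *\<^sub>R (y - a) \<in> S"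
proof -
  have "(1 - t) *\<^sub>R a + t *\<^sub>R y \<in> S"
    using assms by (intro convexD) auto
  then show ?thesis by (simp add: algebra_simps)
qed

text \<open>The weight \<open>t\<^sup>m\<close> makes the class of integrals below closed under differentiation, since the
  chain rule produces a factor \<open>t\<close>.\<close>

lemma has_derivative_ray_integral:
  fixes G :: "'a::euclidean_space \<Rightarrow> real"
  assumes S: "open S" "convex S" "a \<in> S" and G: "smooth_on S G" and y: "y \<in> S"
  shows "((\<lambda>y. integral {0..1} (\<lambda>t. t ^ m * G (a + t *\<^sub>R (y - a)))) has_derivative
    (\<lambda>v. integral {0..1} (\<lambda>t. t ^ Suc m * frechet_derivative G (at (a + t *\<^sub>R (y - a))) v))) (at y)"
proof -
  define G' where "G' v x = frechet_derivative G (at x) v" for v x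
  define fx where "fx y t = (\<Sum>b\<in>Basis. (t ^ Suc m * G' b (a + t *\<^sub>R (y - a))) *\<^sub>R blinfun_inner_left b)" for y t
  have lin: "linear (\<lambda>v. G' v x)" if "x \<in> S" for x
    unfolding G'_def using smooth_on_has_derivative[OF G that] has_derivative_linear by blast
  have fx_apply: "blinfun_apply (fx y t) v = t ^ Suc m * G' v (a + t *\<^sub>R (y - a))"
    if "y \<in> S" "t \<in> {0..1}" for y t v
  proof -
    have "G' v (a + t *\<^sub>R (y - a)) = (\<Sum>b\<in>Basis. (v \<bullet> b) * G' b (a + t *\<^sub>R (y - a)))"
      using linear_Basis_expansion[OF lin[OF segment_in_convex[OF S(2,3) that]], of v] by simp
    then show ?thesis
      by (simp add: fx_def blinfun.bilinear_simps sum_distrib_left algebra_simps)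
  qed
  have cont: "continuous_on (S \<times> cbox 0 1) (\<lambda>(y, t). H (a + t *\<^sub>R (y - a)))"
    if "continuous_on S H" for H :: "'a \<Rightarrow> real"
    unfolding split_beta
    using segment_in_convex[OF S(2,3)]
    by (intro continuous_on_compose2[OF that] continuous_intros) auto
  have cont_G: "continuous_on S G" and cont_G': "continuous_on S (G' b)" for b
    using smooth_on_continuous[OF G] smooth_on_continuous[OF smooth_on_frechet_derivative[OF G]]
    by (auto simp: G'_def[abs_def])
  have cont_fx: "continuous_on (S \<times> cbox 0 1) (\<lambda>(y, t). fx y t)"
    using cont[OF cont_G'] unfolding fx_def split_beta by (intro continuous_intros) auto
  have D: "((\<lambda>y. integral (cbox 0 1) (\<lambda>t. t ^ m * G (a + t *\<^sub>R (y - a)))) has_derivative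
      blinfun_apply (integral (cbox 0 1) (fx y))) (at y within S)"
  proof (rule leibniz_rule[OF _ _ cont_fx y S(2)])
    fix z t assume zt: "z \<in> S" "t \<in> cbox 0 (1::real)"
    then have t: "t \<in> {0..1}" by simp
    let ?p = "a + t *\<^sub>R (z - a)"
    have "((\<lambda>z. a + t *\<^sub>R (z - a)) has_derivative (\<lambda>v. t *\<^sub>R v)) (at z)"
      by (rule has_derivative_eq_rhs) (rule derivative_intros | simp)+
    from diff_chain_at[OF this smooth_on_has_derivative[OF G segment_in_convex[OF S(2,3) zt(1) t]]]
    have "((\<lambda>z. G (a + t *\<^sub>R (z - a))) has_derivative (\<lambda>v. frechet_derivative G (at ?p) (t *\<^sub>R v))) (at z)"
      by (simp add: o_def)
    then have "((\<lambda>z. t ^ m * G (a + t *\<^sub>R (z - a))) has_derivative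
        (\<lambda>v. t ^ m * frechet_derivative G (at ?p) (t *\<^sub>R v))) (at z)"
      by (rule has_derivative_mult_right)
    moreover have "(\<lambda>v. t ^ m * frechet_derivative G (at ?p) (t *\<^sub>R v)) = blinfun_apply (fx z t)"
      using linear_scale[OF lin[OF segment_in_convex[OF S(2,3) zt(1) t]]]
      by (auto simp: fx_apply[OF zt(1) t] G'_def)
    ultimately show "((\<lambda>y. t ^ m * G (a + t *\<^sub>R (y - a))) has_derivative blinfun_apply (fx z t)) (at z within S)"
      by (metis has_derivative_at_withinI)
  next
    fix z assume "z \<in> S"
    then show "(\<lambda>t. t ^ m * G (a + t *\<^sub>R (z - a))) integrable_on cbox 0 1"
      using segment_in_convex[OF S(2,3)]
      by (intro integrable_continuous continuous_intros continuous_on_compose2[OF cont_G]) auto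
  qed
  have "fx y integrable_on cbox 0 1"
    using y continuous_on_compose2[OF cont_fx, of "cbox 0 1" "\<lambda>t. (y, t)"]
    by (intro integrable_continuous) (force intro!: continuous_intros)
  then have "blinfun_apply (integral (cbox 0 1) (fx y)) =
      (\<lambda>v. integral {0..1} (\<lambda>t. t ^ Suc m * G' v (a + t *\<^sub>R (y - a))))"
    using fx_apply[OF y] by (intro ext, subst blinfun_apply_integral) (auto intro!: integral_cong)
  with D show ?thesis
    unfolding at_within_open[OF y S(1)] by (simp add: G'_def)
qed

lemma smooth_on_ray_integral:
  fixes G :: "'a::euclidean_space \<Rightarrow> real"
  assumes S: "open S" "convex S" "a \<in> S" and G: "smooth_on S G"
  shows "smooth_on S (\<lambda>y. integral {0..1} (\<lambda>t. G (a + t *\<^sub>R (y - a))))"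
proof -
  have D: "Ck_on (Suc k) S (\<lambda>y. integral {0..1} (\<lambda>t. t ^ m * G (a + t *\<^sub>R (y - a))))"
    if "smooth_on S G" for G :: "'a \<Rightarrow> real" and k m
    using that
  proof (induction k arbitrary: G m)
    case 0
    let ?I = "\<lambda>v y. integral {0..1} (\<lambda>t. t ^ Suc m * frechet_derivative G (at (a + t *\<^sub>R (y - a))) v)"
    have "continuous_on S (?I v)" for v
      using has_derivative_ray_integral[OF S smooth_on_frechet_derivative[OF 0, of v], of _ "Suc m"]
      by (meson continuous_at_imp_continuous_on has_derivative_continuous)
    then show ?case
      by (intro Ck_on_SucI[OF S(1) has_derivative_ray_integral[OF S 0]]) auto
  next
    case (Suc k)
    then show ?case
      by (intro Ck_on_SucI[OF S(1) has_derivative_ray_integral[OF S Suc.prems]])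
        (auto simp only: intro!: Suc.IH smooth_on_frechet_derivative)
  qed
  have "Ck_on k S (\<lambda>y. integral {0..1} (\<lambda>t. G (a + t *\<^sub>R (y - a))))" for k
    using Ck_on_Suc_imp[OF D[OF G, of k 0]] by simp
  then show ?thesis by (simp add: smooth_on_def)
qed

lemma Hadamard:
  fixes f :: "'a::euclidean_space \<Rightarrow> real"
  assumes S: "open S" "convex S" "a \<in> S" and f: "smooth_on S f"
  obtains h where "\<And>b. smooth_on S (h b)"
    "\<And>b. h b a = frechet_derivative f (at a) b"
    "\<And>y. y \<in> S \<Longrightarrow> f y = f a + (\<Sum>b\<in>Basis. (y \<bullet> b - a \<bullet> b) * h b y)"
proof
  define h where "h b y = integral {0..1} (\<lambda>t. frechet_derivative f (at (a + t *\<^sub>R (y - a))) b)" for b y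
  show "smooth_on S (h b)" for b
    using smooth_on_ray_integral[OF S smooth_on_frechet_derivative[OF f]] by (simp add: h_def[abs_def])
  show "h b a = frechet_derivative f (at a) b" for b
    by (simp add: h_def)
  fix y assume y: "y \<in> S"
  let ?p = "\<lambda>t. a + t *\<^sub>R (y - a)"
  have "((\<lambda>t. f (?p t)) has_vector_derivative frechet_derivative f (at (?p t)) (y - a)) (at t within {0..1})"
    if t: "t \<in> {0..1}" for t
  proof -
    have d: "(f has_derivative frechet_derivative f (at (?p t))) (at (?p t))"
      using smooth_on_has_derivative[OF f segment_in_convex[OF S(2,3) y t]] .
    have "(?p has_derivative (\<lambda>s. s *\<^sub>R (y - a))) (at t)"
      by (rule has_derivative_eq_rhs) (rule derivative_intros | simp)+
    from has_derivative_at_withinI[OF diff_chain_at[OF this d]]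
    have "((\<lambda>t. f (?p t)) has_derivative (\<lambda>s. frechet_derivative f (at (?p t)) (s *\<^sub>R (y - a)))) (at t within {0..1})"
      by (simp add: o_def)
    then show ?thesis
      using has_derivative_linear[OF d]
      by (simp add: has_vector_derivative_def linear_scale)
  qed
  then have "((\<lambda>t. frechet_derivative f (at (?p t)) (y - a)) has_integral f (?p 1) - f (?p 0)) {0..1}"
    by (intro fundamental_theorem_of_calculus) auto
  then have "f y - f a = integral {0..1} (\<lambda>t. frechet_derivative f (at (?p t)) (y - a))"
    by (simp add: integral_unique)
  also have "\<dots> = integral {0..1} (\<lambda>t. \<Sum>b\<in>Basis. ((y - a) \<bullet> b) * frechet_derivative f (at (?p t)) b)"
  proof (rule integral_cong)
    fix t assume t: "t \<in> {0..1::real}"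
    have "linear (frechet_derivative f (at (?p t)))"
      using smooth_on_has_derivative[OF f segment_in_convex[OF S(2,3) y t]] has_derivative_linear by blast
    from linear_Basis_expansion[OF this, of "y - a"]
    show "frechet_derivative f (at (?p t)) (y - a) = (\<Sum>b\<in>Basis. ((y - a) \<bullet> b) * frechet_derivative f (at (?p t)) b)"
      by simp
  qed
  also have "\<dots> = (\<Sum>b\<in>Basis. ((y - a) \<bullet> b) * h b y)"
  proof -
    have "(\<lambda>t. frechet_derivative f (at (?p t)) b) integrable_on {0..1}" for b
      using segment_in_convex[OF S(2,3) y]
      by (intro integrable_continuous_interval
          continuous_on_compose2[OF smooth_on_continuous[OF smooth_on_frechet_derivative[OF f]]])
        (auto intro!: continuous_intros)
    then show ?thesis
      by (subst integral_sum) (auto simp: h_def intro!: integrable_on_mult_right)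
  qed
  finally show "f y = f a + (\<Sum>b\<in>Basis. (y \<bullet> b - a \<bullet> b) * h b y)"
    by (simp add: inner_diff_left)
qed

text \<open>The functions \<open>t\<^sup>-\<^sup>n exp (-1/t)\<close>, extended by \<open>0\<close> to \<open>t \<le> 0\<close>.  The derivative of each of
  them is a linear combination of two others, so that all are smooth.\<close>

definition flat_exp :: "nat \<Rightarrow> real \<Rightarrow> real" where
  "flat_exp n t = (if t \<le> 0 then 0 else exp (- inverse t) * inverse t ^ n)"

lemma flat_exp_tendsto_0: "(flat_exp n \<longlongrightarrow> 0) (at 0)"
proof -
  have "((\<lambda>t. inverse t ^ n / exp (inverse t)) \<longlongrightarrow> 0) (at_right (0::real))"
    using tendsto_power_div_exp_0 filterlim_inverse_at_top_right by (rule filterlim_compose)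
  moreover have "\<forall>\<^sub>F t in at_right (0::real). inverse t ^ n / exp (inverse t) = flat_exp n t"
    by (auto simp: eventually_at_right_less flat_exp_def exp_minus field_simps
        intro!: eventually_mono[OF eventually_at_right_less])
  ultimately have "(flat_exp n \<longlongrightarrow> 0) (at_right 0)"
    using Lim_transform_eventually by blast
  moreover have "\<forall>\<^sub>F t in at_left (0::real). 0 = flat_exp n t"
    by (auto simp: flat_exp_def eventually_at_left_field intro!: exI[of _ "-1"])
  then have "(flat_exp n \<longlongrightarrow> 0) (at_left 0)"
    by (rule Lim_transform_eventually[OF tendsto_const])
  ultimately show ?thesis by (simp add: filterlim_at_split)
qed

lemma flat_exp_deriv:
  "(flat_exp n has_real_derivative flat_exp (n + 2) t - real n * flat_exp (n + 1) t) (at t)"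
proof (cases "t = 0")
  case True
  have "flat_exp n (0 + h) / h = flat_exp (Suc n) h" for h
    by (simp add: flat_exp_def divide_inverse)
  then have "((\<lambda>h. (flat_exp n (0 + h) - flat_exp n 0) / h) \<longlongrightarrow> 0) (at 0)"
    using flat_exp_tendsto_0[of "Suc n"] by (simp add: flat_exp_def[of n 0])
  then show ?thesis
    unfolding True DERIV_def by (simp add: flat_exp_def)
next
  case False
  then consider "t > 0" | "t < 0" by linarith
  then show ?thesis
  proof cases
    case 1
    have "((\<lambda>t. exp (- inverse t) * inverse t ^ n) has_real_derivative
        flat_exp (n + 2) t - real n * flat_exp (n + 1) t) (at t)"
      using 1 by (auto intro!: derivative_eq_intros simp: flat_exp_def power2_eq_square)
        (cases n, auto simp: field_simps)
    then show ?thesis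
      by (rule DERIV_cong_ev[THEN iffD1, rotated 3])
        (use 1 in \<open>auto simp: flat_exp_def intro!: eventually_nhds_in_open[of "{0<..}", THEN eventually_mono]\<close>)
  next
    case 2
    have "((\<lambda>t. 0) has_real_derivative flat_exp (n + 2) t - real n * flat_exp (n + 1) t) (at t)"
      using 2 by (auto simp: flat_exp_def)
    then show ?thesis
      by (rule DERIV_cong_ev[THEN iffD1, rotated 3])
        (use 2 in \<open>auto simp: flat_exp_def intro!: eventually_nhds_in_open[of "{..<0}", THEN eventually_mono]\<close>)
  qed
qed

lemma smooth_on_flat_exp: "smooth_on UNIV (flat_exp n)"
proof -
  have "Ck_on k UNIV (flat_exp n)" for k
  proof (induction k arbitrary: n)
    case 0
    have "continuous_on UNIV (flat_exp n)"
      using flat_exp_deriv DERIV_isCont continuous_at_imp_continuous_on by blast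
    then show ?case by simp
  next
    case (Suc k)
    show ?case
    proof (rule Ck_on_SucI)
      show "(flat_exp n has_derivative (\<lambda>v. (flat_exp (n + 2) t - real n * flat_exp (n + 1) t) * v)) (at t)" for t
        using flat_exp_deriv[of n t] by (simp add: has_field_derivative_def)
      have "Ck_on k UNIV (\<lambda>t. v *\<^sub>R (flat_exp (n + 2) t + (- real n) *\<^sub>R flat_exp (n + 1) t))" for v
        by (intro Ck_on_scaleR Ck_on_add Ck_on_const Suc) auto
      then show "Ck_on k UNIV (\<lambda>t. (flat_exp (n + 2) t - real n * flat_exp (n + 1) t) * v)" for v
        by (simp add: mult.commute)
    qed simp
  qed
  then show ?thesis by (simp add: smooth_on_def)
qed

lemma euclidean_bump:
  fixes a :: "'a::euclidean_space"
  assumes "r > 0"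
  obtains \<beta> :: "'a \<Rightarrow> real" where "smooth_on UNIV \<beta>" "\<beta> a = 1" "\<And>x. x \<notin> ball a r \<Longrightarrow> \<beta> x = 0"
proof
  define \<beta> where "\<beta> x = exp (inverse (r\<^sup>2)) * flat_exp 0 (r\<^sup>2 - (x - a) \<bullet> (x - a))" for x
  have "smooth_on UNIV (\<lambda>x. \<Sum>b\<in>Basis. ((x - a) \<bullet> b) *\<^sub>R ((x - a) \<bullet> b))"
  proof -
    have "Ck_on k UNIV (\<lambda>x. (x + - a) \<bullet> b)" for k and b :: 'a
      by (intro Ck_on_bounded_linear[OF _ bounded_linear_inner_left] Ck_on_add Ck_on_ident Ck_on_const) auto
    then show ?thesis
      unfolding smooth_on_def by (intro allI Ck_on_sum Ck_on_scaleR) auto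
  qed
  then have "smooth_on UNIV (\<lambda>x. (x - a) \<bullet> (x - a))"
    by (simp add: euclidean_inner[of "_ - a" "_ - a"])
  then have "smooth_on UNIV (\<lambda>x. r\<^sup>2 + (-1) *\<^sub>R ((x - a) \<bullet> (x - a)))"
    by (intro smooth_on_add smooth_on_scaleR smooth_on_const) auto
  from smooth_on_compose[OF _ _ this smooth_on_flat_exp[of 0]]
  have "smooth_on UNIV (\<lambda>x. exp (inverse (r\<^sup>2)) *\<^sub>R flat_exp 0 (r\<^sup>2 + (-1) *\<^sub>R ((x - a) \<bullet> (x - a))))"
    by (intro smooth_on_scaleR smooth_on_const) auto
  then show "smooth_on UNIV \<beta>" by (simp add: \<beta>_def[abs_def])
  show "\<beta> a = 1"
    using assms by (simp add: \<beta>_def flat_exp_def exp_minus)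
  show "\<beta> x = 0" if "x \<notin> ball a r" for x
  proof -
    have "r\<^sup>2 \<le> (norm (x - a))\<^sup>2"
      using that assms by (intro power_mono) (auto simp: dist_norm norm_minus_commute)
    then show ?thesis
      by (simp add: \<beta>_def flat_exp_def power2_norm_eq_inner)
  qed
qed

section \<open>Smooth functions on manifolds\<close>

lemma
  assumes "smooth_manifold \<A>" "(D, \<phi>) \<in> \<A>"
  shows open_chart_domain: "open D"
    and open_chart_image: "open U \<Longrightarrow> open (\<phi> ` (U \<inter> D))"
    and inj_on_chart: "inj_on \<phi> D"
    and continuous_on_chart: "continuous_on D \<phi>"
    and continuous_on_chart_inv: "continuous_on (\<phi> ` D) (inv_into D \<phi>)"
proof -
  obtain \<psi> where D: "open D" "open (\<phi> ` D)" and h: "homeomorphism D (\<phi> ` D) \<phi> \<psi>"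
    using assms unfolding smooth_manifold_def by blast
  show "open D" by fact
  show "open (\<phi> ` (U \<inter> D))" if "open U"
  proof -
    have "openin (top_of_set D) (U \<inter> D)"
      using that D by (simp add: openin_open_eq open_Int)
    from homeomorphism_imp_open_map[OF h this]
    show ?thesis using D by (simp add: openin_open_eq)
  qed
  show inj: "inj_on \<phi> D"
    using h unfolding homeomorphism_def inj_on_def by metis
  show "continuous_on D \<phi>"
    using h by (simp add: homeomorphism_def)
  have "\<psi> z = inv_into D \<phi> z" if "z \<in> \<phi> ` D" for z
    using that h inj by (auto simp: homeomorphism_def)
  moreover have "continuous_on (\<phi> ` D) \<psi>"
    using h by (simp add: homeomorphism_def)
  ultimately show "continuous_on (\<phi> ` D) (inv_into D \<phi>)"
    by (simp cong: continuous_on_cong)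
qed

lemma chart_inv: "smooth_manifold \<A> \<Longrightarrow> (D, \<phi>) \<in> \<A> \<Longrightarrow> x \<in> D \<Longrightarrow> inv_into D \<phi> (\<phi> x) = x"
  by (simp add: inj_on_chart inv_into_f_f)

lemma chart_at:
  assumes "smooth_manifold \<A>"
  obtains D \<phi> where "(D, \<phi>) \<in> \<A>" "x \<in> D"
proof -
  have "x \<in> (\<Union>(D, \<phi>)\<in>\<A>. D)"
    using assms by (simp add: smooth_manifold_def)
  then show ?thesis using that by auto
qed

lemma smooth_funI:
  "(\<And>D \<phi>. (D, \<phi>) \<in> \<A> \<Longrightarrow> smooth_on (\<phi> ` (U \<inter> D)) (f \<circ> inv_into D \<phi>)) \<Longrightarrow> smooth_fun \<A> U f"
  by (auto simp: smooth_fun_def)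

lemma smooth_fun_chartD:
  "smooth_fun \<A> U f \<Longrightarrow> (D, \<phi>) \<in> \<A> \<Longrightarrow> smooth_on (\<phi> ` (U \<inter> D)) (f \<circ> inv_into D \<phi>)"
  by (auto simp: smooth_fun_def)

lemma smooth_fun_cong:
  assumes M: "smooth_manifold \<A>" and "open U" and eq: "\<And>x. x \<in> U \<Longrightarrow> f x = h x"
    and f: "smooth_fun \<A> U f"
  shows "smooth_fun \<A> U h"
  unfolding smooth_fun_def
proof clarify
  fix D \<phi> assume c: "(D, \<phi>) \<in> \<A>"
  show "smooth_on (\<phi> ` (U \<inter> D)) (h \<circ> inv_into D \<phi>)"
  proof (rule smooth_on_cong)
    show "open (\<phi> ` (U \<inter> D))"
      using open_chart_image[OF M c \<open>open U\<close>] .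
    show "smooth_on (\<phi> ` (U \<inter> D)) (f \<circ> inv_into D \<phi>)"
      using f c by (auto simp: smooth_fun_def)
  qed (auto simp: chart_inv[OF M c] eq)
qed

lemma smooth_fun_subset: "smooth_fun \<A> V f \<Longrightarrow> U \<subseteq> V \<Longrightarrow> smooth_fun \<A> U f"
  unfolding smooth_fun_def by (fast elim: smooth_on_subset)

lemma smooth_fun_local:
  assumes M: "smooth_manifold \<A>" and l: "\<And>x. x \<in> U \<Longrightarrow> \<exists>V. open V \<and> x \<in> V \<and> smooth_fun \<A> V f"
  shows "smooth_fun \<A> U f"
  unfolding smooth_fun_def
proof clarify
  fix D \<phi> assume c: "(D, \<phi>) \<in> \<A>"
  show "smooth_on (\<phi> ` (U \<inter> D)) (f \<circ> inv_into D \<phi>)"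
  proof (rule smooth_on_local)
    fix z assume "z \<in> \<phi> ` (U \<inter> D)"
    then obtain x where x: "x \<in> U" "x \<in> D" "z = \<phi> x" by auto
    obtain V where V: "open V" "x \<in> V" "smooth_fun \<A> V f"
      using l[OF x(1)] by blast
    have "smooth_on (\<phi> ` (V \<inter> D)) (f \<circ> inv_into D \<phi>)"
      using V(3) c by (auto simp: smooth_fun_def)
    then show "\<exists>T. open T \<and> z \<in> T \<and> smooth_on T (f \<circ> inv_into D \<phi>)"
      using open_chart_image[OF M c V(1)] V(2) x by blast
  qed
qed

lemma smooth_fun_near: "open U \<Longrightarrow> x \<in> U \<Longrightarrow> smooth_fun \<A> U f \<Longrightarrow> smooth_near \<A> x f"
  unfolding smooth_near_def by blast

lemma smooth_fun_iff_near:
  "smooth_manifold \<A> \<Longrightarrow> open U \<Longrightarrow> smooth_fun \<A> U f \<longleftrightarrow> (\<forall>x\<in>U. smooth_near \<A> x f)"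
  using smooth_fun_local smooth_fun_near unfolding smooth_near_def by metis

lemma smooth_near_eventually:
  "smooth_near \<A> x f \<Longrightarrow> \<forall>\<^sub>F z in nhds x. smooth_near \<A> z f"
  unfolding smooth_near_def eventually_nhds by blast

lemma smooth_near_cong:
  assumes M: "smooth_manifold \<A>" and f: "smooth_near \<A> x f" and e: "\<forall>\<^sub>F z in nhds x. f z = h z"
  shows "smooth_near \<A> x h"
proof -
  obtain U where U: "open U" "x \<in> U" "smooth_fun \<A> U f"
    using f unfolding smooth_near_def by blast
  obtain V where V: "open V" "x \<in> V" "\<And>z. z \<in> V \<Longrightarrow> f z = h z"
    using e unfolding eventually_nhds by blast
  have "smooth_fun \<A> (U \<inter> V) h"
    using U V by (intro smooth_fun_cong[OF M _ _ smooth_fun_subset[OF U(3)]]) auto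
  with U V show ?thesis by (auto simp: smooth_near_def)
qed

lemma smooth_fun_const: "smooth_fun \<A> U (\<lambda>x. c)"
  by (auto simp: smooth_fun_def o_def smooth_on_const)

lemma smooth_near_const: "smooth_near \<A> x (\<lambda>x. c)"
  using smooth_fun_const smooth_near_def by blast

lemma smooth_fun_add:
  assumes M: "smooth_manifold \<A>" and "open U" "smooth_fun \<A> U f" "smooth_fun \<A> U h"
  shows "smooth_fun \<A> U (\<lambda>x. f x + h x)"
  using open_chart_image[OF M _ assms(2)] smooth_fun_chartD[OF assms(3)] smooth_fun_chartD[OF assms(4)]
  unfolding o_def by (intro smooth_funI) (auto simp: o_def intro!: smooth_on_add)

lemma smooth_fun_mult:
  fixes f h :: "_ \<Rightarrow> real"
  assumes M: "smooth_manifold \<A>" and "open U" "smooth_fun \<A> U f" "smooth_fun \<A> U h"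
  shows "smooth_fun \<A> U (\<lambda>x. f x * h x)"
  using open_chart_image[OF M _ assms(2)] smooth_fun_chartD[OF assms(3)] smooth_fun_chartD[OF assms(4)]
  unfolding o_def by (intro smooth_funI) (auto simp: o_def intro!: smooth_on_scaleR[where 'b=real, simplified])

lemma smooth_near_add:
  assumes M: "smooth_manifold \<A>" and "smooth_near \<A> x f" "smooth_near \<A> x h"
  shows "smooth_near \<A> x (\<lambda>x. f x + h x)"
proof -
  obtain U where U: "open U" "x \<in> U" "smooth_fun \<A> U f"
    using assms(2) unfolding smooth_near_def by blast
  obtain V where V: "open V" "x \<in> V" "smooth_fun \<A> V h"
    using assms(3) unfolding smooth_near_def by blast
  have "smooth_fun \<A> (U \<inter> V) (\<lambda>x. f x + h x)"
    using U V by (intro smooth_fun_add[OF M] smooth_fun_subset[OF U(3)] smooth_fun_subset[OF V(3)]) auto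
  with U V show ?thesis by (auto simp: smooth_near_def)
qed

lemma smooth_near_mult:
  fixes f h :: "_ \<Rightarrow> real"
  assumes M: "smooth_manifold \<A>" and "smooth_near \<A> x f" "smooth_near \<A> x h"
  shows "smooth_near \<A> x (\<lambda>x. f x * h x)"
proof -
  obtain U where U: "open U" "x \<in> U" "smooth_fun \<A> U f"
    using assms(2) unfolding smooth_near_def by blast
  obtain V where V: "open V" "x \<in> V" "smooth_fun \<A> V h"
    using assms(3) unfolding smooth_near_def by blast
  have "smooth_fun \<A> (U \<inter> V) (\<lambda>x. f x * h x)"
    using U V by (intro smooth_fun_mult[OF M] smooth_fun_subset[OF U(3)] smooth_fun_subset[OF V(3)]) auto
  with U V show ?thesis by (auto simp: smooth_near_def)
qed

lemma smooth_near_sum: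
  fixes f :: "_ \<Rightarrow> _ \<Rightarrow> real"
  assumes M: "smooth_manifold \<A>" and "\<And>i. i \<in> I \<Longrightarrow> smooth_near \<A> x (f i)"
  shows "smooth_near \<A> x (\<lambda>z. \<Sum>i\<in>I. f i z)"
  using assms(2)
  by (induction I rule: infinite_finite_induct) (auto intro!: smooth_near_const smooth_near_add[OF M])

text \<open>Smoothness of a function on a subset of a chart domain can be tested in that chart.\<close>

lemma smooth_fun_chartI:
  assumes M: "smooth_manifold \<A>" and c: "(D, \<phi>) \<in> \<A>" and U: "open U" "U \<subseteq> D"
    and F: "smooth_on (\<phi> ` U) F" and f: "\<And>x. x \<in> U \<Longrightarrow> f x = F (\<phi> x)"
  shows "smooth_fun \<A> U f"
  unfolding smooth_fun_def
proof clarify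
  fix D' \<phi>' assume c': "(D', \<phi>') \<in> \<A>"
  have "smooth_on (\<phi>' ` (D' \<inter> D)) (\<phi> \<circ> inv_into D' \<phi>')"
    using M c c' unfolding smooth_manifold_def by fast
  then have t: "smooth_on (\<phi>' ` (U \<inter> D')) (\<phi> \<circ> inv_into D' \<phi>')"
    by (rule smooth_on_subset) (use U in auto)
  have o: "open (\<phi>' ` (U \<inter> D'))" "open (\<phi> ` U)"
    using open_chart_image[OF M c' U(1)] open_chart_image[OF M c U(1)] U(2) by (auto simp: Int_absorb2)
  have "smooth_on (\<phi>' ` (U \<inter> D')) (\<lambda>z. F ((\<phi> \<circ> inv_into D' \<phi>') z))"
    by (rule smooth_on_compose[OF o t F]) (auto simp: chart_inv[OF M c'])
  then show "smooth_on (\<phi>' ` (U \<inter> D')) (f \<circ> inv_into D' \<phi>')"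
    by (rule smooth_on_cong[OF o(1), rotated]) (auto simp: chart_inv[OF M c'] f)
qed

lemma smooth_fun_coord:
  assumes M: "smooth_manifold \<A>" and c: "(D, \<phi>) \<in> \<A>"
  shows "smooth_fun \<A> D (\<lambda>x. \<phi> x \<bullet> b)"
proof (rule smooth_fun_chartI[OF M c open_chart_domain[OF M c]])
  have "open (\<phi> ` D)"
    using open_chart_image[OF M c open_UNIV] by simp
  then show "smooth_on (\<phi> ` D) (\<lambda>z. z \<bullet> b)"
    using smooth_on_bounded_linear[OF _ bounded_linear_inner_left smooth_on_ident] by blast
qed auto

lemma open_vimage_smooth_map: "smooth_map \<B> \<A> \<iota> \<Longrightarrow> open W \<Longrightarrow> open (\<iota> -` W)"
  by (simp add: smooth_map_def open_vimage)

lemma smooth_fun_compose_map: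
  assumes MB: "smooth_manifold \<B>" and MA: "smooth_manifold \<A>" and \<iota>: "smooth_map \<B> \<A> \<iota>"
    and U: "open U" and f: "smooth_fun \<A> U f"
  shows "smooth_fun \<B> (\<iota> -` U) (f \<circ> \<iota>)"
proof (rule smooth_fun_local[OF MB])
  fix y assume y: "y \<in> \<iota> -` U"
  obtain D \<phi> where c: "(D, \<phi>) \<in> \<A>" "\<iota> y \<in> D"
    using chart_at[OF MA] by blast
  have D: "open D" using open_chart_domain[OF MA c(1)] .
  let ?V = "\<iota> -` (U \<inter> D)"
  have V: "open ?V" using open_vimage_smooth_map[OF \<iota> open_Int[OF U D]] .
  have "smooth_on (\<phi>' ` (?V \<inter> D')) ((f \<circ> \<iota>) \<circ> inv_into D' \<phi>')" if c': "(D', \<phi>') \<in> \<B>" for D' \<phi>'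
  proof -
    have o: "open (\<phi>' ` (?V \<inter> D'))" "open (\<phi> ` (U \<inter> D))"
      using open_chart_image[OF MB c' V] open_chart_image[OF MA c(1) U] .
    have "smooth_on (\<phi>' ` (\<iota> -` D \<inter> D')) ((\<phi> \<circ> \<iota>) \<circ> inv_into D' \<phi>')"
      using \<iota> c c' unfolding smooth_map_def smooth_fun_def by fast
    then have g: "smooth_on (\<phi>' ` (?V \<inter> D')) ((\<phi> \<circ> \<iota>) \<circ> inv_into D' \<phi>')"
      by (rule smooth_on_subset) auto
    have f': "smooth_on (\<phi> ` (U \<inter> D)) (f \<circ> inv_into D \<phi>)"
      using f c by (auto simp: smooth_fun_def)
    have "smooth_on (\<phi>' ` (?V \<inter> D')) (\<lambda>z. (f \<circ> inv_into D \<phi>) (((\<phi> \<circ> \<iota>) \<circ> inv_into D' \<phi>') z))"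
      by (rule smooth_on_compose[OF o g f']) (auto simp: chart_inv[OF MB c'])
    then show ?thesis
      by (rule smooth_on_cong[OF o(1), rotated]) (auto simp: chart_inv[OF MB c'] chart_inv[OF MA c(1)])
  qed
  then have "smooth_fun \<B> ?V (f \<circ> \<iota>)"
    by (auto simp: smooth_fun_def)
  with V y c show "\<exists>V. open V \<and> y \<in> V \<and> smooth_fun \<B> V (f \<circ> \<iota>)" by auto
qed

lemma smooth_near_compose_map:
  assumes "smooth_manifold \<B>" "smooth_manifold \<A>" "smooth_map \<B> \<A> \<iota>" "smooth_near \<A> (\<iota> y) f"
  shows "smooth_near \<B> y (f \<circ> \<iota>)"
  using assms smooth_fun_compose_map open_vimage_smooth_map unfolding smooth_near_def
  by (metis vimageI)

lemma smooth_map_id: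
  assumes M: "smooth_manifold \<A>"
  shows "smooth_map \<A> \<A> id"
  unfolding smooth_map_def
proof safe
  fix D \<phi> assume c: "(D, \<phi>) \<in> \<A>"
  have "smooth_on (\<phi> ` D) (\<lambda>z. z)"
    using smooth_on_ident open_chart_image[OF M c open_UNIV] by auto
  then show "smooth_fun \<A> (id -` D) (\<phi> \<circ> id)"
    using smooth_fun_chartI[OF M c open_chart_domain[OF M c], of "\<lambda>z. z" \<phi>] by simp
qed (simp add: continuous_on_id')

lemma manifold_bump:
  fixes \<A> :: "('a::{t2_space, second_countable_topology}, 'e::euclidean_space) atlas"
  assumes M: "smooth_manifold \<A>" and A: "open A" "x \<in> A"
  obtains \<rho> :: "'a \<Rightarrow> real" and K where "smooth_fun \<A> UNIV \<rho>" "\<rho> x = 1" "closed K" "K \<subseteq> A"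
    "\<And>z. z \<notin> K \<Longrightarrow> \<rho> z = 0"
proof -
  obtain D \<phi> where c: "(D, \<phi>) \<in> \<A>" "x \<in> D"
    using chart_at[OF M] by blast
  have "open (\<phi> ` (A \<inter> D))" "\<phi> x \<in> \<phi> ` (A \<inter> D)"
    using open_chart_image[OF M c(1) A(1)] A c by auto
  then obtain r where r: "r > 0" "cball (\<phi> x) r \<subseteq> \<phi> ` (A \<inter> D)"
    using open_contains_cball by blast
  obtain \<beta> :: "'e \<Rightarrow> real" where \<beta>: "smooth_on UNIV \<beta>" "\<beta> (\<phi> x) = 1" "\<And>z. z \<notin> ball (\<phi> x) r \<Longrightarrow> \<beta> z = 0"
    using euclidean_bump[OF r(1)] by blast
  define K where "K = inv_into D \<phi> ` cball (\<phi> x) r"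
  define \<rho> where "\<rho> z = (if z \<in> D then \<beta> (\<phi> z) else 0)" for z
  have "cball (\<phi> x) r \<subseteq> \<phi> ` D" using r by auto
  then have "compact K"
    unfolding K_def
    by (intro compact_continuous_image continuous_on_subset[OF continuous_on_chart_inv[OF M c(1)]]) auto
  then have K: "closed K" by (rule compact_imp_closed)
  have KA: "K \<subseteq> A \<inter> D"
    using r chart_inv[OF M c(1)] by (fastforce simp: K_def)
  have \<rho>0: "\<rho> z = 0" if "z \<notin> K" for z
  proof (cases "z \<in> D")
    case True
    then have "\<phi> z \<notin> ball (\<phi> x) r"
      using that chart_inv[OF M c(1) True] unfolding K_def by (metis ball_subset_cball image_eqI subsetD)
    then show ?thesis using \<beta>(3) by (simp add: \<rho>_def)
  qed (simp add: \<rho>_def)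
  have 1: "smooth_fun \<A> D \<rho>"
    using smooth_on_subset[OF \<beta>(1)]
    by (intro smooth_fun_chartI[OF M c(1) open_chart_domain[OF M c(1)], of \<beta>]) (auto simp: \<rho>_def)
  have 2: "smooth_fun \<A> (- K) \<rho>"
    using K \<rho>0 by (intro smooth_fun_cong[OF M _ _ smooth_fun_const[of _ _ 0]]) auto
  have "smooth_fun \<A> UNIV \<rho>"
  proof (rule smooth_fun_local[OF M])
    fix z
    show "\<exists>V. open V \<and> z \<in> V \<and> smooth_fun \<A> V \<rho>"
    proof (cases "z \<in> K")
      case True
      then show ?thesis using 1 KA open_chart_domain[OF M c(1)] by blast
    next
      case False
      then show ?thesis using 2 K by blast
    qed
  qed
  then show ?thesis
    using that[of \<rho> K] K KA \<rho>0 c \<beta> by (auto simp: \<rho>_def)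
qed

section \<open>Tangent vectors and coordinate vector fields\<close>

lemma sum_fun_apply: "(\<Sum>i\<in>I. F i) x = (\<Sum>i\<in>I. F i x)"
  by (induction I rule: infinite_finite_induct) auto

lemma scaleR_fun_apply: "(c *\<^sub>R F) x = c *\<^sub>R F x"
  by (simp add: scaleR_fun_def)

lemma
  assumes "v \<in> tangent_space \<A> x"
  shows tangent_add: "smooth_near \<A> x f \<Longrightarrow> smooth_near \<A> x h \<Longrightarrow> v (\<lambda>z. f z + h z) = v f + v h"
    and tangent_mult:
      "smooth_near \<A> x f \<Longrightarrow> smooth_near \<A> x h \<Longrightarrow> v (\<lambda>z. f z * h z) = v f * h x + f x * v h"
    and tangent_scale: "smooth_near \<A> x f \<Longrightarrow> v (\<lambda>z. c * f z) = c * v f"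
    and tangent_cong: "smooth_near \<A> x f \<Longrightarrow> \<forall>\<^sub>F z in nhds x. f z = h z \<Longrightarrow> v f = v h"
    and tangent_not_smooth: "\<not> smooth_near \<A> x f \<Longrightarrow> v f = 0"
  using assms unfolding tangent_space_def by simp_all

lemma tangent_spaceI:
  assumes "\<And>f h. smooth_near \<A> x f \<Longrightarrow> smooth_near \<A> x h \<Longrightarrow> v (\<lambda>z. f z + h z) = v f + v h"
    and "\<And>f h. smooth_near \<A> x f \<Longrightarrow> smooth_near \<A> x h \<Longrightarrow> v (\<lambda>z. f z * h z) = v f * h x + f x * v h"
    and "\<And>c f. smooth_near \<A> x f \<Longrightarrow> v (\<lambda>z. c * f z) = c * v f"
    and "\<And>f h. smooth_near \<A> x f \<Longrightarrow> \<forall>\<^sub>F z in nhds x. f z = h z \<Longrightarrow> v f = v h"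
    and "\<And>f. \<not> smooth_near \<A> x f \<Longrightarrow> v f = 0"
  shows "v \<in> tangent_space \<A> x"
  using assms unfolding tangent_space_def by simp

lemma tangent_const:
  assumes v: "v \<in> tangent_space \<A> x"
  shows "v (\<lambda>z. c) = 0"
proof -
  have "v (\<lambda>z. 1) = 0"
    using tangent_mult[OF v smooth_near_const smooth_near_const, of 1 1] by simp
  then show ?thesis
    using tangent_scale[OF v smooth_near_const, of c 1] by simp
qed

lemma tangent_sum:
  assumes M: "smooth_manifold \<A>" and v: "v \<in> tangent_space \<A> x"
    and "\<And>i. i \<in> I \<Longrightarrow> smooth_near \<A> x (f i)"
  shows "v (\<lambda>z. \<Sum>i\<in>I. f i z) = (\<Sum>i\<in>I. v (f i))"
  using assms(3)
  by (induction I rule: infinite_finite_induct)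
    (auto simp: tangent_const[OF v] tangent_add[OF v] smooth_near_sum[OF M])

lemma subspace_tangent_space: "subspace (tangent_space \<A> x)"
  unfolding subspace_def
proof (intro conjI ballI allI)
  show "0 \<in> tangent_space \<A> x"
    by (rule tangent_spaceI) auto
  show "u + v \<in> tangent_space \<A> x" if "u \<in> tangent_space \<A> x" "v \<in> tangent_space \<A> x" for u v
    using tangent_add[OF that(1)] tangent_add[OF that(2)] tangent_mult[OF that(1)] tangent_mult[OF that(2)]
      tangent_scale[OF that(1)] tangent_scale[OF that(2)] tangent_cong[OF that(1)] tangent_cong[OF that(2)]
      tangent_not_smooth[OF that(1)] tangent_not_smooth[OF that(2)]
    by (intro tangent_spaceI) (auto simp: algebra_simps)
  show "c *\<^sub>R v \<in> tangent_space \<A> x" if "v \<in> tangent_space \<A> x" for c v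
    using tangent_add[OF that] tangent_mult[OF that] tangent_scale[OF that] tangent_cong[OF that]
      tangent_not_smooth[OF that]
    by (intro tangent_spaceI) (auto simp: scaleR_fun_apply algebra_simps)
qed

lemma pushforward_tangent:
  assumes "smooth_manifold \<B>" "smooth_manifold \<A>" "smooth_map \<B> \<A> \<iota>" and w: "w \<in> tangent_space \<B> y"
  shows "pushforward \<A> \<iota> y w \<in> tangent_space \<A> (\<iota> y)"
proof (rule tangent_spaceI)
  note sm = smooth_near_compose_map[OF assms(1-3), unfolded o_def]
  note MA = assms(2)
  fix f h :: "_ \<Rightarrow> real" assume f: "smooth_near \<A> (\<iota> y) f"
  show "pushforward \<A> \<iota> y w (\<lambda>z. c * f z) = c * pushforward \<A> \<iota> y w f" for c
    using f smooth_near_mult[OF MA smooth_near_const f]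
    by (simp add: pushforward_def o_def tangent_scale[OF w] sm)
  show "pushforward \<A> \<iota> y w f = pushforward \<A> \<iota> y w h" if e: "\<forall>\<^sub>F z in nhds (\<iota> y). f z = h z"
  proof -
    obtain U where U: "open U" "\<iota> y \<in> U" "\<And>z. z \<in> U \<Longrightarrow> f z = h z"
      using e unfolding eventually_nhds by blast
    have "\<forall>\<^sub>F z in nhds y. f (\<iota> z) = h (\<iota> z)"
      unfolding eventually_nhds
      using U open_vimage_smooth_map[OF assms(3) U(1)] by (intro exI[of _ "\<iota> -` U"]) auto
    then show ?thesis
      using f smooth_near_cong[OF MA f e]
      by (simp add: pushforward_def o_def tangent_cong[OF w sm[OF f]])
  qed
  assume h: "smooth_near \<A> (\<iota> y) h"
  show "pushforward \<A> \<iota> y w (\<lambda>z. f z + h z) = pushforward \<A> \<iota> y w f + pushforward \<A> \<iota> y w h"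
    using f h smooth_near_add[OF MA f h]
    by (simp add: pushforward_def o_def tangent_add[OF w] sm)
  show "pushforward \<A> \<iota> y w (\<lambda>z. f z * h z) =
      pushforward \<A> \<iota> y w f * h (\<iota> y) + f (\<iota> y) * pushforward \<A> \<iota> y w h"
    using f h smooth_near_mult[OF MA f h]
    by (simp add: pushforward_def o_def tangent_mult[OF w] sm)
qed (simp add: pushforward_def)

lemma linear_pushforward: "linear (pushforward \<A> \<iota> y)"
  by (rule linearI) (auto simp: pushforward_def fun_eq_iff scaleR_fun_apply)

text \<open>The coordinate vector fields \<open>\<partial>\<^sub>b\<close> of a chart \<open>\<phi>\<close> with domain \<open>D\<close>.\<close>

definition coord_field ::
  "('a::topological_space, 'e::euclidean_space) atlas \<Rightarrow> 'a set \<Rightarrow> ('a \<Rightarrow> 'e) \<Rightarrow> 'e \<Rightarrow> 'a \<Rightarrow> 'a tvec" where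
  "coord_field \<A> D \<phi> b x =
     (\<lambda>f. if smooth_near \<A> x f then frechet_derivative (f \<circ> inv_into D \<phi>) (at (\<phi> x)) b else 0)"

lemma chart_has_derivative:
  fixes f :: "'a::{t2_space, second_countable_topology} \<Rightarrow> real"
  assumes c: "(D, \<phi>) \<in> \<A>" "x \<in> D" and f: "smooth_near \<A> x f"
  shows "(f \<circ> inv_into D \<phi> has_derivative (\<lambda>b. coord_field \<A> D \<phi> b x f)) (at (\<phi> x))"
proof -
  obtain U where U: "open U" "x \<in> U" "smooth_fun \<A> U f"
    using f unfolding smooth_near_def by blast
  have "(f \<circ> inv_into D \<phi> has_derivative frechet_derivative (f \<circ> inv_into D \<phi>) (at (\<phi> x))) (at (\<phi> x))"
    using smooth_on_has_derivative[OF smooth_fun_chartD[OF U(3) c(1)]] U c by blast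
  then show ?thesis
    using f by (simp add: coord_field_def)
qed

lemma coord_field_eqI:
  fixes f :: "'a::{t2_space, second_countable_topology} \<Rightarrow> real"
  assumes c: "(D, \<phi>) \<in> \<A>" "x \<in> D" and f: "smooth_near \<A> x f"
    and "(f \<circ> inv_into D \<phi> has_derivative F) (at (\<phi> x))"
  shows "coord_field \<A> D \<phi> b x f = F b"
  using has_derivative_unique[OF chart_has_derivative[OF c f] assms(4)] by (rule fun_cong)

lemma coord_field_tangent:
  fixes \<A> :: "('a::{t2_space, second_countable_topology}, 'e::euclidean_space) atlas"
  assumes M: "smooth_manifold \<A>" and c: "(D, \<phi>) \<in> \<A>" "x \<in> D"
  shows "coord_field \<A> D \<phi> b x \<in> tangent_space \<A> x"
proof (rule tangent_spaceI)
  fix f h :: "'a \<Rightarrow> real" assume f: "smooth_near \<A> x f"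
  note df = chart_has_derivative[OF c f]
  show "coord_field \<A> D \<phi> b x (\<lambda>z. r * f z) = r * coord_field \<A> D \<phi> b x f" for r
    using has_derivative_mult_right[OF df, of r]
    by (intro coord_field_eqI[OF c smooth_near_mult[OF M smooth_near_const f]]) (simp add: o_def)
  show "coord_field \<A> D \<phi> b x f = coord_field \<A> D \<phi> b x h" if e: "\<forall>\<^sub>F z in nhds x. f z = h z"
  proof -
    have h: "smooth_near \<A> x h" using smooth_near_cong[OF M f e] .
    obtain U where U: "open U" "x \<in> U" "\<And>z. z \<in> U \<Longrightarrow> f z = h z"
      using e unfolding eventually_nhds by blast
    have "(h \<circ> inv_into D \<phi> has_derivative (\<lambda>b. coord_field \<A> D \<phi> b x f)) (at (\<phi> x))"
      using df open_chart_image[OF M c(1) U(1)]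
    proof (rule has_derivative_transform_within_open)
      show "\<phi> x \<in> \<phi> ` (U \<inter> D)" using U c by auto
    qed (auto simp: chart_inv[OF M c(1)] U)
    then show ?thesis using coord_field_eqI[OF c h] by simp
  qed
  assume h: "smooth_near \<A> x h"
  note dh = chart_has_derivative[OF c h]
  show "coord_field \<A> D \<phi> b x (\<lambda>z. f z + h z) = coord_field \<A> D \<phi> b x f + coord_field \<A> D \<phi> b x h"
    using has_derivative_add[OF df dh]
    by (intro coord_field_eqI[OF c smooth_near_add[OF M f h]]) (simp add: o_def)
  show "coord_field \<A> D \<phi> b x (\<lambda>z. f z * h z) =
      coord_field \<A> D \<phi> b x f * h x + f x * coord_field \<A> D \<phi> b x h"
    using has_derivative_mult[OF df dh] chart_inv[OF M c]
      coord_field_eqI[OF c smooth_near_mult[OF M f h]]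
    by (simp add: o_def algebra_simps)
qed (simp add: coord_field_def)

lemma coord_field_coord:
  fixes \<A> :: "('a::{t2_space, second_countable_topology}, 'e::euclidean_space) atlas"
  assumes M: "smooth_manifold \<A>" and c: "(D, \<phi>) \<in> \<A>" "x \<in> D"
  shows "coord_field \<A> D \<phi> b x (\<lambda>z. \<phi> z \<bullet> b') = b \<bullet> b'"
proof (rule coord_field_eqI[OF c])
  show "smooth_near \<A> x (\<lambda>z. \<phi> z \<bullet> b')"
    using smooth_fun_near[OF open_chart_domain[OF M c(1)] c(2) smooth_fun_coord[OF M c(1)]] .
  have "((\<lambda>z. z \<bullet> b') has_derivative (\<lambda>b. b \<bullet> b')) (at (\<phi> x))"
    by (rule bounded_linear_imp_has_derivative[OF bounded_linear_inner_left])
  moreover have "open (\<phi> ` D)"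
    using open_chart_image[OF M c(1) open_UNIV] by simp
  ultimately show "((\<lambda>z. \<phi> z \<bullet> b') \<circ> inv_into D \<phi> has_derivative (\<lambda>b. b \<bullet> b')) (at (\<phi> x))"
    by (rule has_derivative_transform_within_open) (use c in \<open>auto simp: chart_inv[OF M c(1)]\<close>)
qed

text \<open>Tangent vectors are determined by their values on the coordinates of a chart.  By Hadamard's
  lemma, a smooth function is near \<open>x\<close> the sum of a constant and of products of two functions, one
  of which is a coordinate minus its value at \<open>x\<close>.\<close>

lemma tangent_expansion:
  fixes \<A> :: "('a::{t2_space, second_countable_topology}, 'e::euclidean_space) atlas"
  assumes M: "smooth_manifold \<A>" and c: "(D, \<phi>) \<in> \<A>" "x \<in> D" and v: "v \<in> tangent_space \<A> x"
  shows "v = (\<Sum>b\<in>Basis. v (\<lambda>z. \<phi> z \<bullet> b) *\<^sub>R coord_field \<A> D \<phi> b x)"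
proof
  fix f :: "'a \<Rightarrow> real"
  show "v f = (\<Sum>b\<in>Basis. v (\<lambda>z. \<phi> z \<bullet> b) *\<^sub>R coord_field \<A> D \<phi> b x) f"
  proof (cases "smooth_near \<A> x f")
    case False
    then show ?thesis
      by (simp add: tangent_not_smooth[OF v] sum_fun_apply scaleR_fun_apply coord_field_def)
  next
    case True
    obtain U where U: "open U" "x \<in> U" "smooth_fun \<A> U f"
      using True unfolding smooth_near_def by blast
    let ?F = "f \<circ> inv_into D \<phi>"
    have "\<phi> x \<in> \<phi> ` (U \<inter> D)" using U c by auto
    then obtain r where r: "r > 0" "ball (\<phi> x) r \<subseteq> \<phi> ` (U \<inter> D)"
      using open_chart_image[OF M c(1) U(1)] open_contains_ball by blast
    have F: "smooth_on (ball (\<phi> x) r) ?F"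
      using smooth_on_subset[OF smooth_fun_chartD[OF U(3) c(1)] r(2)] .
    have a: "\<phi> x \<in> ball (\<phi> x) r" using r(1) by simp
    obtain h where h: "\<And>b. smooth_on (ball (\<phi> x) r) (h b)"
      "\<And>b. h b (\<phi> x) = frechet_derivative ?F (at (\<phi> x)) b"
      "\<And>z. z \<in> ball (\<phi> x) r \<Longrightarrow> ?F z = ?F (\<phi> x) + (\<Sum>b\<in>Basis. (z \<bullet> b - \<phi> x \<bullet> b) * h b z)"
      using Hadamard[OF open_ball convex_ball a F] by blast
    define W where "W = D \<inter> \<phi> -` ball (\<phi> x) r"
    have W: "open W" "W \<subseteq> D" "x \<in> W" "\<phi> ` W \<subseteq> ball (\<phi> x) r"
      unfolding W_def
      using continuous_open_preimage[OF continuous_on_chart[OF M c(1)] open_chart_domain[OF M c(1)] open_ball] c a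
      by auto
    have H: "smooth_near \<A> x (\<lambda>z. h b (\<phi> z))" for b
      using smooth_fun_chartI[OF M c(1) W(1,2) smooth_on_subset[OF h(1) W(4)]]
      by (intro smooth_fun_near[OF W(1,3)]) auto
    have C: "smooth_near \<A> x (\<lambda>z. \<phi> z \<bullet> b)" for b
      using smooth_fun_near[OF open_chart_domain[OF M c(1)] c(2) smooth_fun_coord[OF M c(1)]] .
    have C': "smooth_near \<A> x (\<lambda>z. \<phi> z \<bullet> b + - (\<phi> x \<bullet> b))" for b
      by (intro smooth_near_add[OF M] C smooth_near_const)
    have vC': "v (\<lambda>z. \<phi> z \<bullet> b + - (\<phi> x \<bullet> b)) = v (\<lambda>z. \<phi> z \<bullet> b)" for b
      using tangent_add[OF v C[of b] smooth_near_const[of _ _ "- (\<phi> x \<bullet> b)"]] tangent_const[OF v] by simp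
    have "f z = f x + (\<Sum>b\<in>Basis. (\<phi> z \<bullet> b + - (\<phi> x \<bullet> b)) * h b (\<phi> z))" if "z \<in> W" for z
    proof -
      have "\<phi> z \<in> ball (\<phi> x) r" "z \<in> D" using that W by auto
      then show ?thesis
        using h(3)[of "\<phi> z"] chart_inv[OF M c(1)] c(2) by simp
    qed
    then have "\<forall>\<^sub>F z in nhds x. f z = f x + (\<Sum>b\<in>Basis. (\<phi> z \<bullet> b + - (\<phi> x \<bullet> b)) * h b (\<phi> z))"
      using W unfolding eventually_nhds by blast
    then have "v f = v (\<lambda>z. f x + (\<Sum>b\<in>Basis. (\<phi> z \<bullet> b + - (\<phi> x \<bullet> b)) * h b (\<phi> z)))"
      by (rule tangent_cong[OF v True])
    also have "\<dots> = v (\<lambda>z. \<Sum>b\<in>Basis. (\<phi> z \<bullet> b + - (\<phi> x \<bullet> b)) * h b (\<phi> z))"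
      using tangent_add[OF v smooth_near_const smooth_near_sum[OF M smooth_near_mult[OF M C' H]]]
      by (simp add: tangent_const[OF v])
    also have "\<dots> = (\<Sum>b\<in>Basis. v (\<lambda>z. (\<phi> z \<bullet> b + - (\<phi> x \<bullet> b)) * h b (\<phi> z)))"
      by (rule tangent_sum[OF M v smooth_near_mult[OF M C' H]])
    also have "\<dots> = (\<Sum>b\<in>Basis. v (\<lambda>z. \<phi> z \<bullet> b) * h b (\<phi> x))"
      using tangent_mult[OF v C' H, unfolded vC'] by simp
    finally show ?thesis
      using True by (simp add: h(2) sum_fun_apply scaleR_fun_apply coord_field_def)
  qed
qed

section \<open>Smooth sections along a map\<close>

text \<open>The condition on \<open>V\<close> at a single point \<open>y\<close> which, imposed at all points of an open set,
  makes \<open>V\<close> a smooth section there.\<close>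

definition section_at where
  "section_at \<B> \<A> \<iota> y V \<longleftrightarrow> V y \<in> tangent_space \<A> (\<iota> y) \<and>
     (\<forall>f :: _ \<Rightarrow> real. smooth_near \<A> (\<iota> y) f \<longrightarrow> smooth_near \<B> y (\<lambda>z. V z f))"

lemma section_along_iff:
  assumes MB: "smooth_manifold \<B>" and \<iota>: "smooth_map \<B> \<A> \<iota>" and A: "open A"
  shows "section_along \<B> \<A> \<iota> A V \<longleftrightarrow> (\<forall>y\<in>A. section_at \<B> \<A> \<iota> y V)"
proof
  assume V: "section_along \<B> \<A> \<iota> A V"
  show "\<forall>y\<in>A. section_at \<B> \<A> \<iota> y V"
    unfolding section_at_def
  proof safe
    fix y assume y: "y \<in> A"
    then show "V y \<in> tangent_space \<A> (\<iota> y)" using V by (simp add: section_along_def)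
    fix f :: "_ \<Rightarrow> real" assume "smooth_near \<A> (\<iota> y) f"
    then obtain U where U: "open U" "\<iota> y \<in> U" "smooth_fun \<A> U f"
      unfolding smooth_near_def by blast
    then have "smooth_fun \<B> (A \<inter> \<iota> -` U) (\<lambda>z. V z f)"
      using V by (simp add: section_along_def)
    then show "smooth_near \<B> y (\<lambda>z. V z f)"
      using U y A open_vimage_smooth_map[OF \<iota> U(1)]
      by (intro smooth_fun_near[of "A \<inter> \<iota> -` U"]) auto
  qed
next
  assume V: "\<forall>y\<in>A. section_at \<B> \<A> \<iota> y V"
  show "section_along \<B> \<A> \<iota> A V"
    unfolding section_along_def
  proof safe
    show "V y \<in> tangent_space \<A> (\<iota> y)" if "y \<in> A" for y
      using V that by (simp add: section_at_def)
    fix U and f :: "_ \<Rightarrow> real" assume U: "open U" "smooth_fun \<A> U f"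
    have o: "open (A \<inter> \<iota> -` U)"
      using A open_vimage_smooth_map[OF \<iota> U(1)] by auto
    have "smooth_near \<B> z (\<lambda>z. V z f)" if z: "z \<in> A \<inter> \<iota> -` U" for z
      using V z smooth_fun_near[OF U(1) _ U(2)] by (auto simp: section_at_def)
    then show "smooth_fun \<B> (A \<inter> \<iota> -` U) (\<lambda>z. V z f)"
      by (simp add: smooth_fun_iff_near[OF MB o])
  qed
qed

lemma section_near_iff:
  assumes "smooth_manifold \<B>" and "smooth_map \<B> \<A> \<iota>"
  shows "section_near \<B> \<A> \<iota> y V \<longleftrightarrow> (\<forall>\<^sub>F z in nhds y. section_at \<B> \<A> \<iota> z V)"
  unfolding section_near_def eventually_nhds using section_along_iff[OF assms] by blast

lemma section_near_at:
  assumes "smooth_manifold \<B>" and "smooth_map \<B> \<A> \<iota>" "section_near \<B> \<A> \<iota> y V"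
  shows "section_at \<B> \<A> \<iota> y V"
  using assms eventually_nhds_x_imp_x section_near_iff by blast

lemma section_near_imp_section_along:
  assumes "smooth_manifold \<B>" "smooth_map \<B> \<A> \<iota>" "open A" "\<And>y. y \<in> A \<Longrightarrow> section_near \<B> \<A> \<iota> y V"
  shows "section_along \<B> \<A> \<iota> A V"
  using assms section_along_iff section_near_at by blast

lemma section_along_near: "open A \<Longrightarrow> y \<in> A \<Longrightarrow> section_along \<B> \<A> \<iota> A V \<Longrightarrow> section_near \<B> \<A> \<iota> y V"
  unfolding section_near_def by blast

lemma section_near_cong:
  assumes M: "smooth_manifold \<B>" "smooth_map \<B> \<A> \<iota>" and V: "section_near \<B> \<A> \<iota> y V"
    and e: "\<forall>\<^sub>F z in nhds y. V z = V' z"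
  shows "section_near \<B> \<A> \<iota> y V'"
  using V eventually_eventually[THEN iffD2, OF e]
  unfolding section_near_iff[OF M]
proof eventually_elim
  case (elim z)
  have "V z = V' z" using eventually_nhds_x_imp_x[OF elim(2)] .
  moreover have "smooth_near \<B> z (\<lambda>z. V' z f)" if "smooth_near \<A> (\<iota> z) f" for f :: "_ \<Rightarrow> real"
  proof (rule smooth_near_cong[OF M(1)])
    show "smooth_near \<B> z (\<lambda>z. V z f)" using elim(1) that by (simp add: section_at_def)
    show "\<forall>\<^sub>F w in nhds z. V w f = V' w f" using elim(2) by eventually_elim simp
  qed
  ultimately show ?case using elim(1) by (simp add: section_at_def)
qed

lemma section_near_add:
  assumes M: "smooth_manifold \<B>" "smooth_map \<B> \<A> \<iota>"
    and V: "section_near \<B> \<A> \<iota> y V" and V': "section_near \<B> \<A> \<iota> y V'"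
  shows "section_near \<B> \<A> \<iota> y (\<lambda>z. V z + V' z)"
  using V V' unfolding section_near_iff[OF M]
  by eventually_elim
    (auto simp: section_at_def intro!: smooth_near_add[OF M(1)] subspace_add[OF subspace_tangent_space])

lemma section_near_scaleR:
  assumes M: "smooth_manifold \<B>" "smooth_map \<B> \<A> \<iota>"
    and f: "smooth_near \<B> y f" and V: "section_near \<B> \<A> \<iota> y V"
  shows "section_near \<B> \<A> \<iota> y (\<lambda>z. f z *\<^sub>R V z)"
  using V smooth_near_eventually[OF f] unfolding section_near_iff[OF M]
  by eventually_elim
    (auto simp: section_at_def scaleR_fun_apply intro!: smooth_near_mult[OF M(1)] subspace_mul[OF subspace_tangent_space])

lemma section_near_zero:
  assumes M: "smooth_manifold \<B>" "smooth_map \<B> \<A> \<iota>"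
  shows "section_near \<B> \<A> \<iota> y (\<lambda>z. 0)"
  unfolding section_near_iff[OF M]
  by (simp add: section_at_def smooth_near_const subspace_0[OF subspace_tangent_space])

lemma section_near_sum:
  assumes M: "smooth_manifold \<B>" "smooth_map \<B> \<A> \<iota>"
    and V: "\<And>i. i \<in> I \<Longrightarrow> section_near \<B> \<A> \<iota> y (V i)"
  shows "section_near \<B> \<A> \<iota> y (\<lambda>z. \<Sum>i\<in>I. V i z)"
  using V by (induction I rule: infinite_finite_induct)
    (auto intro!: section_near_add[OF M] section_near_zero[OF M])

lemma section_near_comp:
  assumes M: "smooth_manifold \<B>" "smooth_manifold \<A>" "smooth_map \<B> \<A> \<iota>"
    and Y: "section_near \<A> \<A> id (\<iota> y) Y"
  shows "section_near \<B> \<A> \<iota> y (Y \<circ> \<iota>)"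
proof -
  obtain A where A: "open A" "\<iota> y \<in> A" "section_along \<A> \<A> id A Y"
    using Y unfolding section_near_def by blast
  have "\<forall>x\<in>A. section_at \<A> \<A> id x Y"
    using A section_along_iff[OF M(2) smooth_map_id[OF M(2)] A(1)] by blast
  then have "\<forall>z\<in>\<iota> -` A. section_at \<B> \<A> \<iota> z (Y \<circ> \<iota>)"
    using smooth_near_compose_map[OF M] by (auto simp: section_at_def o_def)
  then show ?thesis
    using A open_vimage_smooth_map[OF M(3) A(1)] section_along_iff[OF M(1,3)]
    unfolding section_near_def by blast
qed

lemma section_near_pushforward:
  assumes M: "smooth_manifold \<B>" "smooth_manifold \<A>" "smooth_map \<B> \<A> \<iota>"
    and X: "section_near \<B> \<B> id y X"
  shows "section_near \<B> \<A> \<iota> y (\<lambda>z. pushforward \<A> \<iota> z (X z))"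
  using X unfolding section_near_iff[OF M(1,3)] section_near_iff[OF M(1) smooth_map_id[OF M(1)]]
proof eventually_elim
  case (elim z)
  have "smooth_near \<B> z (\<lambda>z. pushforward \<A> \<iota> z (X z) f)" if f: "smooth_near \<A> (\<iota> z) f" for f :: "_ \<Rightarrow> real"
  proof (rule smooth_near_cong[OF M(1)])
    show "smooth_near \<B> z (\<lambda>z. X z (f \<circ> \<iota>))"
      using elim smooth_near_compose_map[OF M f] by (simp add: section_at_def)
    obtain U where U: "open U" "\<iota> z \<in> U" "smooth_fun \<A> U f"
      using f unfolding smooth_near_def by blast
    then show "\<forall>\<^sub>F w in nhds z. X w (f \<circ> \<iota>) = pushforward \<A> \<iota> w (X w) f"
      unfolding eventually_nhds using open_vimage_smooth_map[OF M(3) U(1)] smooth_fun_near[OF U(1) _ U(3)]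
      by (intro exI[of _ "\<iota> -` U"]) (auto simp: pushforward_def)
  qed
  then show ?case
    using elim pushforward_tangent[OF M] by (auto simp: section_at_def)
qed

lemma section_near_coord_field:
  fixes \<A> :: "('a::{t2_space, second_countable_topology}, 'e::euclidean_space) atlas"
  assumes M: "smooth_manifold \<A>" and c: "(D, \<phi>) \<in> \<A>" "x \<in> D"
  shows "section_near \<A> \<A> id x (coord_field \<A> D \<phi> b)"
proof -
  have "section_at \<A> \<A> id x (coord_field \<A> D \<phi> b)" if x: "x \<in> D" for x
    unfolding section_at_def
  proof safe
    show "coord_field \<A> D \<phi> b x \<in> tangent_space \<A> (id x)"
      using coord_field_tangent[OF M c(1) x] by simp
    fix f :: "'a \<Rightarrow> real" assume "smooth_near \<A> (id x) f"
    then obtain U where U: "open U" "x \<in> U" "smooth_fun \<A> U f"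
      unfolding smooth_near_def by auto
    have o: "open (U \<inter> D)" using U open_chart_domain[OF M c(1)] by auto
    have "smooth_fun \<A> (U \<inter> D) (\<lambda>z. coord_field \<A> D \<phi> b z f)"
      using smooth_fun_near[OF U(1) _ U(3)]
      by (intro smooth_fun_chartI[OF M c(1) o _ smooth_on_frechet_derivative[OF smooth_fun_chartD[OF U(3) c(1)], of b]])
        (auto simp: coord_field_def)
    then show "smooth_near \<A> x (\<lambda>z. coord_field \<A> D \<phi> b z f)"
      using U x by (intro smooth_fun_near[OF o]) auto
  qed
  then show ?thesis
    using c open_chart_domain[OF M c(1)] section_along_iff[OF M smooth_map_id[OF M]]
    unfolding section_near_def by blast
qed

lemma section_near_expansion:
  fixes \<A> :: "('a::{t2_space, second_countable_topology}, 'e::euclidean_space) atlas"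
  assumes MB: "smooth_manifold \<B>" and MA: "smooth_manifold \<A>" and \<iota>: "smooth_map \<B> \<A> \<iota>"
    and c: "(D, \<phi>) \<in> \<A>" "\<iota> y \<in> D" and V: "section_near \<B> \<A> \<iota> y V"
  shows "\<forall>\<^sub>F z in nhds y. V z = (\<Sum>b\<in>Basis. V z (\<lambda>x. \<phi> x \<bullet> b) *\<^sub>R coord_field \<A> D \<phi> b (\<iota> z))"
    and "smooth_near \<B> y (\<lambda>z. V z (\<lambda>x. \<phi> x \<bullet> b))"
proof -
  have "\<forall>\<^sub>F z in nhds y. \<iota> z \<in> D"
    using eventually_nhds_in_open[OF open_vimage_smooth_map[OF \<iota> open_chart_domain[OF MA c(1)]], of y] c(2)
    by simp
  then show "\<forall>\<^sub>F z in nhds y. V z = (\<Sum>b\<in>Basis. V z (\<lambda>x. \<phi> x \<bullet> b) *\<^sub>R coord_field \<A> D \<phi> b (\<iota> z))"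
    using V unfolding section_near_iff[OF MB \<iota>]
    by eventually_elim (auto simp: section_at_def intro: tangent_expansion[OF MA c(1)])
  show "smooth_near \<B> y (\<lambda>z. V z (\<lambda>x. \<phi> x \<bullet> b))"
    using section_near_at[OF MB \<iota> V]
      smooth_fun_near[OF open_chart_domain[OF MA c(1)] c(2) smooth_fun_coord[OF MA c(1)]]
    by (simp add: section_at_def)
qed

text \<open>A property of germs of sections of \<open>\<iota>\<^sup>*TM\<close> which holds for restrictions of vector fields on
  \<open>M\<close>, and is closed under sums and products with functions, holds for all sections.\<close>

lemma section_near_induct [consumes 4, case_names restrict add scale germ]:
  fixes \<A> :: "('a::{t2_space, second_countable_topology}, 'e::euclidean_space) atlas"
  assumes M: "smooth_manifold \<B>" "smooth_manifold \<A>" "smooth_map \<B> \<A> \<iota>"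
    and V: "section_near \<B> \<A> \<iota> y V"
    and restrict: "\<And>Y. section_near \<A> \<A> id (\<iota> y) Y \<Longrightarrow> P (Y \<circ> \<iota>)"
    and add: "\<And>V V'. section_near \<B> \<A> \<iota> y V \<Longrightarrow> section_near \<B> \<A> \<iota> y V' \<Longrightarrow> P V \<Longrightarrow> P V' \<Longrightarrow>
      P (\<lambda>z. V z + V' z)"
    and scale: "\<And>f V. smooth_near \<B> y f \<Longrightarrow> section_near \<B> \<A> \<iota> y V \<Longrightarrow> P V \<Longrightarrow> P (\<lambda>z. f z *\<^sub>R V z)"
    and germ: "\<And>V V'. section_near \<B> \<A> \<iota> y V \<Longrightarrow> P V \<Longrightarrow> \<forall>\<^sub>F z in nhds y. V z = V' z \<Longrightarrow> P V'"
  shows "P V"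
proof -
  obtain D \<phi> where c: "(D, \<phi>) \<in> \<A>" "\<iota> y \<in> D"
    using chart_at[OF M(2)] by blast
  define E where "E b = coord_field \<A> D \<phi> b \<circ> \<iota>" for b
  have E: "section_near \<B> \<A> \<iota> y (E b)" "P (E b)" for b
    unfolding E_def
    using section_near_coord_field[OF M(2) c] by (auto intro: restrict section_near_comp[OF M])
  define T where "T b z = V z (\<lambda>x. \<phi> x \<bullet> b) *\<^sub>R E b z" for b z
  have T: "section_near \<B> \<A> \<iota> y (T b)" "P (T b)" for b
    unfolding T_def
    using section_near_expansion(2)[OF M c V] E by (auto intro: scale section_near_scaleR[OF M(1,3)])
  have P0: "P (\<lambda>z. 0)"
    using scale[OF smooth_near_const[of _ _ 0] E] by (simp only: scaleR_zero_left)
  have "P (\<lambda>z. \<Sum>b\<in>I. T b z)" if "finite I" for I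
    using that
  proof (induction I)
    case empty
    show ?case using P0 by (simp only: sum.empty)
  next
    case (insert b I)
    show ?case
      using add[OF T(1) section_near_sum[OF M(1,3) T(1)] T(2) insert.IH] insert.hyps
      by (simp only: sum.insert not_False_eq_True)
  qed
  from this[OF finite_Basis] have "P (\<lambda>z. \<Sum>b\<in>Basis. T b z)" .
  moreover have "\<forall>\<^sub>F z in nhds y. (\<Sum>b\<in>Basis. T b z) = V z"
    using section_near_expansion(1)[OF M c V] by eventually_elim (simp add: T_def E_def)
  ultimately show ?thesis by (rule germ[OF section_near_sum[OF M(1,3) T(1)]])
qed

text \<open>In the Leibniz rule for \<open>lie_bracket\<close>, the products of first derivatives cancel.\<close>

lemma lie_bracket_tangent:
  fixes \<A> :: "('a::{t2_space, second_countable_topology}, 'e::euclidean_space) atlas"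
  assumes M: "smooth_manifold \<A>" and X: "section_near \<A> \<A> id x X" and Y: "section_near \<A> \<A> id x Y"
  shows "lie_bracket \<A> X Y x \<in> tangent_space \<A> x"
proof -
  have T: "\<forall>\<^sub>F z in nhds x. Z z \<in> tangent_space \<A> z" and T0: "Z x \<in> tangent_space \<A> x"
    and S: "\<And>f. smooth_near \<A> x f \<Longrightarrow> smooth_near \<A> x (\<lambda>z. Z z f)"
    if "section_near \<A> \<A> id x Z" for Z
    using that section_near_at[OF M smooth_map_id[OF M] that]
    unfolding section_near_iff[OF M smooth_map_id[OF M]]
    by (auto simp: section_at_def elim: eventually_mono)
  have add: "Z' x (\<lambda>z. Z z (\<lambda>z. f z + h z)) = Z' x (\<lambda>z. Z z f) + Z' x (\<lambda>z. Z z h)"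
    and scale: "Z' x (\<lambda>z. Z z (\<lambda>z. c * f z)) = c * Z' x (\<lambda>z. Z z f)"
    and mult: "Z' x (\<lambda>z. Z z (\<lambda>z. f z * h z)) = Z' x (\<lambda>z. Z z f) * h x + Z x f * Z' x h
      + (Z' x f * Z x h + f x * Z' x (\<lambda>z. Z z h))"
    if f: "smooth_near \<A> x f" and h: "smooth_near \<A> x h"
      and Z: "section_near \<A> \<A> id x Z" and Z': "section_near \<A> \<A> id x Z'" for f h c Z Z'
  proof -
    have "\<forall>\<^sub>F z in nhds x. Z z (\<lambda>z. f z + h z) = Z z f + Z z h"
      using T[OF Z] smooth_near_eventually[OF f] smooth_near_eventually[OF h]
      by eventually_elim (rule tangent_add)
    then have "Z' x (\<lambda>z. Z z (\<lambda>z. f z + h z)) = Z' x (\<lambda>z. Z z f + Z z h)"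
      by (intro tangent_cong[OF T0[OF Z']] S[OF Z] smooth_near_add[OF M] f h)
    then show "Z' x (\<lambda>z. Z z (\<lambda>z. f z + h z)) = Z' x (\<lambda>z. Z z f) + Z' x (\<lambda>z. Z z h)"
      by (simp add: tangent_add[OF T0[OF Z']] S[OF Z] f h)
    have "\<forall>\<^sub>F z in nhds x. Z z (\<lambda>z. c * f z) = c * Z z f"
      using T[OF Z] smooth_near_eventually[OF f] by eventually_elim (rule tangent_scale)
    then have "Z' x (\<lambda>z. Z z (\<lambda>z. c * f z)) = Z' x (\<lambda>z. c * Z z f)"
      by (intro tangent_cong[OF T0[OF Z']] S[OF Z] smooth_near_mult[OF M] smooth_near_const f)
    then show "Z' x (\<lambda>z. Z z (\<lambda>z. c * f z)) = c * Z' x (\<lambda>z. Z z f)"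
      by (simp add: tangent_scale[OF T0[OF Z']] S[OF Z] f)
    have "\<forall>\<^sub>F z in nhds x. Z z (\<lambda>z. f z * h z) = Z z f * h z + f z * Z z h"
      using T[OF Z] smooth_near_eventually[OF f] smooth_near_eventually[OF h]
      by eventually_elim (rule tangent_mult)
    then have "Z' x (\<lambda>z. Z z (\<lambda>z. f z * h z)) = Z' x (\<lambda>z. Z z f * h z + f z * Z z h)"
      by (intro tangent_cong[OF T0[OF Z']] S[OF Z] smooth_near_mult[OF M] f h)
    also have "\<dots> = Z' x (\<lambda>z. Z z f * h z) + Z' x (\<lambda>z. f z * Z z h)"
      by (intro tangent_add[OF T0[OF Z']] smooth_near_mult[OF M] S[OF Z] f h)
    finally show "Z' x (\<lambda>z. Z z (\<lambda>z. f z * h z)) = Z' x (\<lambda>z. Z z f) * h x + Z x f * Z' x h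
        + (Z' x f * Z x h + f x * Z' x (\<lambda>z. Z z h))"
      by (simp add: tangent_mult[OF T0[OF Z']] S[OF Z] f h)
  qed
  have cong: "Z' x (\<lambda>z. Z z f) = Z' x (\<lambda>z. Z z h)"
    if f: "smooth_near \<A> x f" and e: "\<forall>\<^sub>F z in nhds x. f z = h z"
      and Z: "section_near \<A> \<A> id x Z" and Z': "section_near \<A> \<A> id x Z'" for f h Z Z'
  proof -
    have "\<forall>\<^sub>F z in nhds x. Z z f = Z z h"
      using T[OF Z] smooth_near_eventually[OF f] eventually_eventually[THEN iffD2, OF e]
      by eventually_elim (rule tangent_cong)
    then show ?thesis by (rule tangent_cong[OF T0[OF Z'] S[OF Z f]])
  qed
  show ?thesis
  proof (rule tangent_spaceI)
    fix f h :: "'a \<Rightarrow> real" assume f: "smooth_near \<A> x f"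
    show "lie_bracket \<A> X Y x (\<lambda>z. c * f z) = c * lie_bracket \<A> X Y x f" for c
      using f smooth_near_mult[OF M smooth_near_const f] scale[OF f f X Y] scale[OF f f Y X]
      by (simp add: lie_bracket_def algebra_simps)
    show "lie_bracket \<A> X Y x f = lie_bracket \<A> X Y x h" if e: "\<forall>\<^sub>F z in nhds x. f z = h z"
      using f smooth_near_cong[OF M f e] cong[OF f e X Y] cong[OF f e Y X]
      by (simp add: lie_bracket_def)
    assume h: "smooth_near \<A> x h"
    show "lie_bracket \<A> X Y x (\<lambda>z. f z + h z) = lie_bracket \<A> X Y x f + lie_bracket \<A> X Y x h"
      using f h smooth_near_add[OF M f h] add[OF f h X Y] add[OF f h Y X]
      by (simp add: lie_bracket_def)
    show "lie_bracket \<A> X Y x (\<lambda>z. f z * h z) = lie_bracket \<A> X Y x f * h x + f x * lie_bracket \<A> X Y x h"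
      using f h smooth_near_mult[OF M f h] mult[OF f h X Y] mult[OF f h Y X]
      by (simp add: lie_bracket_def algebra_simps)
  qed (simp add: lie_bracket_def)
qed

lemma vector_field_through:
  fixes \<A> :: "('a::{t2_space, second_countable_topology}, 'e::euclidean_space) atlas"
  assumes MA: "smooth_manifold \<A>" and u: "u \<in> tangent_space \<A> x"
  obtains X where "section_near \<A> \<A> id x X" "X x = u"
proof -
  obtain C \<phi> where c: "(C, \<phi>) \<in> \<A>" "x \<in> C"
    using chart_at[OF MA] by blast
  have "section_near \<A> \<A> id x (\<lambda>z. \<Sum>b\<in>Basis. u (\<lambda>z. \<phi> z \<bullet> b) *\<^sub>R coord_field \<A> C \<phi> b z)"
    by (intro section_near_sum[OF MA smooth_map_id[OF MA]] section_near_scaleR[OF MA smooth_map_id[OF MA]]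
        smooth_near_const section_near_coord_field[OF MA c])
  then show ?thesis
    by (rule that) (rule tangent_expansion[OF MA c u, symmetric])
qed

text \<open>Local sections near a point are sections over a common neighbourhood.\<close>

lemma section_near_common:
  assumes M: "smooth_manifold \<C>" "smooth_map \<C> \<A> \<kappa>"
    and "section_near \<C> \<A> \<kappa> x X" "section_near \<C> \<A> \<kappa> x Y" "section_near \<C> \<A> \<kappa> x Z"
  obtains A where "open A" "x \<in> A" "section_along \<C> \<A> \<kappa> A X" "section_along \<C> \<A> \<kappa> A Y"
    "section_along \<C> \<A> \<kappa> A Z"
proof -
  have "\<forall>\<^sub>F z in nhds x. section_at \<C> \<A> \<kappa> z X \<and> section_at \<C> \<A> \<kappa> z Y \<and> section_at \<C> \<A> \<kappa> z Z"
    using assms(3-) unfolding section_near_iff[OF M] by eventually_elim simp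
  then obtain A where "open A" "x \<in> A"
    "\<And>z. z \<in> A \<Longrightarrow> section_at \<C> \<A> \<kappa> z X \<and> section_at \<C> \<A> \<kappa> z Y \<and> section_at \<C> \<A> \<kappa> z Z"
    unfolding eventually_nhds by blast
  then show ?thesis
    using that section_along_iff[OF M] by blast
qed

section \<open>The induced connection\<close>

text \<open>A smooth map \<open>\<iota>\<close>, not necessarily an immersion, into a semi-Riemannian manifold, with the
  connection \<open>D\<close> on \<open>\<iota>\<^sup>*TM\<close> induced by the Levi-Civita connection.\<close>

locale induced_levi_civita =
  fixes \<A> :: "('a::{t2_space, second_countable_topology}, 'e::euclidean_space) atlas"
    and g :: "'a \<Rightarrow> 'a tvec \<Rightarrow> 'a tvec \<Rightarrow> real"
    and nabla :: "'a \<Rightarrow> 'a tvec \<Rightarrow> ('a \<Rightarrow> 'a tvec) \<Rightarrow> 'a tvec"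
    and \<B> :: "('b::{t2_space, second_countable_topology}, 'd::euclidean_space) atlas"
    and \<iota> :: "'b \<Rightarrow> 'a"
    and D :: "'b \<Rightarrow> 'b tvec \<Rightarrow> ('b \<Rightarrow> 'a tvec) \<Rightarrow> 'a tvec"
  assumes MA: "smooth_manifold \<A>" and MB: "smooth_manifold \<B>" and \<iota>: "smooth_map \<B> \<A> \<iota>"
    and g: "semi_riemannian \<A> g" and nabla: "levi_civita \<A> g nabla"
    and D: "induced_connection \<B> \<A> \<iota> nabla D"
begin

abbreviation "push \<equiv> pushforward \<A> \<iota>"
abbreviation "TM x \<equiv> tangent_space \<A> x"
abbreviation "TB y \<equiv> tangent_space \<B> y"
abbreviation "snear \<equiv> section_near \<B> \<A> \<iota>"

lemmas TM_add = subspace_add[OF subspace_tangent_space]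
  and TM_scale = subspace_mul[OF subspace_tangent_space]
  and TM_zero = subspace_0[OF subspace_tangent_space]
  and TM_sum = subspace_sum[OF subspace_tangent_space]

lemma g_sym: "u \<in> TM x \<Longrightarrow> v \<in> TM x \<Longrightarrow> g x u v = g x v u"
  using g[unfolded semi_riemannian_def, THEN conjunct1] by simp

lemma g_lin: "u \<in> TM x \<Longrightarrow> v \<in> TM x \<Longrightarrow> w \<in> TM x \<Longrightarrow> g x (c *\<^sub>R u + v) w = c * g x u w + g x v w"
  using g[unfolded semi_riemannian_def, THEN conjunct2, THEN conjunct1] by simp

lemma g_nondegenerate: "u \<in> TM x \<Longrightarrow> (\<And>v. v \<in> TM x \<Longrightarrow> g x u v = 0) \<Longrightarrow> u = 0"
  using g[unfolded semi_riemannian_def, THEN conjunct2, THEN conjunct2, THEN conjunct1] by simp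

lemma g_add_left: "u \<in> TM x \<Longrightarrow> v \<in> TM x \<Longrightarrow> w \<in> TM x \<Longrightarrow> g x (u + v) w = g x u w + g x v w"
  using g_lin[of u x v w 1] by simp

lemma g_zero_left: "w \<in> TM x \<Longrightarrow> g x 0 w = 0"
  using g_add_left[OF TM_zero TM_zero, where w = w] by simp

lemma g_scale_left: "u \<in> TM x \<Longrightarrow> w \<in> TM x \<Longrightarrow> g x (c *\<^sub>R u) w = c * g x u w"
  using g_lin[OF _ TM_zero, of u x w c] by (simp add: g_zero_left)

lemma g_add_right: "u \<in> TM x \<Longrightarrow> v \<in> TM x \<Longrightarrow> w \<in> TM x \<Longrightarrow> g x w (u + v) = g x w u + g x w v"
  using g_add_left[of u x v w] by (simp add: g_sym TM_add)

lemma g_scale_right: "u \<in> TM x \<Longrightarrow> w \<in> TM x \<Longrightarrow> g x w (c *\<^sub>R u) = c * g x w u"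
  using g_scale_left[of u x w c] by (simp add: g_sym TM_scale)

lemma g_zero_right: "w \<in> TM x \<Longrightarrow> g x w 0 = 0"
  using g_zero_left[of w x] by (simp add: g_sym TM_zero)

lemma g_sum_left:
  "(\<And>i. i \<in> I \<Longrightarrow> u i \<in> TM x) \<Longrightarrow> w \<in> TM x \<Longrightarrow> g x (\<Sum>i\<in>I. u i) w = (\<Sum>i\<in>I. g x (u i) w)"
proof (induction I rule: infinite_finite_induct)
  case (insert i I)
  then have "g x (u i + (\<Sum>i\<in>I. u i)) w = g x (u i) w + (\<Sum>i\<in>I. g x (u i) w)"
    by (subst g_add_left) (auto intro: TM_sum)
  with insert.hyps show ?case by (simp only: sum.insert not_False_eq_True)
qed (simp_all add: g_zero_left)

lemma conn: "connection_along \<B> \<A> \<iota> D"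
  using D by (simp add: induced_connection_def)

lemma D_tangent: "w \<in> TB y \<Longrightarrow> snear y V \<Longrightarrow> D y w V \<in> TM (\<iota> y)"
  using conn[unfolded connection_along_def, THEN conjunct1] by simp

lemma D_add: "w \<in> TB y \<Longrightarrow> snear y V \<Longrightarrow> snear y V' \<Longrightarrow> D y w (\<lambda>z. V z + V' z) = D y w V + D y w V'"
  using conn[unfolded connection_along_def, THEN conjunct2, THEN conjunct2, THEN conjunct1] by simp

lemma D_scale: "w \<in> TB y \<Longrightarrow> smooth_near \<B> y f \<Longrightarrow> snear y V \<Longrightarrow>
    D y w (\<lambda>z. f z *\<^sub>R V z) = w f *\<^sub>R V y + f y *\<^sub>R D y w V"
  using conn[unfolded connection_along_def, THEN conjunct2, THEN conjunct2, THEN conjunct2, THEN conjunct1]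
  by simp

lemma D_comp: "w \<in> TB y \<Longrightarrow> section_near \<A> \<A> id (\<iota> y) Y \<Longrightarrow> D y w (Y \<circ> \<iota>) = nabla (\<iota> y) (push y w) Y"
  using D[unfolded induced_connection_def, THEN conjunct2] by simp

lemma snear_tangent:
  assumes "snear y V"
  shows "\<forall>\<^sub>F z in nhds y. V z \<in> TM (\<iota> z)" "V y \<in> TM (\<iota> y)"
  using assms section_near_at[OF MB \<iota> assms] unfolding section_near_iff[OF MB \<iota>]
  by (auto simp: section_at_def elim: eventually_mono)

text \<open>The Leibniz rule for the indicator function of a neighbourhood shows that \<open>D\<close> is local.\<close>

lemma D_germ:
  assumes w: "w \<in> TB y" and V: "snear y V" and e: "\<forall>\<^sub>F z in nhds y. V z = V' z"
  shows "D y w V = D y w V'"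
proof -
  obtain A where A: "open A" "y \<in> A" "\<And>z. z \<in> A \<Longrightarrow> V z = V' z"
    using e unfolding eventually_nhds by blast
  define f :: "'b \<Rightarrow> real" where "f = indicator A"
  have f1: "\<forall>\<^sub>F z in nhds y. 1 = f z"
    unfolding eventually_nhds using A by (intro exI[of _ A]) (auto simp: f_def)
  have f: "smooth_near \<B> y f"
    by (rule smooth_near_cong[OF MB smooth_near_const f1])
  have "w f = 0"
    using tangent_cong[OF w smooth_near_const f1] tangent_const[OF w] by simp
  then have *: "D y w (\<lambda>z. f z *\<^sub>R X z) = D y w X" if "snear y X" for X
    using D_scale[OF w f that] A by (simp add: f_def)
  have "(\<lambda>z. f z *\<^sub>R V z) = (\<lambda>z. f z *\<^sub>R V' z)"
  proof
    show "f z *\<^sub>R V z = f z *\<^sub>R V' z" for z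
      using A(3) by (cases "z \<in> A") (simp_all add: f_def)
  qed
  then show ?thesis
    using *[OF V] *[OF section_near_cong[OF MB \<iota> V e]] by simp
qed

lemma D_zero: "w \<in> TB y \<Longrightarrow> D y w (\<lambda>z. 0) = 0"
  using D_scale[OF _ smooth_near_const[of _ _ 0] section_near_zero[OF MB \<iota>], of w y]
  by (simp only: scaleR_zero_left scaleR_zero_right add_0)

lemma D_sum:
  assumes w: "w \<in> TB y" and "finite I" and V: "\<And>i. i \<in> I \<Longrightarrow> snear y (V i)"
  shows "D y w (\<lambda>z. \<Sum>i\<in>I. V i z) = (\<Sum>i\<in>I. D y w (V i))"
  using assms(2,3)
proof (induction I)
  case empty
  show ?case by (simp only: sum.empty D_zero[OF w])
next
  case (insert i I)
  then have "D y w (\<lambda>z. V i z + (\<Sum>i\<in>I. V i z)) = D y w (V i) + (\<Sum>i\<in>I. D y w (V i))"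
    by (subst D_add[OF w _ section_near_sum[OF MB \<iota>]]) auto
  with insert.hyps show ?case by (simp only: sum.insert not_False_eq_True)
qed

text \<open>\<open>D\<close> is a metric connection.  Both the smoothness of \<open>g(V, V')\<close> and the product rule are proved
  first for restrictions of vector fields on \<open>M\<close>, and then for all sections by
  \<open>section_near_induct\<close> in each argument.\<close>

lemma
  assumes V: "snear y V" and V': "snear y V'"
  shows metric_smooth: "smooth_near \<B> y (\<lambda>z. g (\<iota> z) (V z) (V' z))"
    and metric_compatible: "w \<in> TB y \<Longrightarrow>
      w (\<lambda>z. g (\<iota> z) (V z) (V' z)) = g (\<iota> y) (D y w V) (V' y) + g (\<iota> y) (V y) (D y w V')"
proof -
  define R where "R V V' \<longleftrightarrow> smooth_near \<B> y (\<lambda>z. g (\<iota> z) (V z) (V' z)) \<and>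
    (\<forall>w\<in>TB y. w (\<lambda>z. g (\<iota> z) (V z) (V' z)) = g (\<iota> y) (D y w V) (V' y) + g (\<iota> y) (V y) (D y w V'))" for V V'
  have R_I: "R V V'" if "smooth_near \<B> y (\<lambda>z. g (\<iota> z) (V z) (V' z))"
    "\<And>w. w \<in> TB y \<Longrightarrow> w (\<lambda>z. g (\<iota> z) (V z) (V' z)) = g (\<iota> y) (D y w V) (V' y) + g (\<iota> y) (V y) (D y w V')"
    for V V' using that by (simp add: R_def)
  have R_s: "smooth_near \<B> y (\<lambda>z. g (\<iota> z) (V z) (V' z))"
    and R_D: "w \<in> TB y \<Longrightarrow>
      w (\<lambda>z. g (\<iota> z) (V z) (V' z)) = g (\<iota> y) (D y w V) (V' y) + g (\<iota> y) (V y) (D y w V')"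
    if "R V V'" for V V' w
    using that unfolding R_def by blast+
  have R_germ: "R V2 V'" if "R V V'" "snear y V" "snear y V'" "\<forall>\<^sub>F z in nhds y. V z = V2 z" for V V2 V'
  proof -
    have e: "\<forall>\<^sub>F z in nhds y. g (\<iota> z) (V z) (V' z) = g (\<iota> z) (V2 z) (V' z)"
      using that(4) by eventually_elim simp
    have "V y = V2 y" using eventually_nhds_x_imp_x[OF that(4)] .
    show ?thesis
    proof (rule R_I)
      show "smooth_near \<B> y (\<lambda>z. g (\<iota> z) (V2 z) (V' z))"
        by (rule smooth_near_cong[OF MB R_s[OF that(1)] e])
      fix w assume w: "w \<in> TB y"
      have "w (\<lambda>z. g (\<iota> z) (V2 z) (V' z)) = w (\<lambda>z. g (\<iota> z) (V z) (V' z))"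
        using tangent_cong[OF w R_s[OF that(1)] e] by simp
      then show "w (\<lambda>z. g (\<iota> z) (V2 z) (V' z)) = g (\<iota> y) (D y w V2) (V' y) + g (\<iota> y) (V2 y) (D y w V')"
        using R_D[OF that(1) w] D_germ[OF w that(2,4)] \<open>V y = V2 y\<close> by simp
    qed
  qed
  have R_sym: "R V' V" if "R V V'" "snear y V" "snear y V'" for V V'
  proof -
    have e: "\<forall>\<^sub>F z in nhds y. g (\<iota> z) (V z) (V' z) = g (\<iota> z) (V' z) (V z)"
      using snear_tangent(1)[OF that(2)] snear_tangent(1)[OF that(3)] by eventually_elim (rule g_sym)
    have "w (\<lambda>z. g (\<iota> z) (V' z) (V z)) = g (\<iota> y) (D y w V') (V y) + g (\<iota> y) (V' y) (D y w V)"
      if w: "w \<in> TB y" for w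
    proof -
      have "w (\<lambda>z. g (\<iota> z) (V' z) (V z)) = w (\<lambda>z. g (\<iota> z) (V z) (V' z))"
        using tangent_cong[OF w R_s[OF \<open>R V V'\<close>] e] by simp
      also have "\<dots> = g (\<iota> y) (D y w V) (V' y) + g (\<iota> y) (V y) (D y w V')"
        by (rule R_D[OF \<open>R V V'\<close> w])
      finally show ?thesis
        using g_sym[OF snear_tangent(2)[OF \<open>snear y V\<close>] D_tangent[OF w \<open>snear y V'\<close>]]
          g_sym[OF snear_tangent(2)[OF \<open>snear y V'\<close>] D_tangent[OF w \<open>snear y V\<close>]] by simp
    qed
    moreover have "smooth_near \<B> y (\<lambda>z. g (\<iota> z) (V' z) (V z))"
      by (rule smooth_near_cong[OF MB R_s[OF that(1)] e])
    ultimately show ?thesis by (intro R_I)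
  qed
  have R_add: "R (\<lambda>z. V z + V2 z) V'"
    if R: "R V V'" "R V2 V'" and V: "snear y V" and V2: "snear y V2" and V': "snear y V'" for V V2 V'
  proof -
    note t = snear_tangent[OF V] snear_tangent[OF V2] snear_tangent[OF V']
    have e: "\<forall>\<^sub>F z in nhds y. g (\<iota> z) (V z) (V' z) + g (\<iota> z) (V2 z) (V' z) = g (\<iota> z) (V z + V2 z) (V' z)"
      using t(1,3,5) by eventually_elim (simp only: g_add_left)
    have s: "smooth_near \<B> y (\<lambda>z. g (\<iota> z) (V z) (V' z) + g (\<iota> z) (V2 z) (V' z))"
      by (rule smooth_near_add[OF MB R_s[OF R(1)] R_s[OF R(2)]])
    have "w (\<lambda>z. g (\<iota> z) (V z + V2 z) (V' z)) =
        g (\<iota> y) (D y w (\<lambda>z. V z + V2 z)) (V' y) + g (\<iota> y) (V y + V2 y) (D y w V')" if w: "w \<in> TB y" for w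
    proof -
      have "w (\<lambda>z. g (\<iota> z) (V z + V2 z) (V' z)) =
          w (\<lambda>z. g (\<iota> z) (V z) (V' z)) + w (\<lambda>z. g (\<iota> z) (V2 z) (V' z))"
        using tangent_cong[OF w s e] tangent_add[OF w R_s[OF R(1)] R_s[OF R(2)]] by simp
      also have "\<dots> = g (\<iota> y) (D y w (\<lambda>z. V z + V2 z)) (V' y) + g (\<iota> y) (V y + V2 y) (D y w V')"
        using R_D[OF R(1) w] R_D[OF R(2) w] D_tangent[OF w V] D_tangent[OF w V2] D_tangent[OF w V'] t(2,4,6)
        by (simp only: D_add[OF w V V2] g_add_left)
      finally show ?thesis .
    qed
    then show ?thesis
      using smooth_near_cong[OF MB s e] by (intro R_I)
  qed
  have R_scale: "R (\<lambda>z. f z *\<^sub>R V z) V'"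
    if R: "R V V'" and f: "smooth_near \<B> y f" and V: "snear y V" and V': "snear y V'" for V V' f
  proof -
    note t = snear_tangent[OF V] snear_tangent[OF V']
    have e: "\<forall>\<^sub>F z in nhds y. f z * g (\<iota> z) (V z) (V' z) = g (\<iota> z) (f z *\<^sub>R V z) (V' z)"
      using t(1,3) by eventually_elim (simp only: g_scale_left)
    have s: "smooth_near \<B> y (\<lambda>z. f z * g (\<iota> z) (V z) (V' z))"
      by (rule smooth_near_mult[OF MB f R_s[OF R]])
    have "w (\<lambda>z. g (\<iota> z) (f z *\<^sub>R V z) (V' z)) =
        g (\<iota> y) (D y w (\<lambda>z. f z *\<^sub>R V z)) (V' y) + g (\<iota> y) (f y *\<^sub>R V y) (D y w V')" if w: "w \<in> TB y" for w
    proof -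
      have "w (\<lambda>z. g (\<iota> z) (f z *\<^sub>R V z) (V' z)) =
          w f * g (\<iota> y) (V y) (V' y) + f y * w (\<lambda>z. g (\<iota> z) (V z) (V' z))"
        using tangent_cong[OF w s e] tangent_mult[OF w f R_s[OF R]] by simp
      also have "\<dots> = g (\<iota> y) (D y w (\<lambda>z. f z *\<^sub>R V z)) (V' y) + g (\<iota> y) (f y *\<^sub>R V y) (D y w V')"
        using R_D[OF R w] D_tangent[OF w V] D_tangent[OF w V'] t(2,4)
        by (simp only: D_scale[OF w f V] g_add_left g_scale_left TM_scale) (simp add: algebra_simps)
      finally show ?thesis .
    qed
    then show ?thesis
      using smooth_near_cong[OF MB s e] by (intro R_I)
  qed
  have R_restrict: "R (Y \<circ> \<iota>) (Y' \<circ> \<iota>)"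
    if Y: "section_near \<A> \<A> id (\<iota> y) Y" and Y': "section_near \<A> \<A> id (\<iota> y) Y'" for Y Y'
  proof -
    have smooth: "smooth_near \<A> (\<iota> y) (\<lambda>x. g x (Y x) (Y' x))"
      and LC: "u (\<lambda>x. g x (Y x) (Y' x)) =
        g (\<iota> y) (nabla (\<iota> y) u Y) (Y' (\<iota> y)) + g (\<iota> y) (Y (\<iota> y)) (nabla (\<iota> y) u Y')"
      if u: "u \<in> TM (\<iota> y)" for u
    proof -
      obtain X where X: "section_near \<A> \<A> id (\<iota> y) X" "X (\<iota> y) = u"
        using vector_field_through[OF MA u] by blast
      obtain A where A: "open A" "\<iota> y \<in> A" "vector_field \<A> A X" "vector_field \<A> A Y" "vector_field \<A> A Y'"
        using section_near_common[OF MA smooth_map_id[OF MA] X(1) Y Y'] by blast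
      have "smooth_fun \<A> A (\<lambda>x. g x (Y x) (Y' x))"
        using g A unfolding semi_riemannian_def by blast
      then show "smooth_near \<A> (\<iota> y) (\<lambda>x. g x (Y x) (Y' x))"
        by (rule smooth_fun_near[OF A(1,2)])
      have "X (\<iota> y) (\<lambda>x. g x (Y x) (Y' x)) =
        g (\<iota> y) (nabla (\<iota> y) (X (\<iota> y)) Y) (Y' (\<iota> y)) + g (\<iota> y) (Y (\<iota> y)) (nabla (\<iota> y) (X (\<iota> y)) Y')"
        using nabla A unfolding levi_civita_def by blast
      then show "u (\<lambda>x. g x (Y x) (Y' x)) =
        g (\<iota> y) (nabla (\<iota> y) u Y) (Y' (\<iota> y)) + g (\<iota> y) (Y (\<iota> y)) (nabla (\<iota> y) u Y')"
        by (simp add: X(2))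
    qed
    have s: "smooth_near \<A> (\<iota> y) (\<lambda>x. g x (Y x) (Y' x))"
      using smooth[OF TM_zero] .
    have "w (\<lambda>z. g (\<iota> z) (Y (\<iota> z)) (Y' (\<iota> z))) = push y w (\<lambda>x. g x (Y x) (Y' x))" for w
      using s by (simp add: pushforward_def o_def)
    then show ?thesis
      using smooth_near_compose_map[OF MB MA \<iota> s] LC[OF pushforward_tangent[OF MB MA \<iota>]]
        D_comp[OF _ Y] D_comp[OF _ Y']
      by (intro R_I) (simp_all add: o_def)
  qed
  have R_half: "R V V'"
    if V: "snear y V" and V': "snear y V'"
      and r: "\<And>Y. section_near \<A> \<A> id (\<iota> y) Y \<Longrightarrow> R (Y \<circ> \<iota>) V'" for V V'
    using MB MA \<iota> V
  proof (induction rule: section_near_induct)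
    case (restrict Y)
    then show ?case by (rule r)
  next
    case (add V V2)
    then show ?case using R_add V' by blast
  next
    case (scale f V)
    then show ?case using R_scale V' by blast
  next
    case (germ V V2)
    then show ?case using R_germ V' by blast
  qed
  have "R V V'"
  proof (rule R_half[OF V V'])
    fix Y assume Y: "section_near \<A> \<A> id (\<iota> y) Y"
    have Y\<iota>: "snear y (Y \<circ> \<iota>)" by (rule section_near_comp[OF MB MA \<iota> Y])
    show "R (Y \<circ> \<iota>) V'"
      using R_half[OF V' Y\<iota> R_restrict[OF _ Y]] R_sym V' Y\<iota> by blast
  qed
  then show "smooth_near \<B> y (\<lambda>z. g (\<iota> z) (V z) (V' z))"
    and "w \<in> TB y \<Longrightarrow> w (\<lambda>z. g (\<iota> z) (V z) (V' z)) =
      g (\<iota> y) (D y w V) (V' y) + g (\<iota> y) (V y) (D y w V')"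
    using R_s R_D by blast+
qed

text \<open>A tensor field maps sections along \<open>\<iota>\<close> to sections along \<open>\<iota>\<close>, and commutes with \<open>D\<close> if it is
  parallel.\<close>

lemma
  assumes J: "tensor_field_11 \<A> J" and V: "snear y V"
  shows section_near_tensor: "snear y (\<lambda>z. J (\<iota> z) (V z))"
    and D_parallel_tensor: "parallel_11 \<A> nabla J \<Longrightarrow> w \<in> TB y \<Longrightarrow>
      D y w (\<lambda>z. J (\<iota> z) (V z)) = J (\<iota> y) (D y w V)"
proof -
  have J_lin: "J x (c *\<^sub>R u + v) = c *\<^sub>R J x u + J x v" if "u \<in> TM x" "v \<in> TM x" for x u v c
    using J that unfolding tensor_field_11_def by blast
  have J_add: "J x (u + v) = J x u + J x v" if "u \<in> TM x" "v \<in> TM x" for x u v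
    using J_lin[OF that, of 1] by simp
  have J_zero: "J x 0 = 0" for x
    using J_add[OF TM_zero TM_zero] by simp
  have J_scale: "J x (c *\<^sub>R u) = c *\<^sub>R J x u" if "u \<in> TM x" for x u c
    using J_lin[OF that TM_zero, of c] by (simp add: J_zero)
  define R where "R V \<longleftrightarrow> snear y (\<lambda>z. J (\<iota> z) (V z)) \<and> (parallel_11 \<A> nabla J \<longrightarrow>
    (\<forall>w\<in>TB y. D y w (\<lambda>z. J (\<iota> z) (V z)) = J (\<iota> y) (D y w V)))" for V
  have "R V"
    using MB MA \<iota> V
  proof (induction rule: section_near_induct)
    case (restrict Y)
    then obtain A where A: "open A" "\<iota> y \<in> A" "vector_field \<A> A Y"
      unfolding section_near_def by blast
    then have "vector_field \<A> A (\<lambda>x. J x (Y x))"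
      using J unfolding tensor_field_11_def by blast
    then have JY: "section_near \<A> \<A> id (\<iota> y) (\<lambda>x. J x (Y x))"
      by (rule section_along_near[OF A(1,2)])
    have p: "push y w \<in> TM (\<iota> y)" if "w \<in> TB y" for w
      using pushforward_tangent[OF MB MA \<iota> that] .
    show ?case
      using section_near_comp[OF MB MA \<iota> JY] D_comp[OF _ JY] D_comp[OF _ restrict] p restrict
      by (auto simp: R_def o_def parallel_11_def)
  next
    case (add V V')
    note t = snear_tangent[OF add(1)] snear_tangent[OF add(2)]
    have e: "\<forall>\<^sub>F z in nhds y. J (\<iota> z) (V z) + J (\<iota> z) (V' z) = J (\<iota> z) (V z + V' z)"
      using t(1,3) by eventually_elim (simp only: J_add)
    have s: "snear y (\<lambda>z. J (\<iota> z) (V z) + J (\<iota> z) (V' z))"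
      using add(3,4) by (intro section_near_add[OF MB \<iota>]) (simp_all only: R_def)
    have "D y w (\<lambda>z. J (\<iota> z) (V z + V' z)) = J (\<iota> y) (D y w (\<lambda>z. V z + V' z))"
      if p: "parallel_11 \<A> nabla J" and w: "w \<in> TB y" for w
    proof -
      have "D y w (\<lambda>z. J (\<iota> z) (V z + V' z)) = D y w (\<lambda>z. J (\<iota> z) (V z) + J (\<iota> z) (V' z))"
        using D_germ[OF w s e] by (rule sym)
      also have "\<dots> = D y w (\<lambda>z. J (\<iota> z) (V z)) + D y w (\<lambda>z. J (\<iota> z) (V' z))"
        using add(3,4) by (intro D_add[OF w]) (simp_all only: R_def)
      also have "\<dots> = J (\<iota> y) (D y w (\<lambda>z. V z + V' z))"
        using add(3,4) p w
        by (simp only: R_def D_add[OF w add(1,2)] J_add[OF D_tangent[OF w add(1)] D_tangent[OF w add(2)]])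
      finally show ?thesis .
    qed
    then show ?case
      using section_near_cong[OF MB \<iota> s e] unfolding R_def by blast
  next
    case (scale f V)
    note t = snear_tangent[OF scale(2)]
    have e: "\<forall>\<^sub>F z in nhds y. f z *\<^sub>R J (\<iota> z) (V z) = J (\<iota> z) (f z *\<^sub>R V z)"
      using t(1) by eventually_elim (simp only: J_scale)
    have s: "snear y (\<lambda>z. f z *\<^sub>R J (\<iota> z) (V z))"
      using scale(3) by (intro section_near_scaleR[OF MB \<iota> scale(1)]) (simp only: R_def)
    have "D y w (\<lambda>z. J (\<iota> z) (f z *\<^sub>R V z)) = J (\<iota> y) (D y w (\<lambda>z. f z *\<^sub>R V z))"
      if p: "parallel_11 \<A> nabla J" and w: "w \<in> TB y" for w
    proof -
      have "D y w (\<lambda>z. J (\<iota> z) (f z *\<^sub>R V z)) = D y w (\<lambda>z. f z *\<^sub>R J (\<iota> z) (V z))"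
        using D_germ[OF w s e] by (rule sym)
      also have "\<dots> = w f *\<^sub>R J (\<iota> y) (V y) + f y *\<^sub>R D y w (\<lambda>z. J (\<iota> z) (V z))"
        using scale(3) by (intro D_scale[OF w scale(1)]) (simp only: R_def)
      also have "\<dots> = J (\<iota> y) (D y w (\<lambda>z. f z *\<^sub>R V z))"
        using scale(3) p w D_tangent[OF w scale(2)] t(2)
        by (simp only: R_def D_scale[OF w scale(1,2)] J_lin J_scale TM_scale)
      finally show ?thesis .
    qed
    then show ?case
      using section_near_cong[OF MB \<iota> s e] unfolding R_def by blast
  next
    case (germ V V')
    have e: "\<forall>\<^sub>F z in nhds y. J (\<iota> z) (V z) = J (\<iota> z) (V' z)"
      using germ.hyps(2) by eventually_elim simp
    have s: "snear y (\<lambda>z. J (\<iota> z) (V z))"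
      using germ.IH by (simp only: R_def)
    show ?case
      using germ.IH section_near_cong[OF MB \<iota> s e] D_germ[OF _ s e] D_germ[OF _ germ.hyps]
      by (simp add: R_def)
  qed
  then show "snear y (\<lambda>z. J (\<iota> z) (V z))"
    and "parallel_11 \<A> nabla J \<Longrightarrow> w \<in> TB y \<Longrightarrow>
      D y w (\<lambda>z. J (\<iota> z) (V z)) = J (\<iota> y) (D y w V)"
    unfolding R_def by blast+
qed

text \<open>Derivative of a section in terms of its components \<open>V\<^sup>b\<close> in a chart.  The last summand is the
  derivative of the vector field with constant components \<open>V\<^sup>b(y)\<close>.\<close>

lemma D_expansion:
  assumes c: "(C, \<phi>) \<in> \<A>" "\<iota> y \<in> C" and w: "w \<in> TB y" and V: "snear y V"
  shows "D y w V = (\<Sum>b\<in>Basis. w (\<lambda>z. V z (\<lambda>x. \<phi> x \<bullet> b)) *\<^sub>R coord_field \<A> C \<phi> b (\<iota> y)) +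
    nabla (\<iota> y) (push y w) (\<lambda>x. \<Sum>b\<in>Basis. V y (\<lambda>x. \<phi> x \<bullet> b) *\<^sub>R coord_field \<A> C \<phi> b x)"
proof -
  let ?E = "\<lambda>b z. coord_field \<A> C \<phi> b (\<iota> z)" and ?V = "\<lambda>b z. V z (\<lambda>x. \<phi> x \<bullet> b)"
  note ex = section_near_expansion[OF MB MA \<iota> c V]
  have E: "snear y (?E b)" for b
    using section_near_comp[OF MB MA \<iota> section_near_coord_field[OF MA c]] by (simp add: o_def)
  have VE: "snear y (\<lambda>z. ?V b z *\<^sub>R ?E b z)" for b
    by (rule section_near_scaleR[OF MB \<iota> ex(2) E])
  have const: "section_near \<A> \<A> id (\<iota> y) (\<lambda>x. \<Sum>b\<in>Basis. ?V b y *\<^sub>R coord_field \<A> C \<phi> b x)"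
    by (intro section_near_sum[OF MA smooth_map_id[OF MA]] section_near_scaleR[OF MA smooth_map_id[OF MA]]
        smooth_near_const section_near_coord_field[OF MA c])
  have "nabla (\<iota> y) (push y w) (\<lambda>x. \<Sum>b\<in>Basis. ?V b y *\<^sub>R coord_field \<A> C \<phi> b x) =
      D y w (\<lambda>z. \<Sum>b\<in>Basis. ?V b y *\<^sub>R ?E b z)"
    using D_comp[OF w const] by (simp add: o_def)
  also have "\<dots> = (\<Sum>b\<in>Basis. D y w (\<lambda>z. ?V b y *\<^sub>R ?E b z))"
    by (rule D_sum[OF w finite_Basis section_near_scaleR[OF MB \<iota> smooth_near_const E]])
  also have "\<dots> = (\<Sum>b\<in>Basis. ?V b y *\<^sub>R D y w (?E b))"
    by (simp only: D_scale[OF w smooth_near_const E] tangent_const[OF w] scaleR_zero_left add_0)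
  finally have n: "nabla (\<iota> y) (push y w) (\<lambda>x. \<Sum>b\<in>Basis. ?V b y *\<^sub>R coord_field \<A> C \<phi> b x) =
      (\<Sum>b\<in>Basis. ?V b y *\<^sub>R D y w (?E b))" .
  have "D y w V = D y w (\<lambda>z. \<Sum>b\<in>Basis. ?V b z *\<^sub>R ?E b z)"
    by (rule D_germ[OF w V ex(1)])
  also have "\<dots> = (\<Sum>b\<in>Basis. D y w (\<lambda>z. ?V b z *\<^sub>R ?E b z))"
    by (rule D_sum[OF w finite_Basis VE])
  also have "\<dots> = (\<Sum>b\<in>Basis. w (?V b) *\<^sub>R ?E b y + ?V b y *\<^sub>R D y w (?E b))"
    by (simp only: D_scale[OF w ex(2) E])
  finally show ?thesis
    by (simp only: n sum.distrib)
qed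

text \<open>The difference of the two derivatives splits into its second-order part, which gives the bracket,
  and \<open>nabla\<close> of fields with constant components.\<close>

lemma torsion_free:
  assumes W: "section_near \<B> \<B> id y W" and U: "section_near \<B> \<B> id y U"
  shows "D y (W y) (\<lambda>z. push z (U z)) - D y (U y) (\<lambda>z. push z (W z)) = push y (lie_bracket \<B> W U y)"
proof -
  obtain C \<phi> where c: "(C, \<phi>) \<in> \<A>" "\<iota> y \<in> C"
    using chart_at[OF MA] by blast
  have C: "open C" using open_chart_domain[OF MA c(1)] .
  let ?E = "coord_field \<A> C \<phi>"
  define bar where "bar X x = (\<Sum>b\<in>Basis. push y (X y) (\<lambda>x. \<phi> x \<bullet> b) *\<^sub>R ?E b x)" for X :: "'b \<Rightarrow> 'b tvec" and x
  have t: "X y \<in> TB y" if "section_near \<B> \<B> id y X" for X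
    using section_near_at[OF MB smooth_map_id[OF MB] that] by (simp add: section_at_def)
  have coord: "smooth_near \<A> x (\<lambda>x. \<phi> x \<bullet> b)" if "x \<in> C" for b x
    using smooth_fun_near[OF C that smooth_fun_coord[OF MA c(1)]] .
  have bar: "section_near \<A> \<A> id (\<iota> y) (bar X)" and bar_y: "bar X (\<iota> y) = push y (X y)"
    if "section_near \<B> \<B> id y X" for X
  proof -
    show "section_near \<A> \<A> id (\<iota> y) (bar X)"
      unfolding bar_def
      by (intro section_near_sum[OF MA smooth_map_id[OF MA]] section_near_scaleR[OF MA smooth_map_id[OF MA]]
          smooth_near_const section_near_coord_field[OF MA c])
    show "bar X (\<iota> y) = push y (X y)"
      unfolding bar_def
      by (rule tangent_expansion[OF MA c pushforward_tangent[OF MB MA \<iota> t[OF that]], symmetric])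
  qed
  have bar_coord: "bar X x (\<lambda>x. \<phi> x \<bullet> b) = push y (X y) (\<lambda>x. \<phi> x \<bullet> b)" if "x \<in> C" "b \<in> Basis" for X x b
    unfolding bar_def sum_fun_apply scaleR_fun_apply coord_field_coord[OF MA c(1) that(1)]
    using that(2) by (simp add: inner_Basis if_distrib cong: if_cong)
  \<comment> \<open>The fields \<open>bar W\<close> and \<open>bar U\<close> have constant coefficients, hence commute.\<close>
  have lie0: "lie_bracket \<A> (bar W) (bar U) (\<iota> y) = 0"
  proof -
    let ?l = "lie_bracket \<A> (bar W) (bar U) (\<iota> y)"
    have const: "bar X (\<iota> y) (\<lambda>x. bar X' x (\<lambda>x. \<phi> x \<bullet> b)) = 0"
      if "b \<in> Basis" and X: "section_near \<B> \<B> id y X" for b X X'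
    proof -
      have e: "\<forall>\<^sub>F x in nhds (\<iota> y). push y (X' y) (\<lambda>x. \<phi> x \<bullet> b) = bar X' x (\<lambda>x. \<phi> x \<bullet> b)"
        unfolding eventually_nhds using C c(2) bar_coord[OF _ that(1)] by metis
      have v: "bar X (\<iota> y) \<in> TM (\<iota> y)"
        using bar_y[OF X] pushforward_tangent[OF MB MA \<iota> t[OF X]] by simp
      show ?thesis
        using tangent_cong[OF v smooth_near_const e] tangent_const[OF v] by simp
    qed
    have "?l = (\<Sum>b\<in>Basis. ?l (\<lambda>x. \<phi> x \<bullet> b) *\<^sub>R ?E b (\<iota> y))"
      by (rule tangent_expansion[OF MA c lie_bracket_tangent[OF MA bar[OF W] bar[OF U]]])
    also have "\<dots> = (\<Sum>b\<in>(Basis :: 'e set). 0)"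
    proof (rule sum.cong[OF refl])
      fix b :: 'e assume b: "b \<in> Basis"
      have "?l (\<lambda>x. \<phi> x \<bullet> b) = 0"
        using const[OF b W] const[OF b U] coord[OF c(2)] by (simp add: lie_bracket_def)
      then show "?l (\<lambda>x. \<phi> x \<bullet> b) *\<^sub>R ?E b (\<iota> y) = 0" by (simp only: scaleR_zero_left)
    qed
    finally show ?thesis by (simp only: sum.neutral_const)
  qed
  obtain A where A: "open A" "\<iota> y \<in> A" "vector_field \<A> A (bar W)" "vector_field \<A> A (bar U)"
    using section_near_common[OF MA smooth_map_id[OF MA] bar[OF W] bar[OF U] bar[OF U]] by blast
  have "nabla (\<iota> y) (bar W (\<iota> y)) (bar U) - nabla (\<iota> y) (bar U (\<iota> y)) (bar W) = 0"
    using nabla A lie0 unfolding levi_civita_def by metis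
  then have n: "nabla (\<iota> y) (push y (W y)) (bar U) - nabla (\<iota> y) (push y (U y)) (bar W) = 0"
    by (simp only: bar_y[OF W] bar_y[OF U])
  have ex: "D y (X y) (\<lambda>z. push z (X' z)) =
      (\<Sum>b\<in>Basis. X y (\<lambda>z. X' z (\<lambda>z. \<phi> (\<iota> z) \<bullet> b)) *\<^sub>R ?E b (\<iota> y)) + nabla (\<iota> y) (push y (X y)) (bar X')"
    if X: "section_near \<B> \<B> id y X" and X': "section_near \<B> \<B> id y X'" for X X'
  proof -
    have X'': "snear y (\<lambda>z. push z (X' z))"
      by (rule section_near_pushforward[OF MB MA \<iota> X'])
    have "\<forall>\<^sub>F z in nhds y. \<iota> z \<in> C"
      using eventually_nhds_in_open[OF open_vimage_smooth_map[OF \<iota> C], of y] c(2) by simp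
    then have e: "\<forall>\<^sub>F z in nhds y. push z (X' z) (\<lambda>x. \<phi> x \<bullet> b) = X' z (\<lambda>z. \<phi> (\<iota> z) \<bullet> b)" for b
      by eventually_elim (simp add: pushforward_def coord o_def)
    have "X y (\<lambda>z. push z (X' z) (\<lambda>x. \<phi> x \<bullet> b)) = X y (\<lambda>z. X' z (\<lambda>z. \<phi> (\<iota> z) \<bullet> b))" for b
      by (rule tangent_cong[OF t[OF X] section_near_expansion(2)[OF MB MA \<iota> c X''] e])
    then show ?thesis
      using D_expansion[OF c t[OF X] X''] by (simp only: bar_def[abs_def])
  qed
  let ?b = "lie_bracket \<B> W U y"
  have "push y ?b = (\<Sum>b\<in>Basis. push y ?b (\<lambda>x. \<phi> x \<bullet> b) *\<^sub>R ?E b (\<iota> y))"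
    by (intro tangent_expansion[OF MA c] pushforward_tangent[OF MB MA \<iota>] lie_bracket_tangent[OF MB] W U)
  also have "\<dots> = (\<Sum>b\<in>Basis. (W y (\<lambda>z. U z (\<lambda>z. \<phi> (\<iota> z) \<bullet> b)) - U y (\<lambda>z. W z (\<lambda>z. \<phi> (\<iota> z) \<bullet> b))) *\<^sub>R ?E b (\<iota> y))"
    using coord[OF c(2)] smooth_near_compose_map[OF MB MA \<iota> coord[OF c(2)]]
    by (simp add: pushforward_def lie_bracket_def o_def)
  finally show ?thesis
    using n unfolding ex[OF W U] ex[OF U W]
    by (simp add: scaleR_left_diff_distrib sum_subtractf algebra_simps)
qed

text \<open>Koszul's argument: if the induced metric vanishes, then \<open>g(D\<^sub>W U, X)\<close> is symmetric in \<open>W\<close>,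
  \<open>U\<close> and skew in \<open>U\<close>, \<open>X\<close>.  Hence it vanishes.\<close>

lemma isotropic_second_form_tangent:
  assumes iso: "\<And>z u v. u \<in> TB z \<Longrightarrow> v \<in> TB z \<Longrightarrow> g (\<iota> z) (push z u) (push z v) = 0"
    and W: "section_near \<B> \<B> id y W" and U: "section_near \<B> \<B> id y U" and X: "section_near \<B> \<B> id y X"
  shows "g (\<iota> y) (D y (W y) (\<lambda>z. push z (U z))) (push y (X y)) = 0"
proof -
  let ?b = "\<lambda>W U X. g (\<iota> y) (D y (W y) (\<lambda>z. push z (U z))) (push y (X y))"
  have t: "\<forall>\<^sub>F z in nhds y. X z \<in> TB z" "X y \<in> TB y" if "section_near \<B> \<B> id y X" for X
    using that section_near_at[OF MB smooth_map_id[OF MB] that]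
    unfolding section_near_iff[OF MB smooth_map_id[OF MB]] by (auto simp: section_at_def elim: eventually_mono)
  note p = section_near_pushforward[OF MB MA \<iota>] and pt = pushforward_tangent[OF MB MA \<iota>]
  have sym: "?b W U X = ?b U W X"
    if W: "section_near \<B> \<B> id y W" and U: "section_near \<B> \<B> id y U" and X: "section_near \<B> \<B> id y X" for W U X
  proof -
    have l: "lie_bracket \<B> W U y \<in> TB y" by (rule lie_bracket_tangent[OF MB W U])
    have "D y (W y) (\<lambda>z. push z (U z)) = push y (lie_bracket \<B> W U y) + D y (U y) (\<lambda>z. push z (W z))"
      using torsion_free[OF W U] by (simp add: algebra_simps)
    then show ?thesis
      using g_add_left[OF pt[OF l] D_tangent[OF t(2)[OF U] p[OF W]] pt[OF t(2)[OF X]]] iso[OF l t(2)[OF X]]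
      by simp
  qed
  have skew: "?b W U X = - ?b W X U"
    if W: "section_near \<B> \<B> id y W" and U: "section_near \<B> \<B> id y U" and X: "section_near \<B> \<B> id y X" for W U X
  proof -
    have "\<forall>\<^sub>F z in nhds y. 0 = g (\<iota> z) (push z (U z)) (push z (X z))"
      using t(1)[OF U] t(1)[OF X] by eventually_elim (simp add: iso)
    then have "W y (\<lambda>z. g (\<iota> z) (push z (U z)) (push z (X z))) = 0"
      using tangent_cong[OF t(2)[OF W] smooth_near_const] tangent_const[OF t(2)[OF W]] by metis
    then show ?thesis
      using metric_compatible[OF p[OF U] p[OF X] t(2)[OF W]]
        g_sym[OF pt[OF t(2)[OF U]] D_tangent[OF t(2)[OF W] p[OF X]]] by simp
  qed
  show ?thesis
    using skew[OF W U X] sym[OF W X U] skew[OF X W U] sym[OF X U W] skew[OF U X W] sym[OF U W X] by simp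
qed

end

section \<open>Extension of sections\<close>

text \<open>A local section can be multiplied by a bump function and extended by zero, without changing
  its value at a given point.\<close>

lemma extend_section:
  fixes \<B> :: "('b::{t2_space, second_countable_topology}, 'd::euclidean_space) atlas"
  assumes M: "smooth_manifold \<B>" "smooth_map \<B> \<A> \<iota>" and A: "open A" "y \<in> A"
    and V0: "section_along \<B> \<A> \<iota> A V0" and E: "\<And>z. z \<in> A \<Longrightarrow> V0 z \<in> E z" "\<And>z. subspace (E z)"
  obtains V where "V \<in> sections \<B> \<A> \<iota> E" "V y = V0 y"
proof -
  obtain \<rho> :: "'b \<Rightarrow> real" and K where \<rho>: "smooth_fun \<B> UNIV \<rho>" "\<rho> y = 1" and K: "closed K" "K \<subseteq> A"
    and \<rho>0: "\<And>z. z \<notin> K \<Longrightarrow> \<rho> z = 0"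
    using manifold_bump[OF M(1) A] by blast
  define V where "V z = (if z \<in> A then \<rho> z *\<^sub>R V0 z else 0)" for z
  have "section_near \<B> \<A> \<iota> z V" for z
  proof (cases "z \<in> A")
    case True
    have "section_near \<B> \<A> \<iota> z (\<lambda>z. \<rho> z *\<^sub>R V0 z)"
      using smooth_fun_near[OF open_UNIV _ \<rho>(1)]
      by (intro section_near_scaleR[OF M] section_along_near[OF A(1) True V0]) simp
    moreover have "\<forall>\<^sub>F z in nhds z. \<rho> z *\<^sub>R V0 z = V z"
      unfolding eventually_nhds using A True by (intro exI[of _ A]) (simp add: V_def)
    ultimately show ?thesis by (rule section_near_cong[OF M])
  next
    case False
    have "\<forall>\<^sub>F z in nhds z. 0 = V z"
      unfolding eventually_nhds using False K \<rho>0 by (intro exI[of _ "- K"]) (auto simp: V_def)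
    then show ?thesis by (rule section_near_cong[OF M section_near_zero[OF M]])
  qed
  then have "section_along \<B> \<A> \<iota> UNIV V"
    by (intro section_near_imp_section_along[OF M open_UNIV])
  moreover have "V z \<in> E z" for z
    using E subspace_scale[OF E(2)] subspace_0[OF E(2)] by (auto simp: V_def)
  ultimately have "V \<in> sections \<B> \<A> \<iota> E" by (simp add: sections_def)
  with that A \<rho>(2) show ?thesis by (simp add: V_def)
qed

lemma subbundle_section_through:
  fixes \<B> :: "('b::{t2_space, second_countable_topology}, 'd::euclidean_space) atlas"
  assumes M: "smooth_manifold \<B>" "smooth_map \<B> \<A> \<iota>" and E: "smooth_subbundle \<B> \<A> \<iota> E n" and v: "v \<in> E y"
  obtains A V where "open A" "y \<in> A" "section_along \<B> \<A> \<iota> A V" "\<And>z. z \<in> A \<Longrightarrow> V z \<in> E z" "V y = v"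
proof -
  obtain A F where A: "open A" "y \<in> A" and F: "smooth_frame \<B> \<A> \<iota> E n A F"
    using E unfolding smooth_subbundle_def by blast
  have Fs: "section_along \<B> \<A> \<iota> A (F i)" if "i < n" for i
    using F that by (simp add: smooth_frame_def)
  have sp: "span ((\<lambda>i. F i z) ` {..<n}) = E z" and inj: "inj_on (\<lambda>i. F i z) {..<n}" if "z \<in> A" for z
    using F that by (simp_all add: smooth_frame_def)
  obtain c where "v = (\<Sum>w\<in>(\<lambda>i. F i y) ` {..<n}. c w *\<^sub>R w)"
    using v unfolding sp[OF A(2), symmetric] by (auto simp: span_finite)
  then have v: "v = (\<Sum>i<n. c (F i y) *\<^sub>R F i y)"
    by (simp add: sum.reindex[OF inj[OF A(2)]] o_def)
  define V where "V z = (\<Sum>i<n. c (F i y) *\<^sub>R F i z)" for z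
  have "section_near \<B> \<A> \<iota> z V" if "z \<in> A" for z
    unfolding V_def[abs_def]
    by (intro section_near_sum[OF M] section_near_scaleR[OF M] smooth_near_const
        section_along_near[OF A(1) that Fs]) simp
  then have "section_along \<B> \<A> \<iota> A V"
    by (rule section_near_imp_section_along[OF M A(1)])
  moreover have "V z \<in> E z" if "z \<in> A" for z
    unfolding V_def sp[OF that, symmetric] by (intro span_sum span_scale span_base) auto
  ultimately show ?thesis
    using that A v by (simp add: V_def)
qed

section \<open>Isotropic screen transversal lightlike submanifolds\<close>

text \<open>An isotropic screen transversal lightlike submanifold of a locally metallic manifold, with its
  screen transversal bundle \<open>S\<close>, lightlike transversal bundle \<open>L\<close> and induced connection \<open>D\<close>.\<close>

locale isotropic_screen_transversal = induced_levi_civita \<A> g nabla \<B> \<iota> D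
  for \<A> :: "('a::{t2_space, second_countable_topology}, 'e::euclidean_space) atlas"
    and g :: "'a \<Rightarrow> 'a tvec \<Rightarrow> 'a tvec \<Rightarrow> real"
    and nabla :: "'a \<Rightarrow> 'a tvec \<Rightarrow> ('a \<Rightarrow> 'a tvec) \<Rightarrow> 'a tvec"
    and \<B> :: "('b::{t2_space, second_countable_topology}, 'd::euclidean_space) atlas"
    and \<iota> :: "'b \<Rightarrow> 'a"
    and D :: "'b \<Rightarrow> 'b tvec \<Rightarrow> ('b \<Rightarrow> 'a tvec) \<Rightarrow> 'a tvec" +
  fixes p q :: nat and J :: "'a \<Rightarrow> 'a tvec \<Rightarrow> 'a tvec" and S L :: "'b \<Rightarrow> 'a tvec set"
  assumes q: "q > 0"
    and metallic: "metallic_semi_riemannian p q \<A> g J"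
    and parallel: "parallel_11 \<A> nabla J"
    and st_isotropic: "screen_transversal_lightlike_isotropic \<B> \<A> \<iota> g J S"
    and screen: "screen_transversal_bundle \<B> \<A> \<iota> g S"
    and ltr: "lightlike_transversal_bundle \<B> \<A> \<iota> g S DIM('d) L"
    and J_L: "J (\<iota> y) ` L y \<subseteq> S y"
    and decomposition: "tangent_decomposition \<B> \<A> \<iota> g J S L"
begin

abbreviation "T \<equiv> TN \<B> \<A> \<iota>"
abbreviation "R \<equiv> Rad \<B> \<A> \<iota> g"
abbreviation "Do \<equiv> D_o \<B> \<A> \<iota> g J S L"
abbreviation "ltrp \<equiv> ltr_part \<B> \<A> \<iota> S L"
abbreviation "strp \<equiv> str_part \<B> \<A> \<iota> S L"

lemma J_tensor: "tensor_field_11 \<A> J"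
  using metallic by (simp add: metallic_semi_riemannian_def)

lemma J_tangent: "v \<in> TM x \<Longrightarrow> J x v \<in> TM x"
  using J_tensor by (simp add: tensor_field_11_def)

lemma J_zero: "J x 0 = 0"
proof -
  have "J x (1 *\<^sub>R 0 + 0) = 1 *\<^sub>R J x 0 + J x 0"
    using J_tensor TM_zero unfolding tensor_field_11_def by blast
  then show ?thesis by simp
qed

lemma J_self_adjoint: "u \<in> TM x \<Longrightarrow> v \<in> TM x \<Longrightarrow> g x (J x u) v = g x u (J x v)"
  using metallic by (simp add: metallic_semi_riemannian_def)

lemma J_square: "v \<in> TM x \<Longrightarrow> J x (J x v) = real p *\<^sub>R J x v + real q *\<^sub>R v"
  using metallic by (simp add: metallic_semi_riemannian_def)

lemma g_J_J:
  assumes "u \<in> TM x" "v \<in> TM x"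
  shows "g x (J x u) (J x v) = real p * g x u (J x v) + real q * g x u v"
  using assms by (simp add: J_self_adjoint J_square J_tangent g_add_right g_scale_right TM_scale)

lemma Rad_frame:
  obtains A \<xi> where "open A" "y \<in> A" "smooth_frame \<B> \<A> \<iota> R DIM('d) A \<xi>"
  using st_isotropic
  unfolding screen_transversal_lightlike_isotropic_def isotropic_def lightlike_def smooth_subbundle_def
  by blast

text \<open>The rank of \<open>Rad\<close> is the dimension of the submanifold.  As \<open>TN\<close> is spanned by the images of
  the coordinate vectors, \<open>Rad\<close> is all of \<open>TN\<close>.\<close>

lemma Rad_eq_TN: "R y = T y"
proof
  show "R y \<subseteq> T y" by (auto simp: Rad_def)
  obtain A \<xi> where A: "open A" "y \<in> A" and \<xi>: "smooth_frame \<B> \<A> \<iota> R DIM('d) A \<xi>"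
    by (rule Rad_frame)
  let ?F = "(\<lambda>i. \<xi> i y) ` {..<DIM('d)}"
  have F: "inj_on (\<lambda>i. \<xi> i y) {..<DIM('d)}" "independent ?F" "span ?F = R y"
    using \<xi> A by (simp_all add: smooth_frame_def)
  obtain C \<phi> where c: "(C, \<phi>) \<in> \<B>" "y \<in> C"
    using chart_at[OF MB] by blast
  let ?G = "(\<lambda>b. push y (coord_field \<B> C \<phi> b y)) ` (Basis :: 'd set)"
  have T_span: "T y \<subseteq> span ?G"
  proof
    fix u assume "u \<in> T y"
    then obtain w where w: "w \<in> TB y" "u = push y w" by (auto simp: TN_def)
    have "u = push y (\<Sum>b\<in>Basis. w (\<lambda>z. \<phi> z \<bullet> b) *\<^sub>R coord_field \<B> C \<phi> b y)"
      unfolding w(2) by (rule arg_cong[OF tangent_expansion[OF MB c w(1)]])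
    also have "\<dots> = (\<Sum>b\<in>Basis. w (\<lambda>z. \<phi> z \<bullet> b) *\<^sub>R push y (coord_field \<B> C \<phi> b y))"
      by (simp only: linear_sum[OF linear_pushforward] linear_scale[OF linear_pushforward])
    also have "\<dots> \<in> span ?G"
      by (intro span_sum span_scale span_base) auto
    finally show "u \<in> span ?G" .
  qed
  show "T y \<subseteq> R y"
  proof
    fix v assume v: "v \<in> T y"
    show "v \<in> R y"
    proof (rule ccontr)
      assume "v \<notin> R y"
      then have nv: "v \<notin> span ?F" using F(3) by simp
      then have ind: "independent (insert v ?F)"
        using F(2) independent_insertI by blast
      have "?F \<subseteq> R y"
        using span_superset[of ?F] by (simp only: F(3))
      then have sub: "insert v ?F \<subseteq> span ?G"
        using v T_span \<open>R y \<subseteq> T y\<close> by blast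
      have "card (insert v ?F) \<le> card ?G"
        using independent_span_bound[OF _ ind sub] by simp
      moreover have "card ?G \<le> DIM('d)" by (rule card_image_le) simp
      moreover have "v \<notin> ?F" using nv by (rule contrapos_nn) (rule span_base)
      then have "card (insert v ?F) = Suc DIM('d)"
        by (simp add: card_image[OF F(1)])
      ultimately show False by simp
    qed
  qed
qed

lemma span_orthogonal:
  assumes F: "F \<subseteq> TM x" and G: "G \<subseteq> TM x" and "\<And>u v. u \<in> F \<Longrightarrow> v \<in> G \<Longrightarrow> g x u v = 0"
    and u: "u \<in> span F" and v: "v \<in> span G"
  shows "g x u v = 0"
proof -
  have l: "subspace {u \<in> TM x. g x u v = 0}" if "v \<in> TM x" for v
    using that unfolding subspace_def by (auto simp: g_zero_left g_add_left g_scale_left TM_zero TM_add TM_scale)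
  have r: "subspace {v \<in> TM x. g x u v = 0}" if "u \<in> TM x" for u
    using that unfolding subspace_def by (auto simp: g_zero_right g_add_right g_scale_right TM_zero TM_add TM_scale)
  have 1: "span G \<subseteq> {v \<in> TM x. g x u v = 0}" if "u \<in> F" for u
    using F G assms(3)[OF that] that by (intro span_minimal r) auto
  have "span F \<subseteq> {u \<in> TM x. g x u v = 0}"
    using F G 1 v span_minimal[OF G subspace_tangent_space] by (intro span_minimal l) auto
  then show ?thesis using u by auto
qed


lemma T_tangent: "u \<in> T y \<Longrightarrow> u \<in> TM (\<iota> y)"
  using pushforward_tangent[OF MB MA \<iota>] by (auto simp: TN_def)

lemma S_perp: "s \<in> S y \<Longrightarrow> s \<in> TN_perp \<B> \<A> \<iota> g y"
proof -
  assume s: "s \<in> S y"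
  have "0 \<in> R y" and eq: "TN_perp \<B> \<A> \<iota> g y = R y \<boxplus> S y"
    using screen unfolding screen_transversal_bundle_def complementary_def by (auto intro: subspace_0)
  then show ?thesis
    using s unfolding eq subspace_sum_def by force
qed

lemma S_tangent: "s \<in> S y \<Longrightarrow> s \<in> TM (\<iota> y)"
  using S_perp by (auto simp: TN_perp_def)

lemma g_S_T: "s \<in> S y \<Longrightarrow> u \<in> T y \<Longrightarrow> g (\<iota> y) s u = 0"
  using S_perp by (auto simp: TN_perp_def)

lemma g_T_S: "s \<in> S y \<Longrightarrow> u \<in> T y \<Longrightarrow> g (\<iota> y) u s = 0"
  using g_S_T g_sym S_tangent T_tangent by metis

lemma g_T_T: "u \<in> T y \<Longrightarrow> v \<in> T y \<Longrightarrow> g (\<iota> y) u v = 0"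
  using Rad_eq_TN[of y] by (auto simp: Rad_def TN_perp_def)

lemma L_subbundle: "smooth_subbundle \<B> \<A> \<iota> L DIM('d)"
  using ltr by (simp add: lightlike_transversal_bundle_def)

lemma g_L_S: "n \<in> L y \<Longrightarrow> s \<in> S y \<Longrightarrow> g (\<iota> y) n s = 0"
  using ltr by (simp add: lightlike_transversal_bundle_def orthogonal_sets_def)

lemma dual_frames:
  obtains A \<xi> N where "open A" "y \<in> A" "smooth_frame \<B> \<A> \<iota> R DIM('d) A \<xi>" "smooth_frame \<B> \<A> \<iota> L DIM('d) A N"
    "\<And>z i j. z \<in> A \<Longrightarrow> i < DIM('d) \<Longrightarrow> j < DIM('d) \<Longrightarrow>
      g (\<iota> z) (\<xi> i z) (N j z) = (if i = j then 1 else 0)"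
    "\<And>z i j. z \<in> A \<Longrightarrow> i < DIM('d) \<Longrightarrow> j < DIM('d) \<Longrightarrow> g (\<iota> z) (N i z) (N j z) = 0"
proof -
  obtain A \<xi> where A: "open A" "y \<in> A" and \<xi>: "smooth_frame \<B> \<A> \<iota> R DIM('d) A \<xi>"
    by (rule Rad_frame)
  have "\<exists>N. smooth_frame \<B> \<A> \<iota> L DIM('d) A N \<and> (\<forall>z\<in>A. \<forall>i<DIM('d). \<forall>j<DIM('d).
      g (\<iota> z) (\<xi> i z) (N j z) = (if i = j then 1 else 0) \<and> g (\<iota> z) (N i z) (N j z) = 0)"
    using ltr A(1) \<xi> unfolding lightlike_transversal_bundle_def by blast
  then show ?thesis using that A \<xi> by blast
qed

lemma smooth_frameD:
  assumes "smooth_frame \<B> \<A> \<iota> E n A F"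
  shows "i < n \<Longrightarrow> section_along \<B> \<A> \<iota> A (F i)" "z \<in> A \<Longrightarrow> span ((\<lambda>i. F i z) ` {..<n}) = E z"
    "z \<in> A \<Longrightarrow> i < n \<Longrightarrow> F i z \<in> TM (\<iota> z)"
  using assms by (auto simp: smooth_frame_def section_along_def)

lemma L_tangent: "n \<in> L y \<Longrightarrow> n \<in> TM (\<iota> y)"
proof -
  assume n: "n \<in> L y"
  obtain A N where A: "y \<in> A" "smooth_frame \<B> \<A> \<iota> L DIM('d) A N"
    using dual_frames[of y] by metis
  have "span ((\<lambda>i. N i y) ` {..<DIM('d)}) \<subseteq> TM (\<iota> y)"
    using smooth_frameD(3)[OF A(2,1)] by (intro span_minimal subspace_tangent_space) auto
  then show ?thesis using n smooth_frameD(2)[OF A(2,1)] by auto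
qed

lemma g_L_L: "n \<in> L y \<Longrightarrow> n' \<in> L y \<Longrightarrow> g (\<iota> y) n n' = 0"
proof -
  assume n: "n \<in> L y" "n' \<in> L y"
  obtain A N where A: "y \<in> A" and N: "smooth_frame \<B> \<A> \<iota> L DIM('d) A N"
    "\<And>z i j. z \<in> A \<Longrightarrow> i < DIM('d) \<Longrightarrow> j < DIM('d) \<Longrightarrow> g (\<iota> z) (N i z) (N j z) = 0"
    using dual_frames[of y] by metis
  let ?F = "(\<lambda>i. N i y) ` {..<DIM('d)}"
  have F: "?F \<subseteq> TM (\<iota> y)"
    using smooth_frameD(3)[OF N(1) A] by auto
  show ?thesis
    by (rule span_orthogonal[OF F F]) (use n N A smooth_frameD(2)[OF N(1) A] in auto)
qed

lemma subspaces: "subspace (T y)" "subspace (L y)" "subspace (S y)"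
  using decomposition screen
  by (simp_all add: tangent_decomposition_def Let_def complementary_def screen_transversal_bundle_def)

lemma J_T_in_S: "u \<in> T y \<Longrightarrow> J (\<iota> y) u \<in> S y"
  using st_isotropic unfolding screen_transversal_lightlike_isotropic_def Rad_eq_TN by blast

lemma J_L_in_S: "n \<in> L y \<Longrightarrow> J (\<iota> y) n \<in> S y"
  using J_L by blast

lemma Do_in_S: "z \<in> Do y \<Longrightarrow> z \<in> S y"
  by (simp add: D_o_def)

lemma tangent_decomp_cases:
  assumes "v \<in> TM (\<iota> y)"
  obtains t n u m z where "t \<in> T y" "n \<in> L y" "u \<in> T y" "m \<in> L y" "z \<in> Do y"
    "v = t + n + (J (\<iota> y) u + J (\<iota> y) m) + z"
proof -
  have "TM (\<iota> y) = (T y \<boxplus> L y) \<boxplus> (J (\<iota> y) ` R y \<boxplus> J (\<iota> y) ` L y) \<boxplus> Do y"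
    using decomposition unfolding tangent_decomposition_def Let_def by blast
  with assms show ?thesis
    unfolding subspace_sum_def Rad_eq_TN using that by blast
qed

lemma tangent_decomp:
  assumes "v \<in> TM (\<iota> y)"
  obtains t n s where "t \<in> T y" "n \<in> L y" "s \<in> S y" "v = t + n + s"
proof -
  obtain t n u m z where *: "t \<in> T y" "n \<in> L y" "u \<in> T y" "m \<in> L y" "z \<in> Do y"
    "v = t + n + (J (\<iota> y) u + J (\<iota> y) m) + z"
    using tangent_decomp_cases[OF assms] by blast
  have "J (\<iota> y) u + J (\<iota> y) m + z \<in> S y"
    using * J_T_in_S J_L_in_S Do_in_S by (intro subspace_add[OF subspaces(3)]) auto
  then show ?thesis
    using that[OF *(1,2)] *(6) by (simp add: add.assoc)
qed

lemma g_split: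
  assumes "t \<in> T y" "n \<in> L y" "s \<in> S y" "x \<in> TM (\<iota> y)"
  shows "g (\<iota> y) x (t + n + s) = g (\<iota> y) x t + g (\<iota> y) x n + g (\<iota> y) x s"
    and "g (\<iota> y) (t + n + s) x = g (\<iota> y) t x + g (\<iota> y) n x + g (\<iota> y) s x"
  using T_tangent[OF assms(1)] L_tangent[OF assms(2)] S_tangent[OF assms(3)] assms(4)
  by (simp_all only: g_add_left g_add_right TM_add)

text \<open>Non-degeneracy of \<open>g\<close>, tested on the summands of the decomposition.\<close>

lemma L_eq_0I:
  assumes n: "n \<in> L y" and "\<And>t. t \<in> T y \<Longrightarrow> g (\<iota> y) n t = 0"
  shows "n = 0"
proof (rule g_nondegenerate[OF L_tangent[OF n]])
  fix v assume "v \<in> TM (\<iota> y)"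
  then obtain t m s where "t \<in> T y" "m \<in> L y" "s \<in> S y" "v = t + m + s"
    by (rule tangent_decomp)
  then show "g (\<iota> y) n v = 0"
    using assms g_L_L g_L_S L_tangent by (simp add: g_split)
qed

lemma S_eq_0I:
  assumes s: "s \<in> S y" and "\<And>u. u \<in> T y \<Longrightarrow> g (\<iota> y) s (J (\<iota> y) u) = 0"
    and "\<And>n. n \<in> L y \<Longrightarrow> g (\<iota> y) s (J (\<iota> y) n) = 0" and "\<And>z. z \<in> Do y \<Longrightarrow> g (\<iota> y) s z = 0"
  shows "s = 0"
proof (rule g_nondegenerate[OF S_tangent[OF s]])
  fix v assume "v \<in> TM (\<iota> y)"
  then obtain t n u m z where *: "t \<in> T y" "n \<in> L y" "u \<in> T y" "m \<in> L y" "z \<in> Do y"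
    "v = t + n + (J (\<iota> y) u + J (\<iota> y) m) + z"
    by (rule tangent_decomp_cases)
  have "g (\<iota> y) s n = 0"
    using g_L_S[OF *(2) s] g_sym[OF L_tangent[OF *(2)] S_tangent[OF s]] by simp
  moreover have "t \<in> TM (\<iota> y)" "n \<in> TM (\<iota> y)" "J (\<iota> y) u \<in> TM (\<iota> y)" "J (\<iota> y) m \<in> TM (\<iota> y)" "z \<in> TM (\<iota> y)"
    using * T_tangent L_tangent S_tangent J_T_in_S J_L_in_S Do_in_S by blast+
  ultimately show "g (\<iota> y) s v = 0"
    unfolding *(6) using assms * g_S_T S_tangent[OF s] by (simp only: g_add_right TM_add)
qed

lemma S_inter_T_L:
  assumes s: "s \<in> S y" and "t \<in> T y" "n \<in> L y" "s = t + n"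
  shows "s = 0"
proof (rule g_nondegenerate[OF S_tangent[OF s]])
  fix v assume "v \<in> TM (\<iota> y)"
  then obtain t' n' s' where v: "t' \<in> T y" "n' \<in> L y" "s' \<in> S y" "v = t' + n' + s'"
    by (rule tangent_decomp)
  have "g (\<iota> y) s n' = 0"
    using g_L_S[OF v(2) s] g_sym[OF L_tangent[OF v(2)] S_tangent[OF s]] by simp
  moreover have "g (\<iota> y) s s' = 0"
    unfolding assms(4) using assms(2,3) v(3) T_tangent L_tangent S_tangent g_T_S g_L_S by (simp add: g_add_left)
  ultimately show "g (\<iota> y) s v = 0"
    unfolding v(4) using v g_S_T[OF s] S_tangent[OF s] by (simp add: g_split)
qed

lemma T_inter_L: "t \<in> T y \<Longrightarrow> t \<in> L y \<Longrightarrow> t = 0"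
  using decomposition unfolding tangent_decomposition_def Let_def complementary_def by blast

text \<open>The sum \<open>TN \<oplus> ltr \<oplus> S\<close> is direct, so that the components \<open>ltr_part\<close> and \<open>str_part\<close>, defined by
  a definite description, exist.\<close>

lemma decomp_unique:
  assumes "t \<in> T y" "n \<in> L y" "s \<in> S y" "t' \<in> T y" "n' \<in> L y" "s' \<in> S y" "t + n + s = t' + n' + s'"
  shows "n = n'" "s = s'"
proof -
  have "s - s' = (t' - t) + (n' - n)"
    using assms(7) by (simp add: algebra_simps)
  moreover have d: "t' - t \<in> T y" "n' - n \<in> L y" "s - s' \<in> S y"
    using assms subspaces by (auto intro: subspace_diff)
  ultimately have s: "s - s' = 0" using S_inter_T_L by blast
  then show "s = s'" by simp
  have "t' - t = n - n'"
    using assms(7) s by (simp add: algebra_simps)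
  moreover have "n - n' \<in> L y"
    using assms subspaces by (auto intro: subspace_diff)
  ultimately have "t' - t = 0" using d T_inter_L by metis
  then show "n = n'" using \<open>t' - t = n - n'\<close> by simp
qed

lemma parts_eq:
  assumes v: "t \<in> T y" "n \<in> L y" "s \<in> S y" "v = t + n + s"
  shows "ltrp y v = n" "strp y v = s"
proof -
  show "ltrp y v = n"
    unfolding ltr_part_def component_def
  proof (rule the_equality)
    show "n \<in> L y \<and> v - n \<in> T y \<boxplus> S y"
    proof -
      have "v - n = t + s" using v(4) by simp
      then show ?thesis unfolding subspace_sum_def using v by blast
    qed
    fix n' assume "n' \<in> L y \<and> v - n' \<in> T y \<boxplus> S y"
    then obtain t' s' where "n' \<in> L y" "t' \<in> T y" "s' \<in> S y" "v - n' = t' + s'"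
      unfolding subspace_sum_def by blast
    moreover from this have "t' + n' + s' = t + n + s"
      using v(4) by (simp add: algebra_simps)
    ultimately show "n' = n" using v decomp_unique(1) by blast
  qed
  show "strp y v = s"
    unfolding str_part_def component_def
  proof (rule the_equality)
    show "s \<in> S y \<and> v - s \<in> T y \<boxplus> L y"
    proof -
      have "v - s = t + n" using v(4) by simp
      then show ?thesis unfolding subspace_sum_def using v by blast
    qed
    fix s' assume "s' \<in> S y \<and> v - s' \<in> T y \<boxplus> L y"
    then obtain t' n' where "s' \<in> S y" "t' \<in> T y" "n' \<in> L y" "v - s' = t' + n'"
      unfolding subspace_sum_def by blast
    moreover from this have "t' + n' + s' = t + n + s"
      using v(4) by (simp add: algebra_simps)
    ultimately show "s' = s" using v decomp_unique(2) by blast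
  qed
qed

lemma parts:
  assumes v: "v \<in> TM (\<iota> y)"
  shows "\<exists>t\<in>T y. v = t + ltrp y v + strp y v" "ltrp y v \<in> L y" "strp y v \<in> S y"
proof -
  obtain t n s where *: "t \<in> T y" "n \<in> L y" "s \<in> S y" "v = t + n + s"
    using tangent_decomp[OF v] by blast
  show "\<exists>t\<in>T y. v = t + ltrp y v + strp y v" "ltrp y v \<in> L y" "strp y v \<in> S y"
    using * parts_eq[OF *] by auto
qed

lemma g_ltr_part:
  assumes v: "v \<in> TM (\<iota> y)" and u: "u \<in> T y"
  shows "g (\<iota> y) v u = g (\<iota> y) (ltrp y v) u"
proof -
  obtain t where t: "t \<in> T y" "v = t + ltrp y v + strp y v" using parts(1)[OF v] by blast
  show ?thesis
    using g_split(2)[OF t(1) parts(2,3)[OF v] T_tangent[OF u], folded t(2)]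
      g_T_T[OF t(1) u] g_S_T[OF parts(3)[OF v] u] by simp
qed

lemma g_str_part:
  assumes v: "v \<in> TM (\<iota> y)" and s: "s \<in> S y"
  shows "g (\<iota> y) v s = g (\<iota> y) (strp y v) s"
proof -
  obtain t where t: "t \<in> T y" "v = t + ltrp y v + strp y v" using parts(1)[OF v] by blast
  show ?thesis
    using g_split(2)[OF t(1) parts(2,3)[OF v] S_tangent[OF s], folded t(2)]
      g_T_S[OF s t(1)] g_L_S[OF parts(2)[OF v] s] by simp
qed

lemma ltr_part_eq_0_iff:
  assumes v: "v \<in> TM (\<iota> y)"
  shows "ltrp y v = 0 \<longleftrightarrow> (\<forall>u\<in>T y. g (\<iota> y) v u = 0)"
  using g_ltr_part[OF v] L_eq_0I[OF parts(2)[OF v]] g_zero_left T_tangent by metis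

lemma str_part_eq_0I:
  assumes v: "v \<in> TM (\<iota> y)" and "\<And>u. u \<in> T y \<Longrightarrow> g (\<iota> y) v (J (\<iota> y) u) = 0"
    and "\<And>n. n \<in> L y \<Longrightarrow> g (\<iota> y) v (J (\<iota> y) n) = 0" and "\<And>z. z \<in> Do y \<Longrightarrow> g (\<iota> y) v z = 0"
  shows "strp y v = 0"
  using assms(2-) g_str_part[OF v] J_T_in_S J_L_in_S Do_in_S
  by (intro S_eq_0I[OF parts(3)[OF v]]) metis+

section \<open>Global sections through given vectors\<close>

lemma tangent_sections_Rad: "tangent_sections \<B> \<A> \<iota> R = {X. vector_field \<B> UNIV X}"
proof -
  have "X y \<in> TB y" if "vector_field \<B> UNIV X" for X y
    using that by (simp add: section_along_def)
  then show ?thesis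
    by (auto simp: tangent_sections_def Rad_eq_TN TN_def)
qed

lemma T_section_through:
  assumes "u \<in> T y"
  obtains X where "X \<in> tangent_sections \<B> \<A> \<iota> R" "push y (X y) = u"
proof -
  obtain w where w: "w \<in> TB y" "u = push y w" using assms by (auto simp: TN_def)
  obtain X0 where X0: "section_near \<B> \<B> id y X0" "X0 y = w"
    using vector_field_through[OF MB w(1)] by blast
  then obtain A where A: "open A" "y \<in> A" "vector_field \<B> A X0"
    unfolding section_near_def by blast
  have "X0 z \<in> TB z" if "z \<in> A" for z
    using A(3) that by (simp add: section_along_def)
  then obtain X where "X \<in> sections \<B> \<B> id (\<lambda>z. TB z)" "X y = X0 y"
    using extend_section[OF MB smooth_map_id[OF MB] A, of "\<lambda>z. TB z"] subspace_tangent_space by blast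
  then show ?thesis
    using that[of X] w X0(2) by (simp add: sections_def tangent_sections_Rad)
qed

lemma L_section_through:
  assumes "n \<in> L y"
  obtains N where "N \<in> sections \<B> \<A> \<iota> L" "N y = n"
proof -
  obtain A V where A: "open A" "y \<in> A" and V: "section_along \<B> \<A> \<iota> A V" "\<And>z. z \<in> A \<Longrightarrow> V z \<in> L z" "V y = n"
    using subbundle_section_through[OF MB \<iota> L_subbundle assms] by blast
  obtain N where "N \<in> sections \<B> \<A> \<iota> L" "N y = V y"
    using extend_section[OF MB \<iota> A V(1), of L] V(2) subspaces(2) by blast
  with that V(3) show ?thesis by simp
qed

text \<open>The self-adjoint \<open>J\<close> maps \<open>Rad \<oplus> ltr\<close> onto \<open>J Rad \<oplus> J ltr\<close> and multiplies \<open>g\<close> by \<open>q\<close> there.\<close>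

lemma g_J_J_mixed:
  assumes x: "x \<in> T y" and n: "n \<in> L y"
  shows "u \<in> T y \<Longrightarrow> g (\<iota> y) (J (\<iota> y) (x + n)) (J (\<iota> y) u) = real q * g (\<iota> y) u n"
    and "m \<in> L y \<Longrightarrow> g (\<iota> y) (J (\<iota> y) (x + n)) (J (\<iota> y) m) = real q * g (\<iota> y) x m"
proof -
  have xn: "x + n \<in> TM (\<iota> y)" using T_tangent[OF x] L_tangent[OF n] by (rule TM_add)
  show "g (\<iota> y) (J (\<iota> y) (x + n)) (J (\<iota> y) u) = real q * g (\<iota> y) u n" if u: "u \<in> T y"
    using g_J_J[OF xn T_tangent[OF u]] x n u T_tangent L_tangent S_tangent[OF J_T_in_S[OF u]]
      g_T_S[OF J_T_in_S[OF u]] g_L_S[OF _ J_T_in_S[OF u]] g_T_T g_sym[OF L_tangent[OF n] T_tangent[OF u]]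
    by (simp add: g_add_left)
  show "g (\<iota> y) (J (\<iota> y) (x + n)) (J (\<iota> y) m) = real q * g (\<iota> y) x m" if m: "m \<in> L y"
    using g_J_J[OF xn L_tangent[OF m]] x n m T_tangent L_tangent S_tangent[OF J_L_in_S[OF m]]
      g_T_S[OF J_L_in_S[OF m]] g_L_S[OF _ J_L_in_S[OF m]] g_L_L
    by (simp add: g_add_left)
qed

lemma subspace_Do: "subspace (Do y)"
proof -
  have t: "u \<in> TM (\<iota> y)" if u: "u \<in> J (\<iota> y) ` R y \<boxplus> J (\<iota> y) ` L y" for u
  proof -
    from u obtain a b where "a \<in> T y" "b \<in> L y" "u = J (\<iota> y) a + J (\<iota> y) b"
      unfolding subspace_sum_def Rad_eq_TN by blast
    then show ?thesis using J_T_in_S J_L_in_S S_tangent by (auto intro: TM_add)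
  qed
  then show ?thesis
    unfolding subspace_def D_o_def
    using subspaces(3) S_tangent
    by (auto simp: g_zero_left g_add_left g_scale_left intro: subspace_0 subspace_add subspace_mul)
qed

lemma DoI:
  assumes z: "z \<in> S y" and "\<And>u. u \<in> T y \<Longrightarrow> g (\<iota> y) z (J (\<iota> y) u) = 0"
    and "\<And>n. n \<in> L y \<Longrightarrow> g (\<iota> y) z (J (\<iota> y) n) = 0"
  shows "z \<in> Do y"
proof -
  have "g (\<iota> y) z u = 0" if u: "u \<in> J (\<iota> y) ` R y \<boxplus> J (\<iota> y) ` L y" for u
  proof -
    from u obtain a b where "a \<in> T y" "b \<in> L y" "u = J (\<iota> y) a + J (\<iota> y) b"
      unfolding subspace_sum_def Rad_eq_TN by blast
    then show ?thesis
      using assms J_T_in_S J_L_in_S S_tangent by (simp add: g_add_right)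
  qed
  with z show ?thesis by (simp add: D_o_def)
qed

text \<open>A local section of \<open>S(TN\<^sup>\<bottom>)\<close> through \<open>z0\<close> is made orthogonal to \<open>J Rad \<oplus> J ltr\<close> by subtracting
  \<open>J (\<Sum>\<^sub>i a\<^sub>i \<xi>\<^sub>i + b\<^sub>i N\<^sub>i)\<close>, where \<open>a\<^sub>i\<close>, \<open>b\<^sub>i\<close> are its products with \<open>J N\<^sub>i\<close>, \<open>J \<xi>\<^sub>i\<close> divided by \<open>q\<close>;
  this works because \<open>g(J \<xi>\<^sub>i, J N\<^sub>j) = q \<delta>\<^sub>i\<^sub>j\<close>, while \<open>J Rad\<close> and \<open>J ltr\<close> are isotropic.  Nothing is
  subtracted at \<open>y\<close>, where \<open>z0\<close> is already orthogonal to \<open>J Rad \<oplus> J ltr\<close>.\<close>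

lemma Do_section_through:
  assumes z0: "z0 \<in> Do y"
  obtains Z where "Z \<in> sections \<B> \<A> \<iota> Do" "Z y = z0"
proof -
  obtain k where k: "smooth_subbundle \<B> \<A> \<iota> S k"
    using screen[unfolded screen_transversal_bundle_def, THEN conjunct1] by (rule exE)
  obtain A1 V where A1: "open A1" "y \<in> A1" and V: "section_along \<B> \<A> \<iota> A1 V"
    "\<And>z. z \<in> A1 \<Longrightarrow> V z \<in> S z" "V y = z0"
    using subbundle_section_through[OF MB \<iota> k Do_in_S[OF z0]] by blast
  obtain A2 \<xi> N where A2: "open A2" "y \<in> A2"
    and \<xi>: "smooth_frame \<B> \<A> \<iota> R DIM('d) A2 \<xi>" and N: "smooth_frame \<B> \<A> \<iota> L DIM('d) A2 N"
    and dual: "\<And>z i j. z \<in> A2 \<Longrightarrow> i < DIM('d) \<Longrightarrow> j < DIM('d) \<Longrightarrow>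
      g (\<iota> z) (\<xi> i z) (N j z) = (if i = j then 1 else 0)"
    using dual_frames[of y] by metis
  let ?m = "DIM('d)"
  define A where "A = A1 \<inter> A2"
  have A: "open A" "y \<in> A" using A1 A2 by (auto simp: A_def)
  have \<xi>T: "\<xi> i z \<in> T z" if "i < ?m" "z \<in> A" for i z
    using smooth_frameD(2)[OF \<xi>, of z] that span_base[of "\<xi> i z" "(\<lambda>i. \<xi> i z) ` {..<?m}"]
    by (auto simp: A_def Rad_eq_TN)
  have NL: "N i z \<in> L z" if "i < ?m" "z \<in> A" for i z
    using smooth_frameD(2)[OF N, of z] that span_base[of "N i z" "(\<lambda>i. N i z) ` {..<?m}"]
    by (auto simp: A_def)
  have VS: "V z \<in> S z" if "z \<in> A" for z using V(2) that by (simp add: A_def)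
  have sV: "snear z V" and s\<xi>: "i < ?m \<Longrightarrow> snear z (\<xi> i)" and sN: "i < ?m \<Longrightarrow> snear z (N i)"
    if "z \<in> A" for z i
    using that section_along_near[OF A1(1) _ V(1)] section_along_near[OF A2(1) _ smooth_frameD(1)[OF \<xi>]]
      section_along_near[OF A2(1) _ smooth_frameD(1)[OF N]] by (auto simp: A_def)
  define a where "a i z = g (\<iota> z) (V z) (J (\<iota> z) (N i z)) / real q" for i z
  define b where "b i z = g (\<iota> z) (V z) (J (\<iota> z) (\<xi> i z)) / real q" for i z
  have sa: "smooth_near \<B> z (a i)" and sb: "smooth_near \<B> z (b i)" if "z \<in> A" "i < ?m" for i z
    unfolding a_def[abs_def] b_def[abs_def] divide_inverse
    using smooth_near_mult[OF MB metric_smooth[OF sV section_near_tensor[OF J_tensor sN]] smooth_near_const]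
      smooth_near_mult[OF MB metric_smooth[OF sV section_near_tensor[OF J_tensor s\<xi>]] smooth_near_const] that
    by simp_all
  define x where "x z = (\<Sum>i<?m. a i z *\<^sub>R \<xi> i z)" for z
  define n where "n z = (\<Sum>i<?m. b i z *\<^sub>R N i z)" for z
  have xT: "x z \<in> T z" and nL: "n z \<in> L z" if "z \<in> A" for z
    unfolding x_def n_def using \<xi>T NL that
    by (auto intro!: subspace_sum[OF subspaces(1)] subspace_sum[OF subspaces(2)]
        subspace_mul[OF subspaces(1)] subspace_mul[OF subspaces(2)])
  have sx: "snear z x" and sn: "snear z n" if "z \<in> A" for z
    unfolding x_def[abs_def] n_def[abs_def] using that
    by (intro section_near_sum[OF MB \<iota>] section_near_scaleR[OF MB \<iota>] sa sb s\<xi> sN; simp)+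
  have gxN: "g (\<iota> z) (x z) (N j z) = a j z" and g\<xi>n: "g (\<iota> z) (\<xi> j z) (n z) = b j z"
    if z: "z \<in> A" and j: "j < ?m" for z j
  proof -
    have z2: "z \<in> A2" using z by (simp add: A_def)
    have "g (\<iota> z) (x z) (N j z) = (\<Sum>i<?m. a i z * g (\<iota> z) (\<xi> i z) (N j z))"
      unfolding x_def using \<xi>T NL z j T_tangent L_tangent
      by (subst g_sum_left) (auto simp: g_scale_left intro: TM_scale)
    also have "\<dots> = (\<Sum>i<?m. if i = j then a j z else 0)"
      using dual[OF z2] j by (intro sum.cong) auto
    finally show "g (\<iota> z) (x z) (N j z) = a j z" using j by simp
    have "g (\<iota> z) (n z) (\<xi> j z) = (\<Sum>i<?m. b i z * g (\<iota> z) (N i z) (\<xi> j z))"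
      unfolding n_def using \<xi>T NL z j T_tangent L_tangent
      by (subst g_sum_left) (auto simp: g_scale_left intro: TM_scale)
    also have "\<dots> = (\<Sum>i<?m. if i = j then b j z else 0)"
    proof (intro sum.cong refl)
      fix i assume "i \<in> {..<?m}"
      then show "b i z * g (\<iota> z) (N i z) (\<xi> j z) = (if i = j then b j z else 0)"
        using dual[OF z2 j, of i] g_sym[OF L_tangent[OF NL[of i z]] T_tangent[OF \<xi>T[OF j z]]] z by auto
    qed
    finally have "g (\<iota> z) (n z) (\<xi> j z) = b j z" using j by simp
    then show "g (\<iota> z) (\<xi> j z) (n z) = b j z"
      using g_sym[OF L_tangent[OF nL[OF z]] T_tangent[OF \<xi>T[OF j z]]] by simp
  qed
  define Z0 where "Z0 z = V z + (-1) *\<^sub>R J (\<iota> z) (x z + n z)" for z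
  have JS: "J (\<iota> z) (x z + n z) \<in> S z" if z: "z \<in> A" for z
  proof -
    have "J (\<iota> z) (1 *\<^sub>R x z + n z) = 1 *\<^sub>R J (\<iota> z) (x z) + J (\<iota> z) (n z)"
      using J_tensor T_tangent[OF xT[OF z]] L_tangent[OF nL[OF z]] unfolding tensor_field_11_def by blast
    then show ?thesis
      using J_T_in_S[OF xT[OF z]] J_L_in_S[OF nL[OF z]] subspace_add[OF subspaces(3)] by simp
  qed
  have sZ: "snear z Z0" if z: "z \<in> A" for z
    unfolding Z0_def[abs_def]
    by (intro section_near_add[OF MB \<iota>] section_near_scaleR[OF MB \<iota>] smooth_near_const
        section_near_tensor[OF J_tensor] sV sx sn z)
  have ZDo: "Z0 z \<in> Do z" if z: "z \<in> A" for z
  proof -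
    let ?g = "g (\<iota> z)" and ?J = "J (\<iota> z)"
    have ZS: "Z0 z \<in> S z"
      unfolding Z0_def using VS[OF z] JS[OF z] by (intro subspace_add[OF subspaces(3)] subspace_mul[OF subspaces(3)])
    have gZ: "?g (Z0 z) s = ?g (V z) s - ?g (?J (x z + n z)) s" if "s \<in> S z" for s
      unfolding Z0_def using S_tangent[OF VS[OF z]] S_tangent[OF JS[OF z]] S_tangent[OF that]
      by (simp only: g_add_left g_scale_left TM_scale)
    have q0: "real q \<noteq> 0" using q by simp
    \<comment> \<open>As \<open>J\<close> is self-adjoint, \<open>Z0 z\<close> is orthogonal to \<open>J Rad \<oplus> J ltr\<close> if \<open>J (Z0 z)\<close> is orthogonal to
      the frames \<open>\<xi>\<close> and \<open>N\<close>.\<close>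
    have JZ: "?J (Z0 z) \<in> TM (\<iota> z)" using J_tangent[OF S_tangent[OF ZS]] .
    have frame\<xi>: "?g (?J (Z0 z)) (\<xi> j z) = 0" if j: "j < ?m" for j
    proof -
      have "?g (?J (Z0 z)) (\<xi> j z) = ?g (Z0 z) (?J (\<xi> j z))"
        by (rule J_self_adjoint[OF S_tangent[OF ZS] T_tangent[OF \<xi>T[OF j z]]])
      also have "\<dots> = ?g (V z) (?J (\<xi> j z)) - real q * ?g (\<xi> j z) (n z)"
        using gZ[OF J_T_in_S[OF \<xi>T[OF j z]]] g_J_J_mixed(1)[OF xT[OF z] nL[OF z] \<xi>T[OF j z]] by simp
      also have "\<dots> = 0"
        unfolding g\<xi>n[OF z j] using q0 by (simp add: b_def)
      finally show ?thesis .
    qed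
    have frameN: "?g (?J (Z0 z)) (N j z) = 0" if j: "j < ?m" for j
    proof -
      have "?g (?J (Z0 z)) (N j z) = ?g (Z0 z) (?J (N j z))"
        by (rule J_self_adjoint[OF S_tangent[OF ZS] L_tangent[OF NL[OF j z]]])
      also have "\<dots> = ?g (V z) (?J (N j z)) - real q * ?g (x z) (N j z)"
        using gZ[OF J_L_in_S[OF NL[OF j z]]] g_J_J_mixed(2)[OF xT[OF z] nL[OF z] NL[OF j z]] by simp
      also have "\<dots> = 0"
        unfolding gxN[OF z j] using q0 by (simp add: a_def)
      finally show ?thesis .
    qed
    have z2: "z \<in> A2" using z by (simp add: A_def)
    show ?thesis
    proof (rule DoI[OF ZS])
      fix u assume u: "u \<in> T z"
      have "?g (?J (Z0 z)) u = 0"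
      proof (rule span_orthogonal[of "{?J (Z0 z)}" _ "(\<lambda>i. \<xi> i z) ` {..<?m}"])
        show "u \<in> span ((\<lambda>i. \<xi> i z) ` {..<?m})"
          using u smooth_frameD(2)[OF \<xi> z2] by (simp add: Rad_eq_TN)
      qed (use JZ frame\<xi> smooth_frameD(3)[OF \<xi> z2] in \<open>auto intro: span_base\<close>)
      then show "?g (Z0 z) (?J u) = 0"
        using J_self_adjoint[OF S_tangent[OF ZS] T_tangent[OF u]] by simp
    next
      fix u assume u: "u \<in> L z"
      have "?g (?J (Z0 z)) u = 0"
      proof (rule span_orthogonal[of "{?J (Z0 z)}" _ "(\<lambda>i. N i z) ` {..<?m}"])
        show "u \<in> span ((\<lambda>i. N i z) ` {..<?m})"
          using u smooth_frameD(2)[OF N z2] by simp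
      qed (use JZ frameN smooth_frameD(3)[OF N z2] in \<open>auto intro: span_base\<close>)
      then show "?g (Z0 z) (?J u) = 0"
        using J_self_adjoint[OF S_tangent[OF ZS] L_tangent[OF u]] by simp
    qed
  qed
  have "Z0 y = z0"
  proof -
    have "g (\<iota> y) z0 (J (\<iota> y) u + J (\<iota> y) m) = 0" if "u \<in> T y" "m \<in> L y" for u m
      using z0 that unfolding D_o_def subspace_sum_def Rad_eq_TN by blast
    from this[OF _ subspace_0[OF subspaces(2)]] this[OF subspace_0[OF subspaces(1)]]
    have "g (\<iota> y) z0 (J (\<iota> y) u) = 0" "g (\<iota> y) z0 (J (\<iota> y) m) = 0" if "u \<in> T y" "m \<in> L y" for u m
      using that by (simp_all add: J_zero)
    then have "a i y = 0" "b i y = 0" if "i < ?m" for i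
      using \<xi>T[OF that A(2)] NL[OF that A(2)] by (simp_all add: a_def b_def V(3))
    then have "x y = 0" "n y = 0" by (simp_all add: x_def n_def)
    then show ?thesis by (simp add: Z0_def V(3) J_zero)
  qed
  moreover obtain Z where "Z \<in> sections \<B> \<A> \<iota> Do" "Z y = Z0 y"
    using extend_section[OF MB \<iota> A section_near_imp_section_along[OF MB \<iota> A(1) sZ], of Do] ZDo subspace_Do
    by blast
  ultimately show ?thesis using that by simp
qed


section \<open>Characterisation of totally geodesic submanifolds\<close>

lemma orthogonal_sections_derivative:
  assumes V: "snear y V" and V': "snear y V'" and w: "w \<in> TB y"
    and 0: "\<And>z. g (\<iota> z) (V z) (V' z) = 0"
  shows "g (\<iota> y) (D y w V) (V' y) = - g (\<iota> y) (V y) (D y w V')"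
  using metric_compatible[OF V V' w] tangent_const[OF w, of 0] by (simp add: 0)

lemma totally_geodesic_iff:
  "totally_geodesic \<B> \<A> \<iota> D S L \<longleftrightarrow>
    (\<forall>\<xi>\<^sub>1 \<in> tangent_sections \<B> \<A> \<iota> R.
     \<forall>\<xi>\<^sub>2 \<in> tangent_sections \<B> \<A> \<iota> R.
     \<forall>N \<in> sections \<B> \<A> \<iota> L.
     \<forall>Z \<in> sections \<B> \<A> \<iota> Do.
       (\<forall>y. D_l \<B> \<A> \<iota> D S L \<xi>\<^sub>1 (J_along \<A> \<iota> J \<xi>\<^sub>2) y = 0) \<and>
       (\<forall>y. D_l \<B> \<A> \<iota> D S L \<xi>\<^sub>1 Z y = 0) \<and>
       no_component_in_J_Rad \<B> \<A> \<iota> g J (D_s \<B> \<A> \<iota> D S L \<xi>\<^sub>1 N))"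
  (is "?tg \<longleftrightarrow> ?cond")
proof -
  let ?TS = "tangent_sections \<B> \<A> \<iota> R"
  let ?p = "\<lambda>U z. push z (U z)"
  have field: "section_near \<B> \<B> id y X" "X y \<in> TB y" "push y (X y) \<in> T y" "snear y (?p X)"
    if "X \<in> ?TS" for X y
  proof -
    have X: "vector_field \<B> UNIV X" using that by (simp add: tangent_sections_Rad)
    show "section_near \<B> \<B> id y X"
      using X by (rule section_along_near[OF open_UNIV UNIV_I])
    then show "snear y (?p X)" by (rule section_near_pushforward[OF MB MA \<iota>])
    show "X y \<in> TB y" using X by (simp add: section_along_def)
    then show "push y (X y) \<in> T y" by (simp add: TN_def)
  qed
  have sec: "snear y V" "V y \<in> E y" if "V \<in> sections \<B> \<A> \<iota> E" for V E y
    using that section_along_near[OF open_UNIV UNIV_I] by (auto simp: sections_def)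
  have J_sec: "snear y (J_along \<A> \<iota> J X)" if "X \<in> ?TS" for X y
    unfolding J_along_def by (rule section_near_tensor[OF J_tensor field(4)[OF that]])
  \<comment> \<open>The products of \<open>D\<^sub>W U\<close> which test its component in \<open>S(TN\<^sup>\<bottom>)\<close>.\<close>
  have test_J\<xi>: "g (\<iota> y) (D y (W y) (?p U)) (J_along \<A> \<iota> J X y) =
      - g (\<iota> y) (push y (U y)) (D y (W y) (J_along \<A> \<iota> J X))"
    if W: "W \<in> ?TS" and U: "U \<in> ?TS" and X: "X \<in> ?TS" for W U X y
    using g_T_S[OF J_T_in_S[OF field(3)[OF X]] field(3)[OF U]]
    by (intro orthogonal_sections_derivative[OF field(4)[OF U] J_sec[OF X] field(2)[OF W]])
      (simp add: J_along_def)
  have test_Z: "g (\<iota> y) (D y (W y) (?p U)) (Z y) = - g (\<iota> y) (push y (U y)) (D y (W y) Z)"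
    if W: "W \<in> ?TS" and U: "U \<in> ?TS" and Z: "Z \<in> sections \<B> \<A> \<iota> Do" for W U Z y
    using g_T_S[OF Do_in_S[OF sec(2)[OF Z]] field(3)[OF U]]
    by (intro orthogonal_sections_derivative[OF field(4)[OF U] sec(1)[OF Z] field(2)[OF W]])
  have test_JN: "g (\<iota> y) (D y (W y) (?p U)) (J (\<iota> y) (N y)) =
      - g (\<iota> y) (D_s \<B> \<A> \<iota> D S L W N y) (J_along \<A> \<iota> J U y)"
    if W: "W \<in> ?TS" and U: "U \<in> ?TS" and N: "N \<in> sections \<B> \<A> \<iota> L" for W U N y
  proof -
    have DN: "D y (W y) N \<in> TM (\<iota> y)" using D_tangent[OF field(2)[OF W] sec(1)[OF N]] .
    have u: "push y (U y) \<in> T y" using field(3)[OF U] .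
    have "g (\<iota> y) (D y (W y) (?p U)) (J (\<iota> y) (N y)) =
        - g (\<iota> y) (push y (U y)) (D y (W y) (\<lambda>z. J (\<iota> z) (N z)))"
      using g_T_S[OF J_L_in_S[OF sec(2)[OF N]] field(3)[OF U]]
      by (intro orthogonal_sections_derivative[OF field(4)[OF U] section_near_tensor[OF J_tensor sec(1)[OF N]]
            field(2)[OF W]])
    also have "\<dots> = - g (\<iota> y) (push y (U y)) (J (\<iota> y) (D y (W y) N))"
      by (simp only: D_parallel_tensor[OF J_tensor sec(1)[OF N] parallel field(2)[OF W]])
    also have "\<dots> = - g (\<iota> y) (D y (W y) N) (J (\<iota> y) (push y (U y)))"
      using J_self_adjoint[OF DN T_tangent[OF u]] g_sym[OF J_tangent[OF DN] T_tangent[OF u]] by simp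
    also have "\<dots> = - g (\<iota> y) (D_s \<B> \<A> \<iota> D S L W N y) (J_along \<A> \<iota> J U y)"
      using g_str_part[OF DN J_T_in_S[OF u]] by (simp add: D_s_def J_along_def)
    finally show ?thesis .
  qed
  show ?thesis
  proof
    assume tg: ?tg
    have DT: "D y (W y) (?p U) \<in> T y" if W: "W \<in> ?TS" and U: "U \<in> ?TS" for W U y
    proof -
      have 0: "ltrp y (D y (W y) (?p U)) = 0" "strp y (D y (W y) (?p U)) = 0"
        using tg W U by (simp_all add: totally_geodesic_def tangent_sections_Rad h_l_def h_s_def)
      obtain t where t: "t \<in> T y"
        "D y (W y) (?p U) = t + ltrp y (D y (W y) (?p U)) + strp y (D y (W y) (?p U))"
        using parts(1)[OF D_tangent[OF field(2)[OF W] field(4)[OF U]]] by blast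
      have "D y (W y) (?p U) = t"
        using t(2) unfolding 0 by simp
      with t(1) show ?thesis by simp
    qed
    have D_l_0: "D_l \<B> \<A> \<iota> D S L W V y = 0"
      if W: "W \<in> ?TS" and V: "snear y V" and t: "\<And>U. U \<in> ?TS \<Longrightarrow> g (\<iota> y) (push y (U y)) (D y (W y) V) = 0"
      for W V y
    proof -
      have DV: "D y (W y) V \<in> TM (\<iota> y)" using D_tangent[OF field(2)[OF W] V] .
      have "g (\<iota> y) (D y (W y) V) u = 0" if u: "u \<in> T y" for u
      proof -
        obtain U where U: "U \<in> ?TS" "push y (U y) = u" using T_section_through[OF u] by blast
        show ?thesis using t[OF U(1)] g_sym[OF DV T_tangent[OF u]] by (simp only: U(2))
      qed
      then show ?thesis by (simp add: D_l_def ltr_part_eq_0_iff[OF DV])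
    qed
    show ?cond
    proof (intro ballI conjI allI)
      fix W X N Z y
      assume W: "W \<in> ?TS" and X: "X \<in> ?TS" and N: "N \<in> sections \<B> \<A> \<iota> L" and Z: "Z \<in> sections \<B> \<A> \<iota> Do"
      show "D_l \<B> \<A> \<iota> D S L W (J_along \<A> \<iota> J X) y = 0"
      proof (rule D_l_0[OF W J_sec[OF X]])
        fix U assume U: "U \<in> ?TS"
        show "g (\<iota> y) (push y (U y)) (D y (W y) (J_along \<A> \<iota> J X)) = 0"
          using test_J\<xi>[OF W U X, of y] g_T_S[OF J_T_in_S[OF field(3)[OF X]] DT[OF W U]]
          by (simp add: J_along_def)
      qed
      show "D_l \<B> \<A> \<iota> D S L W Z y = 0"
      proof (rule D_l_0[OF W sec(1)[OF Z]])
        fix U assume U: "U \<in> ?TS"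
        show "g (\<iota> y) (push y (U y)) (D y (W y) Z) = 0"
          using test_Z[OF W U Z, of y] g_T_S[OF Do_in_S[OF sec(2)[OF Z]] DT[OF W U]] by simp
      qed
      show "no_component_in_J_Rad \<B> \<A> \<iota> g J (D_s \<B> \<A> \<iota> D S L W N)"
        unfolding no_component_in_J_Rad_def
      proof (intro ballI allI)
        fix U y assume U: "U \<in> ?TS"
        show "g (\<iota> y) (D_s \<B> \<A> \<iota> D S L W N y) (J_along \<A> \<iota> J U y) = 0"
          using test_JN[OF W U N, of y] g_T_S[OF J_L_in_S[OF sec(2)[OF N]] DT[OF W U]] by simp
      qed
    qed
  next
    assume cond: ?cond
    \<comment> \<open>The condition quantifies jointly over \<open>\<xi>\<^sub>2\<close>, \<open>N\<close>, \<open>Z\<close>; its parts separate because there are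
      sections of all three kinds.\<close>
    have zero: "\<exists>X. X \<in> ?TS" "\<exists>N. N \<in> sections \<B> \<A> \<iota> L" "\<exists>Z. Z \<in> sections \<B> \<A> \<iota> Do"
      using T_section_through[OF subspace_0[OF subspaces(1)]] L_section_through[OF subspace_0[OF subspaces(2)]]
        Do_section_through[OF subspace_0[OF subspace_Do]] by metis+
    have c1: "ltrp y (D y (W y) (J_along \<A> \<iota> J X)) = 0" if "W \<in> ?TS" "X \<in> ?TS" for W X y
      using cond that zero unfolding D_l_def by blast
    have c2: "ltrp y (D y (W y) Z) = 0" if "W \<in> ?TS" "Z \<in> sections \<B> \<A> \<iota> Do" for W Z y
      using cond that zero unfolding D_l_def by blast
    have c3: "g (\<iota> y) (D_s \<B> \<A> \<iota> D S L W N y) (J_along \<A> \<iota> J U y) = 0"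
      if "W \<in> ?TS" "N \<in> sections \<B> \<A> \<iota> L" "U \<in> ?TS" for W N U y
      using cond that zero unfolding no_component_in_J_Rad_def by blast
    show ?tg
      unfolding totally_geodesic_def h_l_def h_s_def
    proof (intro allI impI conjI)
      fix W U y assume "vector_field \<B> UNIV W \<and> vector_field \<B> UNIV U"
      then have W: "W \<in> ?TS" and U: "U \<in> ?TS" by (simp_all add: tangent_sections_Rad)
      let ?v = "D y (W y) (?p U)"
      have v: "?v \<in> TM (\<iota> y)" using D_tangent[OF field(2)[OF W] field(4)[OF U]] .
      have ltr0: "g (\<iota> y) (push y (U y)) (D y (W y) V) = 0"
        if V: "snear y V" and 0: "ltrp y (D y (W y) V) = 0" for V
      proof -
        have DV: "D y (W y) V \<in> TM (\<iota> y)" using D_tangent[OF field(2)[OF W] V] .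
        then have "g (\<iota> y) (D y (W y) V) (push y (U y)) = 0"
          using 0 field(3)[OF U] by (simp add: ltr_part_eq_0_iff)
        then show ?thesis using g_sym[OF DV T_tangent[OF field(3)[OF U]]] by simp
      qed
      have "g (\<iota> y) ?v u = 0" if u: "u \<in> T y" for u
      proof -
        obtain X where X: "X \<in> ?TS" "push y (X y) = u" using T_section_through[OF u] by blast
        have "g (\<iota> y) ?v (push y (X y)) = 0"
          using g_T_T
          by (intro isotropic_second_form_tangent field(1) W U X(1)) (auto simp: TN_def)
        then show ?thesis by (simp only: X(2))
      qed
      then show "ltrp y ?v = 0" by (simp add: ltr_part_eq_0_iff[OF v])
      show "strp y ?v = 0"
      proof (rule str_part_eq_0I[OF v])
        fix u assume "u \<in> T y"
        then obtain X where X: "X \<in> ?TS" "push y (X y) = u" using T_section_through by blast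
        then show "g (\<iota> y) ?v (J (\<iota> y) u) = 0"
          using test_J\<xi>[OF W U X(1), of y] ltr0[OF J_sec[OF X(1)] c1[OF W X(1)]]
          by (simp add: J_along_def)
      next
        fix n assume "n \<in> L y"
        then obtain N where N: "N \<in> sections \<B> \<A> \<iota> L" "N y = n" using L_section_through by blast
        then show "g (\<iota> y) ?v (J (\<iota> y) n) = 0"
          using test_JN[OF W U N(1), of y] c3[OF W N(1) U, of y] by simp
      next
        fix z assume "z \<in> Do y"
        then obtain Z where Z: "Z \<in> sections \<B> \<A> \<iota> Do" "Z y = z" using Do_section_through by blast
        then show "g (\<iota> y) ?v z = 0"
          using test_Z[OF W U Z(1), of y] ltr0[OF sec(1)[OF Z(1)] c2[OF W Z(1)]] by simp
      qed
    qed
  qed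
qed

end


theorem theorem3p19:
  fixes p q :: nat
    and \<A> :: "('a::{t2_space, second_countable_topology}, 'e::euclidean_space) atlas"
    and g :: "'a \<Rightarrow> 'a tvec \<Rightarrow> 'a tvec \<Rightarrow> real"
    and J :: "'a \<Rightarrow> 'a tvec \<Rightarrow> 'a tvec"
    and nabla :: "'a \<Rightarrow> 'a tvec \<Rightarrow> ('a \<Rightarrow> 'a tvec) \<Rightarrow> 'a tvec"
    and \<B> :: "('b::{t2_space, second_countable_topology}, 'd::euclidean_space) atlas"
    and \<iota> :: "'b \<Rightarrow> 'a"
    and D :: "'b \<Rightarrow> 'b tvec \<Rightarrow> ('b \<Rightarrow> 'a tvec) \<Rightarrow> 'a tvec"
    and S L :: "'b \<Rightarrow> 'a tvec set"
  assumes "p > 0" and "q > 0"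
    and "locally_metallic p q \<A> g J nabla"
    and "induced_connection \<B> \<A> \<iota> nabla D"
    and "screen_transversal_lightlike_isotropic \<B> \<A> \<iota> g J S"
    and "screen_transversal_bundle \<B> \<A> \<iota> g S"
    and "lightlike_transversal_bundle \<B> \<A> \<iota> g S DIM('d) L"
    and "\<And>y. J (\<iota> y) ` L y \<subseteq> S y"
    and "tangent_decomposition \<B> \<A> \<iota> g J S L"
  shows "totally_geodesic \<B> \<A> \<iota> D S L \<longleftrightarrow>
    (\<forall>\<xi>\<^sub>1 \<in> tangent_sections \<B> \<A> \<iota> (Rad \<B> \<A> \<iota> g).
     \<forall>\<xi>\<^sub>2 \<in> tangent_sections \<B> \<A> \<iota> (Rad \<B> \<A> \<iota> g).
     \<forall>N \<in> sections \<B> \<A> \<iota> L.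
     \<forall>Z \<in> sections \<B> \<A> \<iota> (D_o \<B> \<A> \<iota> g J S L).
       (\<forall>y. D_l \<B> \<A> \<iota> D S L \<xi>\<^sub>1 (J_along \<A> \<iota> J \<xi>\<^sub>2) y = 0) \<and>
       (\<forall>y. D_l \<B> \<A> \<iota> D S L \<xi>\<^sub>1 Z y = 0) \<and>
       no_component_in_J_Rad \<B> \<A> \<iota> g J (D_s \<B> \<A> \<iota> D S L \<xi>\<^sub>1 N))"
proof -
  have "submanifold \<B> \<A> \<iota>"
    using assms(5) by (simp add: screen_transversal_lightlike_isotropic_def isotropic_def lightlike_def)
  then interpret isotropic_screen_transversal \<A> g nabla \<B> \<iota> D p q J S L
    using assms
    by unfold_locales
      (simp_all add: submanifold_def locally_metallic_def metallic_semi_riemannian_def)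
  show ?thesis by (rule totally_geodesic_iff)
qed

end
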